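(* Let $r\ge2$ be an integer, $w(x)=x^\alpha(1-x)^\beta$ with $\alpha,\beta>0$, $\varphi(x)=\sqrt{x(1-x)}$, $0\le\lambda\le1$, and let $B^\ast_{n,r-1}$ be the modified combination of Bernstein operators described in the context. Then there is a constant $C>0$ independent of $n$, $x$ and $f$ such that for $x\in(0,1)$: (i) for every $f\in C_w$, $$|w(x)\varphi^{r\lambda}(x)(B^{\ast}_{n,r-1}(f))^{(r)}(x)|\leqslant C\,n^{r/2}\max\{n^{r(1-\lambda)/2},\varphi^{r(\lambda-1)}(x)\}\,\|wf\|;$$ (ii) for every $f\in W^r_{w,\lambda}$, $$|w(x)\varphi^{r\lambda}(x)(B^{\ast}_{n,r-1}(f))^{(r)}(x)|\leqslant C\,\|w\varphi^{r\lambda}f^{(r)}\|.$$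
   Context: $C_w=\{f\in C((0,1)):\lim_{x\to0}(wf)(x)=\lim_{x\to1}(wf)(x)=0\}$, $\|g\|=\sup_{0\le x\le1}|g(x)|$. $W^r_{w,\lambda}=\{f\in C_w: f^{(r-1)}\text{ absolutely continuous on }(0,1),\ \|w\varphi^{r\lambda}f^{(r)}\|<\infty\}$. Bernstein operators: $B_m(g,x)=\sum_{k=0}^m g(k/m)\binom{m}{k}x^k(1-x)^{m-k}$. Combination: $B_{n,r-1}(g,x)=\sum_{i=0}^{r-2}C_i(n)B_{n_i}(g,x)$, where (a) $n=n_0<n_1<\dots<n_{r-2}\le Cn$, (b) $\sum_i|C_i(n)|\le C$, (c) $\sum_i C_i(n)=1$, (d) $\sum_i C_i(n)n_i^{-k}=0$ for $k=1,\dots,r-2$. Modified operator: $B^\ast_{n,r-1}(f,x)=B_{n,r-1}(F_n,x)$, where: $L_r(f,x)$ is the Lagrange interpolation polynomial of $f$ at nodes $i/n$, $i=1,\dots,r$; $R_r(f,x)$ the one at nodes $1-i/n$, $i=1,\dots,r$; $\psi\in C^\infty(\mathbb R)$, $0\le\psi\le1$, $\psi(t)=0$ for $t\le0$, $\psi(t)=1$ for $t\ge1$; $F_n=f$ on $[2/n,1-2/n]$, $F_n=L_r(f,\cdot)$ on $[0,1/n]$, $F_n(x)=L_r(f,x)+\psi(nx-1)(f(x)-L_r(f,x))$ on $[1/n,2/n]$, $F_n=R_r(f,\cdot)$ on $[1-1/n,1]$, $F_n(x)=R_r(f,x)+\psi(n-nx-1)(f(x)-R_r(f,x))$ on $[1-2/n,1-1/n]$.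 *)

theory Defs
  imports "HOL-Analysis.Analysis"
begin

definition wt :: "real \<Rightarrow> real \<Rightarrow> real \<Rightarrow> real" where
  "wt \<alpha> \<beta> x = x powr \<alpha> * (1 - x) powr \<beta>"

definition phi :: "real \<Rightarrow> real" where
  "phi x = sqrt (x * (1 - x))"

definition Cw :: "real \<Rightarrow> real \<Rightarrow> (real \<Rightarrow> real) set" where
  "Cw \<alpha> \<beta> = {f. continuous_on {0<..<1} f
                 \<and> ((\<lambda>x. wt \<alpha> \<beta> x * f x) \<longlongrightarrow> 0) (at_right 0)
                 \<and> ((\<lambda>x. wt \<alpha> \<beta> x * f x) \<longlongrightarrow> 0) (at_left 1)}"

definition abs_cont_on :: "(real \<Rightarrow> real) \<Rightarrow> real \<Rightarrow> real \<Rightarrow> bool" where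
  "abs_cont_on g a b \<longleftrightarrow>
     (\<forall>\<epsilon>>0. \<exists>\<delta>>0. \<forall>(N::nat) (u::nat \<Rightarrow> real) (v::nat \<Rightarrow> real).
        (\<forall>k<N. a \<le> u k \<and> u k \<le> v k \<and> v k \<le> b)
        \<and> (\<forall>j<N. \<forall>k<N. j \<noteq> k \<longrightarrow> v j \<le> u k \<or> v k \<le> u j)
        \<and> (\<Sum>k<N. v k - u k) < \<delta>
        \<longrightarrow> (\<Sum>k<N. \<bar>g (v k) - g (u k)\<bar>) < \<epsilon>)"

definition abs_cont_loc01 :: "(real \<Rightarrow> real) \<Rightarrow> bool" where
  "abs_cont_loc01 g \<longleftrightarrow> (\<forall>a b. 0 < a \<and> a \<le> b \<and> b < 1 \<longrightarrow> abs_cont_on g a b)"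

definition ac_deriv_class :: "nat \<Rightarrow> (real \<Rightarrow> real) \<Rightarrow> bool" where
  "ac_deriv_class r f \<longleftrightarrow>
     (\<forall>k < r - 1. \<forall>x\<in>{0<..<1}. ((deriv ^^ k) f) differentiable (at x))
     \<and> abs_cont_loc01 ((deriv ^^ (r - 1)) f)"

definition is_rth_deriv :: "nat \<Rightarrow> (real \<Rightarrow> real) \<Rightarrow> (real \<Rightarrow> real) \<Rightarrow> bool" where
  "is_rth_deriv r f g \<longleftrightarrow>
     (AE x in lborel. x \<in> {0<..<1} \<longrightarrow> ((deriv ^^ (r - 1)) f has_real_derivative g x) (at x))"

definition bernstein :: "nat \<Rightarrow> (real \<Rightarrow> real) \<Rightarrow> real \<Rightarrow> real" where
  "bernstein m g x = (\<Sum>k=0..m. g (real k / real m) * real (m choose k) * x ^ k * (1 - x) ^ (m - k))"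

definition comb_bernstein ::
  "nat \<Rightarrow> (nat \<Rightarrow> nat \<Rightarrow> nat) \<Rightarrow> (nat \<Rightarrow> nat \<Rightarrow> real) \<Rightarrow> nat \<Rightarrow> (real \<Rightarrow> real) \<Rightarrow> real \<Rightarrow> real" where
  "comb_bernstein r nn c n g x = (\<Sum>i=0..r-2. c n i * bernstein (nn n i) g x)"

definition lagrange_interp :: "(nat \<Rightarrow> real) \<Rightarrow> nat set \<Rightarrow> (real \<Rightarrow> real) \<Rightarrow> real \<Rightarrow> real" where
  "lagrange_interp xs I f x =
     (\<Sum>i\<in>I. f (xs i) * (\<Prod>j\<in>I - {i}. (x - xs j) / (xs i - xs j)))"

definition Lr :: "nat \<Rightarrow> nat \<Rightarrow> (real \<Rightarrow> real) \<Rightarrow> real \<Rightarrow> real" where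
  "Lr r n f = lagrange_interp (\<lambda>i. real i / real n) {1..r} f"

definition Rr :: "nat \<Rightarrow> nat \<Rightarrow> (real \<Rightarrow> real) \<Rightarrow> real \<Rightarrow> real" where
  "Rr r n f = lagrange_interp (\<lambda>i. 1 - real i / real n) {1..r} f"

text \<open>The modified function F_n (values outside [0,1] are irrelevant).\<close>
definition Fn :: "(real \<Rightarrow> real) \<Rightarrow> nat \<Rightarrow> nat \<Rightarrow> (real \<Rightarrow> real) \<Rightarrow> real \<Rightarrow> real" where
  "Fn \<psi> r n f x =
     (if x \<le> 1 / real n then Lr r n f x
      else if x \<le> 2 / real n then Lr r n f x + \<psi> (real n * x - 1) * (f x - Lr r n f x)
      else if x < 1 - 2 / real n then f x
      else if x < 1 - 1 / real n then Rr r n f x + \<psi> (real n - real n * x - 1) * (f x - Rr r n f x)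
      else Rr r n f x)"

definition Bstar ::
  "(real \<Rightarrow> real) \<Rightarrow> nat \<Rightarrow> (nat \<Rightarrow> nat \<Rightarrow> nat) \<Rightarrow> (nat \<Rightarrow> nat \<Rightarrow> real) \<Rightarrow> nat \<Rightarrow> (real \<Rightarrow> real) \<Rightarrow> real \<Rightarrow> real" where
  "Bstar \<psi> r nn c n f = comb_bernstein r nn c n (Fn \<psi> r n f)"

text \<open>Admissible indices n: the construction needs 2/n <= 1-2/n and the interpolation nodes
  i/n, 1-i/n (i=1..r) to lie in (0,1).\<close>
definition admissible :: "nat \<Rightarrow> nat \<Rightarrow> bool" where
  "admissible r n \<longleftrightarrow> 4 \<le> n \<and> r < n"

definition comb_conditions :: "nat \<Rightarrow> (nat \<Rightarrow> nat \<Rightarrow> nat) \<Rightarrow> (nat \<Rightarrow> nat \<Rightarrow> real) \<Rightarrow> real \<Rightarrow> nat \<Rightarrow> bool" where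
  "comb_conditions r nn c A n \<longleftrightarrow>
     nn n 0 = n \<and> (\<forall>i. i < r - 2 \<longrightarrow> nn n i < nn n (Suc i))
     \<and> real (nn n (r - 2)) \<le> A * real n
     \<and> (\<Sum>i=0..r-2. \<bar>c n i\<bar>) \<le> A
     \<and> (\<Sum>i=0..r-2. c n i) = 1
     \<and> (\<forall>k\<in>{1..r-2}. (\<Sum>i=0..r-2. c n i / real (nn n i) ^ k) = 0)"

definition smooth_fun :: "(real \<Rightarrow> real) \<Rightarrow> bool" where
  "smooth_fun \<psi> \<longleftrightarrow> (\<forall>k x. ((deriv ^^ k) \<psi>) differentiable (at x))"

end

theory Submission
  imports Defs "HOL-Computational_Algebra.Polynomial"
begin

text \<open>
  Each Bernstein operator \<open>B\<^sub>m\<close> of the combination, \<open>n \<le> m \<le> A n\<close>, satisfies the estimates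
  separately; of the conditions on the coefficients only the boundedness of their absolute sum matters.

  The weight is absorbed by the inequality
  \<open>w(x) \<Sum>\<^sub>k (N/(k+1))\<^sup>\<alpha> (N/(N-k+1))\<^sup>\<beta> p\<^bsub>N,k\<^esub>(x) \<le> C\<close>, which for integer exponents follows
  because \<open>p\<^bsub>N,k\<^esub>\<close> divided by products of factors \<open>k+i\<close> and \<open>N-k+i\<close> is a multiple of a Bernstein
  basis polynomial of higher degree.

  For (i), \<open>|F\<^sub>n(k/m)|\<close> is bounded by \<open>\<parallel>wf\<parallel>\<close> times these node weights. Writing \<open>B\<^sub>m\<^sup>(\<^sup>r\<^sup>)\<close> through \<open>r\<close>-th
  differences bounds \<open>w B\<^sub>m\<^sup>(\<^sup>r\<^sup>)\<close> by \<open>n\<^sup>r\<close>. If \<open>n \<phi>\<^sup>2 \<ge> 1\<close>, differentiating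
  \<open>x(1-x) p' = (k-mx) p\<close> repeatedly gives
  \<open>(\<phi>/\<surd>m)\<^sup>r |p\<^sup>(\<^sup>r\<^sup>)| \<le> C (1+|z|)\<^sup>r p\<close> with \<open>z = (k-mx)/(\<surd>m \<phi>)\<close>, and exponential moments bound
  \<open>\<Sum>\<^sub>k (1+|z|)\<^sup>2\<^sup>r p\<close>; hence \<open>w \<phi>\<^sup>r B\<^sub>m\<^sup>(\<^sup>r\<^sup>)\<close> is bounded by \<open>n\<^bsup>r/2\<^esup>\<close>.

  For (ii), \<open>f\<^bsup>(r-1)\<^esup>\<close> is locally Lipschitz with constants governed by \<open>1/(w \<phi>\<^bsup>r\<lambda>\<^esup>)\<close>. As \<open>F\<^sub>n\<close> depends only on
  the values of \<open>f\<close> on \<open>[1/n, 1-1/n]\<close>, \<open>f\<close> may be replaced outside by its Taylor polynomials; the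
  interpolation errors on the boundary layers are controlled by Rolle's theorem, and a product rule for differences
  bounds the \<open>r\<close>-th differences of \<open>F\<^sub>n\<close> by \<open>m\<^bsup>-r\<^esup>\<close> times the node weights.
\<close>

section \<open>Absolutely continuous functions with bounded derivative\<close>

text \<open>Take a tagged division fine for a gauge that linearises \<open>h\<close> at the good points and stays inside a small
  open set around the exceptional null set: absolute continuity controls the pieces tagged there.\<close>

lemma abs_cont_on_deriv_bound:
  fixes h :: "real \<Rightarrow> real"
  assumes ab: "a \<le> b" and ac: "abs_cont_on h a b"
    and der: "AE x in lborel. x \<in> {a..b} \<longrightarrow> (\<exists>d. (h has_real_derivative d) (at x) \<and> \<bar>d\<bar> \<le> K)"
  shows "\<bar>h b - h a\<bar> \<le> K * (b - a)"
proof (rule field_le_epsilon)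
  fix e :: real assume e: "0 < e"
  \<comment> \<open>The intervals with good tags lose \<open>\<epsilon> * (b - a)\<close> and the
    remaining ones less than \<open>\<epsilon>\<close>, which together make up
    \<open>e\<close>.\<close>
  define \<epsilon> where "\<epsilon> = e / (b - a + 1)"
  have \<epsilon>: "\<epsilon> > 0" using e ab by (simp add: \<epsilon>_def)
  obtain E where E: "E \<in> null_sets lborel"
    and der': "\<And>x. x \<in> {a..b} - E \<Longrightarrow> \<exists>d. (h has_real_derivative d) (at x) \<and> \<bar>d\<bar> \<le> K"
    using AE_E3[OF der] by (metis (mono_tags, lifting) DiffD1 DiffD2 DiffI UNIV_I space_borel space_lborel)
  obtain \<delta> where \<delta>: "\<delta> > 0" and ac\<delta>:
    "\<forall>N u v. (\<forall>k<N. a \<le> u k \<and> u k \<le> v k \<and> v k \<le> b)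
        \<and> (\<forall>j<N. \<forall>k<N. j \<noteq> k \<longrightarrow> v j \<le> u k \<or> v k \<le> u j)
        \<and> (\<Sum>k<N. v k - u k) < \<delta> \<longrightarrow> (\<Sum>k<(N::nat). \<bar>h (v k) - h (u k)\<bar>) < \<epsilon>"
    using ac[unfolded abs_cont_on_def, THEN spec, THEN mp, OF \<epsilon>] by (elim exE conjE)
  have El: "E \<in> null_sets lebesgue" using E by (rule null_sets_completionI)
  \<comment> \<open>As \<open>E\<close> is null, \<open>G\<close> itself has measure below
    \<open>\<delta>\<close>, the threshold that absolute continuity supplies for
    \<open>\<epsilon>\<close>.\<close>
  then obtain G where G: "open G" "E \<subseteq> G" "(G - E) \<in> lmeasurable" "emeasure lebesgue (G - E) < ennreal \<delta>"
    using sets_lebesgue_outer_open[of E \<delta>] \<delta> by (metis null_setsD2)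
  have Gsets: "G \<in> sets lebesgue" using G(1) by (simp add: borel_open)
  have eqG: "emeasure lebesgue G = emeasure lebesgue (G - E)"
    using emeasure_Diff_null_set[OF El Gsets] by simp
  have Gl: "G \<in> lmeasurable"
    using Gsets eqG G(4) by (intro fmeasurableI) (auto simp: less_top[symmetric] top.extremum_strict)
  have Gm: "measure lebesgue G < \<delta>"
  proof -
    have "ennreal (measure lebesgue G) < ennreal \<delta>"
      using eqG G(4) emeasure_eq_measure2[OF Gl] by simp
    then show ?thesis by (simp add: ennreal_less_iff)
  qed
  have loc: "\<exists>d>0. \<forall>y. \<bar>y - x\<bar> < d \<longrightarrow> \<bar>h y - h x\<bar> \<le> (K + \<epsilon>) * \<bar>y - x\<bar>" if x: "x \<in> {a..b} - E" for x
  proof -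
    obtain D where D: "(h has_real_derivative D) (at x)" "\<bar>D\<bar> \<le> K" using der'[OF x] by blast
    have "(h has_derivative (\<lambda>t. D * t)) (at x)" using D(1) by (simp add: has_field_derivative_def)
    then obtain d where d: "d > 0" "\<And>y. norm (y - x) < d \<Longrightarrow> norm (h y - h x - D * (y - x)) \<le> \<epsilon> * norm (y - x)"
      using \<epsilon> unfolding has_derivative_at_alt by blast
    have "\<bar>h y - h x\<bar> \<le> (K + \<epsilon>) * \<bar>y - x\<bar>" if "\<bar>y - x\<bar> < d" for y
    proof -
      have "\<bar>h y - h x - D * (y - x)\<bar> \<le> \<epsilon> * \<bar>y - x\<bar>" using d(2)[of y] that by simp
      moreover have "\<bar>D * (y - x)\<bar> \<le> K * \<bar>y - x\<bar>" using D(2) by (simp add: abs_mult mult_right_mono)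
      ultimately show ?thesis by (simp add: distrib_right)
    qed
    then show ?thesis using d(1) by blast
  qed
  then obtain d where d: "\<And>x. x \<in> {a..b} - E \<Longrightarrow> d x > 0"
    "\<And>x y. x \<in> {a..b} - E \<Longrightarrow> \<bar>y - x\<bar> < d x \<Longrightarrow> \<bar>h y - h x\<bar> \<le> (K + \<epsilon>) * \<bar>y - x\<bar>"
    by metis
  define \<gamma> where "\<gamma> x = (if x \<in> E then G else if x \<in> {a..b} then ball x (d x) else UNIV)" for x
  have "gauge \<gamma>" unfolding gauge_def \<gamma>_def using G(1,2) d(1) by auto
  then obtain p where p: "p tagged_division_of {a..b}" "\<gamma> fine p"
    by (rule fine_division_exists_real)
  note pD = tagged_division_ofD[OF p(1)]
  have pint: "\<exists>u v. K' = {u..v} \<and> u \<le> x \<and> x \<le> v \<and> a \<le> u \<and> v \<le> b" if pk: "(x, K') \<in> p" for x K'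
  proof -
    obtain u v where uv: "K' = {u..v}" using pD(4)[OF pk] by auto
    have "x \<in> K'" "K' \<subseteq> {a..b}" using pD(2,3)[OF pk] by auto
    then show ?thesis using uv by auto
  qed
  define inc where "inc = (\<lambda>(x::real,K'). h (Sup K') - h (Inf K'))"
  define len where "len = (\<lambda>(x::real,K'). Sup K' - Inf K' :: real)"
  \<comment> \<open>Degenerate intervals tagged in \<open>E\<close> have zero increment and count as
    good. The members of \<open>p2\<close> thus have nonempty interior, and disjointness of the
    interiors puts their end points in order.\<close>
  define p2 where "p2 = {(x,K') \<in> p. x \<in> E \<and> Inf K' < Sup K'}"
  have fin: "finite p" using pD(1) .
  have p2p: "p2 \<subseteq> p" by (auto simp: p2_def)
  have fin2: "finite p2" using fin p2p by (rule finite_subset[rotated])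
  have suminc: "sum inc p = h b - h a"
    unfolding inc_def by (rule additive_tagged_division_1[OF ab p(1)])
  have sumlen: "sum len p = b - a"
    unfolding len_def by (rule additive_tagged_division_1[OF ab p(1), of "\<lambda>x. x"])
  have lennn: "len q \<ge> 0" if "q \<in> p" for q
    using that pint[of "fst q" "snd q"] by (auto simp: len_def split: prod.splits)
  have good: "\<bar>inc q\<bar> \<le> (K + \<epsilon>) * len q" if qp: "q \<in> p - p2" for q
  proof -
    obtain x K' where q: "q = (x, K')" by force
    then obtain u v where uv: "K' = {u..v}" "u \<le> x" "x \<le> v" "a \<le> u" "v \<le> b"
      using pint[of x K'] qp by auto
    show ?thesis
    proof (cases "x \<in> E")
      case True
      then have "u = v" using qp q uv by (auto simp: p2_def)
      then show ?thesis using q uv by (simp add: inc_def len_def)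
    next
      case False
      then have x: "x \<in> {a..b} - E" using uv by auto
      have "K' \<subseteq> ball x (d x)" using fineD[OF p(2), of x K'] qp q x by (auto simp: \<gamma>_def)
      moreover have "u \<in> K'" "v \<in> K'" using uv by auto
      ultimately have "u \<in> ball x (d x)" "v \<in> ball x (d x)" by blast+
      then have "\<bar>h u - h x\<bar> \<le> (K + \<epsilon>) * \<bar>u - x\<bar>" "\<bar>h v - h x\<bar> \<le> (K + \<epsilon>) * \<bar>v - x\<bar>"
        using d(2)[OF x] by (auto simp: dist_real_def abs_minus_commute)
      moreover have "(K + \<epsilon>) * \<bar>u - x\<bar> + (K + \<epsilon>) * \<bar>v - x\<bar> = (K + \<epsilon>) * (v - u)"
        using uv by (simp add: algebra_simps)
      ultimately have "\<bar>h v - h u\<bar> \<le> (K + \<epsilon>) * (v - u)" by linarith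
      then show ?thesis using q uv by (simp add: inc_def len_def)
    qed
  qed
  \<comment> \<open>\<open>K\<close> comes without a sign. For \<open>a < b\<close> the null set
    cannot cover \<open>{a..b}\<close>, and the derivative bound at a remaining point forces
    \<open>K\<close> to be nonnegative.\<close>
  have Keps: "K + \<epsilon> \<ge> 0" if "a < b"
  proof -
    have "\<not> {a..b} \<subseteq> E"
    proof
      assume "{a..b} \<subseteq> E"
      then have "emeasure lborel {a..b} \<le> emeasure lborel E" using E by (intro emeasure_mono) auto
      then show False using E \<open>a < b\<close> by (auto simp: null_sets_def)
    qed
    then obtain x where "x \<in> {a..b} - E" by blast
    from der'[OF this] \<epsilon> show ?thesis by auto
  qed
  have S1: "(\<Sum>q\<in>p - p2. \<bar>inc q\<bar>) \<le> (K + \<epsilon>) * (b - a)"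
  proof -
    have "(\<Sum>q\<in>p - p2. \<bar>inc q\<bar>) \<le> (\<Sum>q\<in>p - p2. (K + \<epsilon>) * len q)"
      by (rule sum_mono) (use good in auto)
    also have "\<dots> = (K + \<epsilon>) * (\<Sum>q\<in>p - p2. len q)" by (simp add: sum_distrib_left)
    also have "\<dots> \<le> (K + \<epsilon>) * (b - a)"
    proof (cases "a < b")
      case True
      have "(\<Sum>q\<in>p - p2. len q) \<le> sum len p" using fin lennn by (intro sum_mono2) auto
      then show ?thesis using Keps[OF True] sumlen by (simp add: mult_left_mono)
    next
      case False
      then have "sum len p = 0" using sumlen ab by simp
      then have "\<forall>q\<in>p. len q = 0" using sum_nonneg_eq_0_iff[OF fin] lennn by blast
      then have "(\<Sum>q\<in>p - p2. len q) = 0" by (intro sum.neutral) auto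
      then show ?thesis using False ab by simp
    qed
    finally show ?thesis .
  qed
  obtain en where en: "bij_betw en {..<card p2} p2"
    using ex_bij_betw_nat_finite[OF fin2] by (auto simp: atLeast0LessThan)
  have en_in: "en j \<in> p2" if "j < card p2" for j using en that by (auto simp: bij_betw_def)
  define u where "u j = Inf (snd (en j))" for j
  define v where "v j = Sup (snd (en j))" for j
  have uv: "snd (en j) = {u j..v j} \<and> a \<le> u j \<and> u j < v j \<and> v j \<le> b \<and> fst (en j) \<in> E \<and> (fst (en j), snd (en j)) \<in> p"
    if "j < card p2" for j
  proof -
    obtain x K' where q: "en j = (x, K')" by force
    have "(x, K') \<in> p" "x \<in> E" "Inf K' < Sup K'" using en_in[OF that] q by (auto simp: p2_def)
    then show ?thesis using pint[of x K'] q by (auto simp: u_def v_def)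
  qed
  have disj: "{u j<..<v j} \<inter> {u k<..<v k} = {}" if "j < card p2" "k < card p2" "j \<noteq> k" for j k
  proof -
    have "en j \<noteq> en k" using en that by (auto simp: bij_betw_def inj_on_def)
    then have ne: "(fst (en j), snd (en j)) \<noteq> (fst (en k), snd (en k))" by simp
    have "interior (snd (en j)) \<inter> interior (snd (en k)) = {}"
      by (rule pD(5)[OF _ _ ne]) (use uv[OF that(1)] uv[OF that(2)] in blast)+
    then show ?thesis using uv[OF that(1)] uv[OF that(2)] by simp
  qed
  have order: "v j \<le> u k \<or> v k \<le> u j" if "j < card p2" "k < card p2" "j \<noteq> k" for j k
  proof (rule ccontr)
    assume "\<not> ?thesis"
    then have "max (u j) (u k) < min (v j) (v k)" using uv[OF that(1)] uv[OF that(2)] by auto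
    then obtain t where "max (u j) (u k) < t" "t < min (v j) (v k)" using dense by blast
    then have "t \<in> {u j<..<v j} \<inter> {u k<..<v k}" by auto
    then show False using disj[OF that] by auto
  qed
  \<comment> \<open>The intervals of \<open>p2\<close> do not overlap and, by fineness at tags in
    \<open>E\<close>, lie in \<open>G\<close>; their total length is therefore below
    \<open>\<delta>\<close>.\<close>
  have "(\<Sum>k<card p2. v k - u k) = (\<Sum>k<card p2. measure lebesgue {u k<..<v k})"
    using uv by (intro sum.cong) (auto simp: less_imp_le)
  also have "\<dots> = measure lebesgue (\<Union>k<card p2. {u k<..<v k})"
    using disj by (subst measure_UNION') (auto simp: pairwise_def disjnt_def)
  also have "\<dots> \<le> measure lebesgue G"
  proof (rule measure_mono_fmeasurable)
    show "(\<Union>k<card p2. {u k<..<v k}) \<subseteq> G"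
    proof clarsimp
      fix k t assume k: "k < card p2" and t: "u k < t" "t < v k"
      have "snd (en k) \<subseteq> \<gamma> (fst (en k))" using fineD[OF p(2)] uv[OF k] by blast
      then show "t \<in> G" using uv[OF k] t by (auto simp: \<gamma>_def)
    qed
  qed (use Gl in auto)
  finally have "(\<Sum>k<card p2. v k - u k) < \<delta>" using Gm by simp
  then have "(\<Sum>k<card p2. \<bar>h (v k) - h (u k)\<bar>) < \<epsilon>"
    using uv order by (intro ac\<delta>[rule_format]) (auto simp: less_imp_le)
  moreover have "(\<Sum>k<card p2. \<bar>h (v k) - h (u k)\<bar>) = (\<Sum>q\<in>p2. \<bar>inc q\<bar>)"
    by (subst sum.reindex_bij_betw[OF en, symmetric])
      (auto simp: inc_def u_def v_def split: prod.splits intro!: sum.cong)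
  ultimately have S2: "(\<Sum>q\<in>p2. \<bar>inc q\<bar>) < \<epsilon>" by simp
  have "\<bar>h b - h a\<bar> \<le> (\<Sum>q\<in>p. \<bar>inc q\<bar>)" unfolding suminc[symmetric] by (rule sum_abs)
  also have "\<dots> = (\<Sum>q\<in>p - p2. \<bar>inc q\<bar>) + (\<Sum>q\<in>p2. \<bar>inc q\<bar>)"
    by (rule sum.subset_diff[OF p2p fin])
  also have "\<dots> \<le> (K + \<epsilon>) * (b - a) + \<epsilon>" using S1 S2 by linarith
  also have "\<dots> = K * (b - a) + \<epsilon> * (b - a + 1)" by (simp add: algebra_simps)
  also have "\<epsilon> * (b - a + 1) = (e::real)" using ab unfolding \<epsilon>_def by simp
  finally show "\<bar>h b - h a\<bar> \<le> K * (b - a) + e" .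
qed

section \<open>Forward differences and derivatives of Bernstein sums\<close>

text \<open>Iterated forward difference. The recursion differences the sequence first, which suits
  inductions that replace the function; \<open>ndiff_Suc_right\<close> is the form that differences
  the result.\<close>

fun ndiff :: "nat \<Rightarrow> (nat \<Rightarrow> real) \<Rightarrow> nat \<Rightarrow> real" where
  "ndiff 0 a = a"
| "ndiff (Suc i) a = ndiff i (\<lambda>k. a (Suc k) - a k)"

text \<open>The coefficients form an arbitrary sequence, not samples of a function, so that
  derivatives, with differenced coefficients and lower degree, are again of this form.\<close>

definition bern_sum :: "nat \<Rightarrow> (nat \<Rightarrow> real) \<Rightarrow> real \<Rightarrow> real" where
  "bern_sum N a x = (\<Sum>k\<le>N. a k * Bernstein N k x)"

text \<open>De Casteljau's recursion, from which the derivative formula follows by induction on the degree.\<close>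

lemma bern_sum_Suc:
  "bern_sum (Suc N) a x = (1 - x) * bern_sum N a x + x * bern_sum N (\<lambda>k. a (Suc k)) x"
proof -
  have B: "Bernstein (Suc N) (Suc k) x = (1 - x) * Bernstein N (Suc k) x + x * Bernstein N k x" for k
  proof (cases "k < N")
    case True
    then have "N - k = Suc (N - Suc k)" by simp
    then show ?thesis by (simp add: Bernstein_def algebra_simps)
  next
    case False
    then show ?thesis by (simp add: Bernstein_def binomial_eq_0)
  qed
  have 0: "Bernstein (Suc N) 0 x = (1 - x) * Bernstein N 0 x" by (simp add: Bernstein_def)
  have "bern_sum (Suc N) a x = a 0 * Bernstein (Suc N) 0 x + (\<Sum>k\<le>N. a (Suc k) * Bernstein (Suc N) (Suc k) x)"
    unfolding bern_sum_def by (rule sum.atMost_Suc_shift)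
  also have "\<dots> = (1 - x) * (a 0 * Bernstein N 0 x + (\<Sum>k\<le>N. a (Suc k) * Bernstein N (Suc k) x))
      + x * (\<Sum>k\<le>N. a (Suc k) * Bernstein N k x)"
    unfolding B 0 by (simp add: distrib_left sum.distrib sum_distrib_left mult_ac)
  also have "a 0 * Bernstein N 0 x + (\<Sum>k\<le>N. a (Suc k) * Bernstein N (Suc k) x)
      = (\<Sum>k\<le>Suc N. a k * Bernstein N k x)"
    by (rule sum.atMost_Suc_shift[symmetric])
  also have "\<dots> = bern_sum N a x" by (simp add: bern_sum_def Bernstein_def)
  finally show ?thesis by (simp add: bern_sum_def)
qed

lemma bern_sum_0: "bern_sum 0 a x = a 0"
  by (simp add: bern_sum_def Bernstein_def)

lemma bern_sum_diff: "bern_sum N (\<lambda>k. a k - b k) x = bern_sum N a x - bern_sum N b x"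
  by (simp add: bern_sum_def algebra_simps sum_subtractf)

lemma DERIV_bern_sum:
  "(bern_sum (Suc N) a has_real_derivative real (Suc N) * bern_sum N (\<lambda>k. a (Suc k) - a k) x) (at x)"
proof (induction N arbitrary: a)
  case 0
  have "bern_sum (Suc 0) a = (\<lambda>x. (1 - x) * a 0 + x * a 1)"
    by (rule ext) (simp add: bern_sum_Suc bern_sum_0)
  then show ?case by (auto simp: bern_sum_0 intro!: derivative_eq_intros)
next
  case (Suc N)
  have e: "bern_sum (Suc (Suc N)) a = (\<lambda>x. (1 - x) * bern_sum (Suc N) a x + x * bern_sum (Suc N) (\<lambda>k. a (Suc k)) x)"
    by (rule ext) (rule bern_sum_Suc)
  show ?case unfolding e
    by (rule derivative_eq_intros Suc.IH refl)+
      (simp add: bern_sum_diff bern_sum_Suc algebra_simps)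
qed

text \<open>\<open>deriv\<close> is total and carries no differentiability; a chain of true
  derivatives, valid at every point, determines its iterates as functions.\<close>

lemma funpow_deriv_chain:
  fixes E :: "nat \<Rightarrow> real \<Rightarrow> real"
  assumes "\<And>i x. i < r \<Longrightarrow> (E i has_real_derivative E (Suc i) x) (at x)"
  shows "(deriv ^^ r) (E 0) = E r"
  using assms
proof (induction r)
  case (Suc r)
  then have "(deriv ^^ r) (E 0) = E r" by simp
  moreover have "deriv (E r) = E (Suc r)" using Suc.prems by (auto intro!: DERIV_imp_deriv)
  ultimately show ?case by simp
qed simp

lemma ndiff_Suc_right: "ndiff (Suc i) a k = ndiff i a (Suc k) - ndiff i a k"
proof (induction i arbitrary: a)
  case (Suc i)
  show ?case by (subst ndiff.simps(2), subst Suc.IH) simp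
qed simp

lemma funpow_deriv_bern_sum:
  assumes "r \<le> m"
  shows "(deriv ^^ r) (bern_sum m a) = (\<lambda>x. (\<Prod>i<r. real (m - i)) * bern_sum (m - r) (ndiff r a) x)"
proof -
  define E where "E i x = (\<Prod>j<i. real (m - j)) * bern_sum (m - i) (ndiff i a) x" for i x
  have "(E i has_real_derivative E (Suc i) x) (at x)" if "i < r" for i x
  proof -
    have mi: "m - i = Suc (m - Suc i)" using that assms by simp
    have eq: "E i = (\<lambda>x. (\<Prod>j<i. real (m - j)) * bern_sum (Suc (m - Suc i)) (ndiff i a) x)"
      using mi by (simp add: E_def fun_eq_iff)
    have nd: "ndiff (Suc i) a = (\<lambda>k. ndiff i a (Suc k) - ndiff i a k)"
      by (rule ext) (rule ndiff_Suc_right)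
    show ?thesis unfolding eq
      by (rule derivative_eq_intros DERIV_bern_sum refl)+ (use mi in \<open>simp add: E_def nd del: ndiff.simps\<close>)
  qed
  then have fd: "(deriv ^^ r) (E 0) = E r" by (rule funpow_deriv_chain)
  have E0: "E 0 = bern_sum m a" by (simp add: E_def fun_eq_iff)
  show ?thesis using fd unfolding E0 by (simp add: E_def fun_eq_iff)
qed

lemma abs_ndiff_le:
  assumes "\<And>j. j \<le> i \<Longrightarrow> \<bar>a (k + j)\<bar> \<le> T"
  shows "\<bar>ndiff i a k\<bar> \<le> 2 ^ i * T"
  using assms
proof (induction i arbitrary: k)
  case (Suc i)
  have "\<bar>ndiff i a (Suc k)\<bar> \<le> 2 ^ i * T" "\<bar>ndiff i a k\<bar> \<le> 2 ^ i * T"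
    using Suc.prems[of "Suc _"] Suc.prems by (auto intro!: Suc.IH)
  then show ?case unfolding ndiff_Suc_right by simp
qed (use assms[of 0] in auto)

lemma ndiff_add: "ndiff i (\<lambda>k. a k + b k) k = ndiff i a k + ndiff i b k"
  by (induction i arbitrary: k) (simp_all add: ndiff_Suc_right del: ndiff.simps(2))

text \<open>Discrete Leibniz rule: a difference of the product falls on \<open>a\<close> with
  \<open>b\<close> shifted, or on \<open>b\<close>, so geometric bounds with ratios \<open>t\<close>
  and \<open>v\<close> combine as in the binomial expansion of \<open>(t + v) ^ i\<close>. Bounds on
  the factors are asked for only inside the window from \<open>k\<close> to \<open>k + i\<close>, so
  that local information suffices.\<close>

lemma abs_ndiff_mult_le:
  assumes "\<And>j k'. j \<le> i \<Longrightarrow> k \<le> k' \<Longrightarrow> k' + j \<le> k + i \<Longrightarrow> \<bar>ndiff j a k'\<bar> \<le> A * t ^ j"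
    and "\<And>j k'. j \<le> i \<Longrightarrow> k \<le> k' \<Longrightarrow> k' + j \<le> k + i \<Longrightarrow> \<bar>ndiff j b k'\<bar> \<le> B * v ^ j"
    and "0 \<le> A" "0 \<le> t"
  shows "\<bar>ndiff i (\<lambda>k. a k * b k) k\<bar> \<le> A * B * (t + v) ^ i"
  using assms
proof (induction i arbitrary: a b A B)
  case 0
  from 0(1)[of 0 k] 0(2)[of 0 k] 0(3) show ?case by (simp add: abs_mult mult_mono)
next
  case (Suc i)
  have e: "(\<lambda>k. a (Suc k) * b (Suc k) - a k * b k)
      = (\<lambda>k. (a (Suc k) - a k) * b (Suc k) + a k * (b (Suc k) - b k))"
    by (auto simp: algebra_simps)
  have sh: "ndiff j (\<lambda>k. b (Suc k)) k' = ndiff j b (Suc k')" for j k'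
    by (induction j arbitrary: k') (simp_all add: ndiff_Suc_right del: ndiff.simps(2))
  have 1: "\<bar>ndiff i (\<lambda>k. (a (Suc k) - a k) * b (Suc k)) k\<bar> \<le> (A * t) * B * (t + v) ^ i"
  proof (rule Suc.IH)
    fix j k' assume "j \<le> i" "k \<le> k'" "k' + j \<le> k + i"
    then show "\<bar>ndiff j (\<lambda>k. a (Suc k) - a k) k'\<bar> \<le> A * t * t ^ j"
      "\<bar>ndiff j (\<lambda>k. b (Suc k)) k'\<bar> \<le> B * v ^ j"
      using Suc.prems(1)[of "Suc j" k'] Suc.prems(2)[of j "Suc k'"] by (simp_all add: sh)
  qed (use Suc.prems in auto)
  have 2: "\<bar>ndiff i (\<lambda>k. a k * (b (Suc k) - b k)) k\<bar> \<le> A * (B * v) * (t + v) ^ i"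
  proof (rule Suc.IH)
    fix j k' assume "j \<le> i" "k \<le> k'" "k' + j \<le> k + i"
    then show "\<bar>ndiff j a k'\<bar> \<le> A * t ^ j" "\<bar>ndiff j (\<lambda>k. b (Suc k) - b k) k'\<bar> \<le> B * v * v ^ j"
      using Suc.prems(1)[of j k'] Suc.prems(2)[of "Suc j" k'] by simp_all
  qed (use Suc.prems in auto)
  have "\<bar>ndiff (Suc i) (\<lambda>k. a k * b k) k\<bar>
      \<le> \<bar>ndiff i (\<lambda>k. (a (Suc k) - a k) * b (Suc k)) k\<bar> + \<bar>ndiff i (\<lambda>k. a k * (b (Suc k) - b k)) k\<bar>"
    by (simp add: e ndiff_add abs_triangle_ineq)
  also have "\<dots> \<le> (A * t) * B * (t + v) ^ i + A * (B * v) * (t + v) ^ i" using 1 2 by linarith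
  also have "\<dots> = A * B * (t + v) ^ Suc i" by (simp add: algebra_simps)
  finally show ?case .
qed

section \<open>Weighted sums and moments of the Bernstein basis\<close>

lemma fact_add_le: "fact (k + a) \<le> (fact k * fact a * (real k + 1) ^ a :: real)"
proof (induction a)
  case (Suc a)
  have "real (k + Suc a) \<le> real (Suc a) * (real k + 1)" by (simp add: algebra_simps)
  then have "real (k + Suc a) * fact (k + a) \<le> (real (Suc a) * (real k + 1)) * (fact k * fact a * (real k + 1) ^ a)"
    using Suc by (intro mult_mono) auto
  then show ?case by (simp add: algebra_simps)
qed simp

lemma power_fact_le: "real N ^ c * fact N \<le> fact (N + c)"
proof (induction c)
  case (Suc c)
  have "real N * (real N ^ c * fact N) \<le> real (N + Suc c) * fact (N + c)"
    using Suc by (intro mult_mono) auto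
  then show ?case by (simp add: algebra_simps)
qed simp

text \<open>The factors \<open>x ^ a\<close> and \<open>(1 - x) ^ b\<close> raise the exponents to
  those of the basis polynomial of degree \<open>N + a + b\<close> at index \<open>k + a\<close>.
  The quotient of the binomial coefficients is controlled by \<open>power_fact_le\<close> for
  \<open>N\<close> and by \<open>fact_add_le\<close> for \<open>k\<close> and
  \<open>N - k\<close>.\<close>

lemma Bernstein_shift_bound:
  assumes x: "0 < x" "x < 1" and k: "k \<le> N"
  shows "(x * N / (real k + 1)) ^ a * ((1 - x) * N / (real N - real k + 1)) ^ b * Bernstein N k x
      \<le> fact a * fact b * Bernstein (N + a + b) (k + a) x"
proof -
  obtain l where l: "N = k + l" using k le_Suc_ex by blast
  have inv: "1 / ((real k + 1) ^ a * fact k) \<le> fact a / fact (k + a)" for k a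
    using fact_add_le[of k a] by (simp add: field_simps)
  have rl: "real N - real k + 1 = real l + 1" "N - k = l" "real (N choose k) = fact N / (fact k * fact l)"
    using l by (simp_all add: binomial_fact)
  define X where "X = x ^ (k + a) * (1 - x) ^ (l + b)"
  have X: "X \<ge> 0" using x by (simp add: X_def)
  have "(x * N / (real k + 1)) ^ a * ((1 - x) * N / (real N - real k + 1)) ^ b * Bernstein N k x
     = (real N ^ (a + b) * fact N) * (1 / ((real k + 1) ^ a * fact k)) * (1 / ((real l + 1) ^ b * fact l)) * X"
    unfolding Bernstein_def X_def rl by (simp add: power_add power_divide power_mult_distrib mult_ac)
  also have "\<dots> \<le> fact (N + (a + b)) * (fact a / fact (k + a)) * (fact b / fact (l + b)) * X"
    using inv X by (intro mult_right_mono mult_mono power_fact_le) auto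
  also have "\<dots> = fact a * fact b * Bernstein (N + a + b) (k + a) x"
    unfolding Bernstein_def X_def using l
    by (simp add: binomial_fact add_ac)
  finally show ?thesis .
qed

lemma sum_Bernstein_shift_le:
  assumes "0 < x" "x < 1"
  shows "(\<Sum>k\<le>N. Bernstein (N + a + b) (k + a) x) \<le> 1"
proof -
  have "(\<Sum>k\<le>N. Bernstein (N + a + b) (k + a) x) = (\<Sum>k\<in>(\<lambda>k. k + a) ` {..N}. Bernstein (N + a + b) k x)"
    by (subst sum.reindex) auto
  also have "\<dots> \<le> (\<Sum>k\<le>N + a + b. Bernstein (N + a + b) k x)"
    using assms by (intro sum_mono2) (auto intro: Bernstein_nonneg)
  finally show ?thesis by simp
qed

lemma sum_Bernstein_weight_nat:
  assumes x: "0 < x" "x < 1"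
  shows "(\<Sum>k\<le>N. (x * N / (real k + 1)) ^ a * ((1 - x) * N / (real N - real k + 1)) ^ b * Bernstein N k x)
      \<le> fact a * fact b"
proof -
  have "(\<Sum>k\<le>N. (x * N / (real k + 1)) ^ a * ((1 - x) * N / (real N - real k + 1)) ^ b * Bernstein N k x)
     \<le> (\<Sum>k\<le>N. fact a * fact b * Bernstein (N + a + b) (k + a) x)"
    by (intro sum_mono Bernstein_shift_bound x) auto
  also have "\<dots> = fact a * fact b * (\<Sum>k\<le>N. Bernstein (N + a + b) (k + a) x)"
    by (simp add: sum_distrib_left)
  also have "\<dots> \<le> fact a * fact b * 1"
    by (intro mult_left_mono sum_Bernstein_shift_le x) auto
  finally show ?thesis by simp
qed

text \<open>The shifts by one keep the weights finite at the end nodes \<open>k = 0\<close> and \<open>k = N\<close>.\<close>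

definition node_weight :: "real \<Rightarrow> real \<Rightarrow> nat \<Rightarrow> nat \<Rightarrow> real" where
  "node_weight a b N k = (N / (real k + 1)) powr a * (N / (real N - real k + 1)) powr b"

lemma node_weight_nonneg: "0 \<le> node_weight a b N k"
  by (simp add: node_weight_def)

lemma powr_le_1_plus_power:
  assumes "0 < q" "a \<le> real n" "0 \<le> a"
  shows "q powr a \<le> 1 + q ^ n"
proof (cases "q \<le> 1")
  case True
  then have "q powr a \<le> 1" using assms by (intro powr_le1) auto
  then show ?thesis using assms by (simp add: add_increasing2)
next
  case False
  then have "q powr a \<le> q powr n" using assms by (intro powr_mono) auto
  then show ?thesis using assms by (simp add: powr_realpow)
qed

text \<open>Real exponents are rounded up to integers: by \<open>powr_le_1_plus_power\<close> each
  weight factor is dominated by one plus an integer power, and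
  \<open>sum_Bernstein_weight_nat\<close> bounds what results, uniformly in \<open>N\<close> and
  \<open>x\<close>.\<close>

lemma weighted_bern_sum_bounded:
  assumes "0 \<le> a" "0 \<le> b"
  obtains C where "C > 0"
    "\<And>N x. 0 < x \<Longrightarrow> x < 1 \<Longrightarrow> 0 < N \<Longrightarrow> wt a b x * bern_sum N (node_weight a b N) x \<le> C"
proof -
  define p where "p = nat \<lceil>a\<rceil>"
  define q where "q = nat \<lceil>b\<rceil>"
  have pq: "a \<le> real p" "b \<le> real q" by (simp_all add: p_def q_def real_nat_ceiling_ge)
  define C :: real where "C = 1 + fact p + fact q + fact p * fact q"
  have C: "C > 0" by (simp add: C_def add_pos_pos)
  have "wt a b x * bern_sum N (node_weight a b N) x \<le> C" if x: "0 < x" "x < 1" and N: "0 < N" for N x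
  proof -
    let ?s = "\<lambda>k. x * N / (real k + 1)" and ?t = "\<lambda>k. (1 - x) * N / (real N - real k + 1)"
    have le: "wt a b x * (node_weight a b N k * Bernstein N k x)
        \<le> (1 + ?s k ^ p) * (1 + ?t k ^ q) * Bernstein N k x" if k: "k \<le> N" for k
    proof -
      have pos: "?s k > 0" "?t k > 0" using x N k by (auto intro!: divide_pos_pos mult_pos_pos)
      have "wt a b x * node_weight a b N k = ?s k powr a * ?t k powr b"
        unfolding wt_def node_weight_def using x k N by (simp add: powr_mult powr_divide)
      also have "\<dots> \<le> (1 + ?s k ^ p) * (1 + ?t k ^ q)"
        using pos pq assms by (intro mult_mono powr_le_1_plus_power) (auto simp: add_nonneg_nonneg)
      finally show ?thesis using Bernstein_nonneg[of x N k] x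
        by (metis less_imp_le mult.assoc mult_right_mono)
    qed
    have expand: "(1 + u) * (1 + v) * y = y + u * 1 * y + 1 * v * y + u * v * y" for u v y :: real
      by algebra
    have "wt a b x * bern_sum N (node_weight a b N) x
        = (\<Sum>k\<le>N. wt a b x * (node_weight a b N k * Bernstein N k x))"
      by (simp add: bern_sum_def sum_distrib_left)
    also have "\<dots> \<le> (\<Sum>k\<le>N. (1 + ?s k ^ p) * (1 + ?t k ^ q) * Bernstein N k x)"
      by (intro sum_mono le) auto
    \<comment> \<open>Zeroth powers are kept so that the mixed terms are instances of the same
      integer estimate.\<close>
    also have "\<dots> = (\<Sum>k\<le>N. Bernstein N k x) + (\<Sum>k\<le>N. ?s k ^ p * ?t k ^ 0 * Bernstein N k x)
        + (\<Sum>k\<le>N. ?s k ^ 0 * ?t k ^ q * Bernstein N k x) + (\<Sum>k\<le>N. ?s k ^ p * ?t k ^ q * Bernstein N k x)"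
      unfolding sum.distrib[symmetric] power_0 by (intro sum.cong refl expand)
    also have "\<dots> \<le> 1 + fact p * fact 0 + fact 0 * fact q + fact p * fact q"
      unfolding sum_Bernstein by (intro add_mono sum_Bernstein_weight_nat x) auto
    finally show ?thesis by (simp add: C_def)
  qed
  with C that show ?thesis by blast
qed

section \<open>Exponential moments of the Bernstein basis\<close>

lemma exp_le_quadratic:
  fixes u :: real
  assumes "\<bar>u\<bar> \<le> 1"
  shows "exp u \<le> 1 + u + u\<^sup>2"
proof (cases "0 \<le> u")
  case True
  then show ?thesis using exp_bound[of u] assms by simp
next
  case False
  have "1 - u \<le> exp (- u)" using exp_ge_add_one_self[of "- u"] by simp
  then have "exp u \<le> 1 / (1 - u)" using False by (simp add: exp_minus field_simps)
  \<comment> \<open>\<open>(1 + u + u^2) * (1 - u)\<close> equals \<open>1 - u^3\<close>, which is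
    at least 1 for negative \<open>u\<close>.\<close>
  also have "\<dots> \<le> 1 + u + u\<^sup>2"
  proof -
    have "u ^ 3 \<le> 0" using False by (simp add: power3_eq_cube mult_nonpos_nonneg mult_nonneg_nonneg split_mult_pos_le mult_le_0_iff)
    then have "1 \<le> (1 + u + u\<^sup>2) * (1 - u)" by (simp add: algebra_simps power2_eq_square power3_eq_cube)
    then show ?thesis using False by (simp add: divide_le_eq)
  qed
  finally show ?thesis .
qed

text \<open>The left side is the moment generating function of a centred binomial variable and
  factorises by the binomial theorem. In each factor the quadratic bound on \<open>exp\<close>,
  valid because \<open>t\<close> is at most 1 in absolute value, leaves the variance
  \<open>x * (1 - x)\<close> once the linear terms cancel.\<close>

lemma sum_Bernstein_exp:
  assumes x: "0 < x" "x < 1" and t: "\<bar>t\<bar> \<le> 1"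
  shows "(\<Sum>k\<le>m. exp (t * (real k - m * x)) * Bernstein m k x) \<le> exp (t\<^sup>2 * (m * (x * (1 - x))))"
proof -
  define A where "A = x * exp (t * (1 - x))"
  define B where "B = (1 - x) * exp (- (t * x))"
  have trm: "exp (t * (real k - m * x)) * Bernstein m k x = of_nat (m choose k) * A ^ k * B ^ (m - k)"
    if "k \<le> m" for k
  proof -
    have "exp (t * (real k - m * x)) = exp (real k * (t * (1 - x)) + real (m - k) * (- (t * x)))"
      using that by (simp add: algebra_simps of_nat_diff)
    also have "\<dots> = exp (t * (1 - x)) ^ k * exp (- (t * x)) ^ (m - k)"
      by (simp only: exp_add exp_of_nat_mult)
    finally show ?thesis by (simp add: A_def B_def Bernstein_def power_mult_distrib)
  qed
  have "(\<Sum>k\<le>m. exp (t * (real k - m * x)) * Bernstein m k x) = (A + B) ^ m"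
    unfolding binomial_ring by (intro sum.cong refl) (use trm in auto)
  also have "\<dots> \<le> exp (t\<^sup>2 * (x * (1 - x))) ^ m"
  proof (rule power_mono)
    have tx: "\<bar>t * (1 - x)\<bar> \<le> 1" "\<bar>- (t * x)\<bar> \<le> 1" using x t by (auto simp: abs_mult intro: mult_le_one)
    have "A + B \<le> x * (1 + t * (1 - x) + (t * (1 - x))\<^sup>2) + (1 - x) * (1 + - (t * x) + (- (t * x))\<^sup>2)"
      unfolding A_def B_def using x tx by (intro add_mono mult_left_mono exp_le_quadratic) auto
    also have "\<dots> = 1 + t\<^sup>2 * (x * (1 - x))" by algebra
    also have "\<dots> \<le> exp (t\<^sup>2 * (x * (1 - x)))" by (rule exp_ge_add_one_self)
    finally show "A + B \<le> exp (t\<^sup>2 * (x * (1 - x)))" .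
    show "0 \<le> A + B" using x by (simp add: A_def B_def)
  qed
  also have "\<dots> = exp (t\<^sup>2 * (m * (x * (1 - x))))" by (simp add: exp_of_nat_mult[symmetric] mult_ac)
  finally show ?thesis .
qed

lemma power_le_fact_exp:
  fixes y :: real
  assumes "0 \<le> y"
  shows "y ^ p \<le> fact p * exp y"
proof -
  have "(\<Sum>n\<in>{p}. inverse (fact n) * y ^ n) \<le> exp y"
    unfolding exp_def using assms summable_exp_generic[of y]
    by (simp add: scaleR_conv_of_real) (intro sum_le_suminf[where I="{p}", simplified], auto simp: scaleR_conv_of_real field_simps)
  then show ?thesis by (simp add: field_simps)
qed

text \<open>A power of \<open>1 + \<bar>z\<bar>\<close> is dominated by
  \<open>exp z + exp (- z)\<close>, and the generating function is evaluated at plus and minus the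
  reciprocal of the standard deviation, where its bound is \<open>exp 1\<close>. The hypothesis on
  \<open>m\<close> makes these two arguments admissible.\<close>

lemma Bernstein_central_moment:
  assumes x: "0 < x" "x < 1" and m: "1 \<le> m * (x * (1 - x))"
  shows "(\<Sum>k\<le>m. (1 + \<bar>real k - m * x\<bar> / sqrt (m * (x * (1 - x)))) ^ p * Bernstein m k x)
     \<le> fact p * exp 1 * (2 * exp 1)"
proof -
  define \<sigma> where "\<sigma> = sqrt (m * (x * (1 - x)))"
  have \<sigma>: "\<sigma> \<ge> 1" "\<sigma>\<^sup>2 = m * (x * (1 - x))" using m by (simp_all add: \<sigma>_def)
  define t where "t = 1 / \<sigma>"
  have t: "\<bar>t\<bar> \<le> 1" "\<bar>- t\<bar> \<le> 1" "t\<^sup>2 * (m * (x * (1 - x))) = 1"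
    using \<sigma> by (auto simp: t_def power_divide simp flip: \<sigma>(2))
  have "(1 + \<bar>real k - m * x\<bar> / \<sigma>) ^ p * Bernstein m k x
     \<le> fact p * exp 1 * (exp (t * (real k - m * x)) * Bernstein m k x + exp (- t * (real k - m * x)) * Bernstein m k x)" for k
  proof -
    define z where "z = (real k - m * x) / \<sigma>"
    have "(1 + \<bar>z\<bar>) ^ p \<le> fact p * exp (1 + \<bar>z\<bar>)" by (rule power_le_fact_exp) simp
    also have "exp (1 + \<bar>z\<bar>) \<le> exp 1 * (exp z + exp (- z))" by (auto simp: exp_add abs_if)
    finally have "(1 + \<bar>z\<bar>) ^ p \<le> fact p * exp 1 * (exp z + exp (- z))" by (simp add: mult_ac)
    then have "(1 + \<bar>z\<bar>) ^ p * Bernstein m k x \<le> fact p * exp 1 * (exp z + exp (- z)) * Bernstein m k x"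
      using x by (intro mult_right_mono Bernstein_nonneg) auto
    moreover have "t * (real k - m * x) = z" "- t * (real k - m * x) = - z"
      "\<bar>real k - m * x\<bar> / \<sigma> = \<bar>z\<bar>"
      using \<sigma>(1) by (simp_all add: z_def t_def abs_divide)
    ultimately show ?thesis by (simp only: distrib_right mult.assoc)
  qed
  then have "(\<Sum>k\<le>m. (1 + \<bar>real k - m * x\<bar> / \<sigma>) ^ p * Bernstein m k x)
     \<le> (\<Sum>k\<le>m. fact p * exp 1 * (exp (t * (real k - m * x)) * Bernstein m k x + exp (- t * (real k - m * x)) * Bernstein m k x))"
    by (rule sum_mono)
  also have "\<dots> = fact p * exp 1 * ((\<Sum>k\<le>m. exp (t * (real k - m * x)) * Bernstein m k x)
       + (\<Sum>k\<le>m. exp (- t * (real k - m * x)) * Bernstein m k x))"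
    unfolding sum.distrib[symmetric] sum_distrib_left ..
  also have "\<dots> \<le> fact p * exp 1 * (exp 1 + exp 1)"
    using sum_Bernstein_exp[OF x t(1), of m] sum_Bernstein_exp[OF x t(2), of m] t(3)
    by (intro mult_left_mono add_mono) auto
  finally show ?thesis by (simp add: \<sigma>_def)
qed

section \<open>Derivatives of the Bernstein basis\<close>

text \<open>A formal polynomial, so that derivatives of all orders come from \<open>pderiv\<close>
  without differentiability conditions.\<close>

definition Bernstein_poly :: "nat \<Rightarrow> nat \<Rightarrow> real poly" where
  "Bernstein_poly m k = smult (of_nat (m choose k)) ([:0, 1:] ^ k * [:1, -1:] ^ (m - k))"

lemma poly_Bernstein_poly: "poly (Bernstein_poly m k) x = Bernstein m k x"
  by (simp add: Bernstein_poly_def Bernstein_def)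

lemma real_poly_ext:
  fixes p q :: "real poly"
  shows "(\<And>x. poly p x = poly q x) \<Longrightarrow> p = q"
  by (metis ext poly_eq_poly_eq_iff)

text \<open>The logarithmic derivative of the basis polynomial is
  \<open>k / x - (m - k) / (1 - x)\<close>; clearing denominators gives an identity that also holds
  at the end points.\<close>

lemma Bernstein_poly_ode:
  assumes "k \<le> m"
  shows "[:0, 1, -1:] * pderiv (Bernstein_poly m k) = [:real k, - real m:] * Bernstein_poly m k"
proof -
  define l where "l = m - k"
  have m: "real m = real k + real l" using assms by (simp add: l_def)
  have X: "x * poly (pderiv ([:0, 1:] ^ k)) x = real k * x ^ k" for x :: real
    by (cases k) (simp_all add: pderiv_power pderiv_pCons del: power_Suc, simp)
  have Y: "(1 - x) * poly (pderiv ([:1, -1:] ^ l)) x = - (real l * (1 - x) ^ l)" for x :: real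
    by (cases l) (simp_all add: pderiv_power pderiv_pCons del: power_Suc, simp add: mult_ac)
  have "poly ([:0, 1, -1:] * pderiv (Bernstein_poly m k)) x = poly ([:real k, - real m:] * Bernstein_poly m k) x" for x
  proof -
    have "poly ([:0, 1, -1:] * pderiv (Bernstein_poly m k)) x
        = (m choose k) * (x ^ k * x * ((1 - x) * poly (pderiv ([:1, -1:] ^ l)) x)
           + (1 - x) ^ l * (1 - x) * (x * poly (pderiv ([:0, 1:] ^ k)) x))"
      unfolding Bernstein_poly_def l_def[symmetric]
      by (simp add: pderiv_smult pderiv_mult algebra_simps)
    also have "\<dots> = poly ([:real k, - real m:] * Bernstein_poly m k) x"
      unfolding X Y Bernstein_poly_def l_def[symmetric] by (simp add: m algebra_simps)
    finally show ?thesis .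
  qed
  then show ?thesis by (rule real_poly_ext)
qed

text \<open>Repeated differentiation of the first-order equation. Because \<open>x * (1 - x)\<close>
  is quadratic and the right-hand coefficient is linear, only three consecutive orders are
  linked.\<close>

lemma pderiv_ode_recurrence:
  fixes P :: "real poly"
  assumes "[:0, 1, -1:] * pderiv P = [:c, - d:] * P"
  shows "x * (1 - x) * poly ((pderiv ^^ Suc (Suc j)) P) x =
     (c - d * x - (real j + 1) * (1 - 2 * x)) * poly ((pderiv ^^ Suc j) P) x
       + (real j + 1) * (real j - d) * poly ((pderiv ^^ j) P) x"
proof -
  have "[:0, 1, -1:] * (pderiv ^^ Suc (Suc j)) P =
     [:c - (real j + 1), - d + 2 * (real j + 1):] * (pderiv ^^ Suc j) P
       + smult ((real j + 1) * (real j - d)) ((pderiv ^^ j) P)"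
  proof (induction j)
    case 0
    have eq: "pderiv ([:0, 1, -1:] * pderiv P) = pderiv ([:c, - d:] * P)" using assms by simp
    have "poly ([:0, 1, -1:] * pderiv (pderiv P)) x = poly ([:c - (0 + 1), - d + 2 * (0 + 1):] * pderiv P
       + smult ((0 + 1) * (0 - d)) P) x" for x
      using arg_cong[OF eq, of "\<lambda>p. poly p x"]
      by (simp only: pderiv_mult) (simp add: pderiv_pCons algebra_simps)
    then have "[:0, 1, -1:] * pderiv (pderiv P) = [:c - (0 + 1), - d + 2 * (0 + 1):] * pderiv P
       + smult ((0 + 1) * (0 - d)) P" by (rule real_poly_ext)
    then show ?case by simp
  next
    case (Suc j)
    let ?P = "\<lambda>i. (pderiv ^^ i) P"
    have eq: "pderiv ([:0, 1, -1:] * ?P (Suc (Suc j))) =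
      pderiv ([:c - (real j + 1), - d + 2 * (real j + 1):] * ?P (Suc j)
       + smult ((real j + 1) * (real j - d)) (?P j))" using Suc by simp
    have "poly ([:0, 1, -1:] * ?P (Suc (Suc (Suc j)))) x =
       poly ([:c - (real (Suc j) + 1), - d + 2 * (real (Suc j) + 1):] * ?P (Suc (Suc j))
       + smult ((real (Suc j) + 1) * (real (Suc j) - d)) (?P (Suc j))) x" for x
      using arg_cong[OF eq, of "\<lambda>p. poly p x"]
      by (simp only: pderiv_mult pderiv_add pderiv_smult) (simp add: pderiv_pCons algebra_simps)
    then show ?case by (rule real_poly_ext)
  qed
  then have "poly ([:0, 1, -1:] * (pderiv ^^ Suc (Suc j)) P) x =
     poly ([:c - (real j + 1), - d + 2 * (real j + 1):] * (pderiv ^^ Suc j) P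
       + smult ((real j + 1) * (real j - d)) ((pderiv ^^ j) P)) x" by simp
  then show ?thesis by (simp add: algebra_simps)
qed

text \<open>With \<open>s\<close> equal to \<open>\<phi> / sqrt m\<close>, one derivative costs
  about \<open>(1 + z) / s\<close>, where \<open>z\<close> is the distance of \<open>k\<close> from
  the mean in standard deviations. The recurrence is rescaled by powers of \<open>s\<close> and
  solved by induction.\<close>

lemma Bernstein_poly_deriv_bound:
  assumes x: "0 < x" "x < 1" and m: "1 \<le> m * (x * (1 - x))" and k: "k \<le> m"
  shows "sqrt (x * (1 - x) / m) ^ j * \<bar>poly ((pderiv ^^ j) (Bernstein_poly m k)) x\<bar>
     \<le> 2 ^ j * fact j * (1 + \<bar>real k - m * x\<bar> / sqrt (m * (x * (1 - x)))) ^ j * Bernstein m k x"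
proof -
  define s where "s = sqrt (x * (1 - x) / m)"
  define \<sigma> where "\<sigma> = sqrt (m * (x * (1 - x)))"
  define z where "z = \<bar>real k - m * x\<bar> / \<sigma>"
  define f where "f = x * (1 - x)"
  define P where "P i = poly ((pderiv ^^ i) (Bernstein_poly m k)) x" for i
  define p where "p = Bernstein m k x"
  have m0: "0 < real m" using m by (cases m) auto
  have f0: "f > 0" using x by (simp add: f_def)
  have \<sigma>1: "\<sigma> \<ge> 1" using m by (simp add: \<sigma>_def)
  have ss: "s * s = f / m" "s > 0" using m0 f0 by (simp_all add: s_def f_def)
  have s\<sigma>: "s * \<sigma> = f"
  proof -
    have "s * \<sigma> = sqrt ((x * (1 - x) / m) * (m * (x * (1 - x))))" unfolding s_def \<sigma>_def by (rule real_sqrt_mult[symmetric])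
    also have "(x * (1 - x) / m) * (m * (x * (1 - x))) = f * f"
      unfolding f_def[symmetric] using m0 by simp
    finally show ?thesis using f0 by simp
  qed
  have z0: "z \<ge> 0" using \<sigma>1 by (simp add: z_def)
  have p0: "p \<ge> 0" using x by (simp add: p_def Bernstein_nonneg)
  have kz: "\<bar>real k - m * x\<bar> = z * \<sigma>" using \<sigma>1 by (simp add: z_def)
  \<comment> \<open>Multiplication by \<open>s ^ Suc (Suc i) / f\<close> removes the large
    coefficients \<open>\<sigma>\<close> and \<open>m\<close>, since \<open>s * \<sigma> = f\<close>
    and \<open>s * s = f / m\<close>.\<close>
  have rec: "s ^ Suc (Suc i) * \<bar>P (Suc (Suc i))\<bar> \<le>
      (real i + 1) * (1 + z) * (s ^ Suc i * \<bar>P (Suc i)\<bar>) + (real i + 1)\<^sup>2 * (s ^ i * \<bar>P i\<bar>)" for i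
  proof -
    have gen: "(a * u * y + b * v * w) * q = a * (u * q * y) + b * (v * q * w)" for a u y b v w q :: real
      by (simp add: algebra_simps)
    have "f * P (Suc (Suc i)) = (real k - m * x - (real i + 1) * (1 - 2 * x)) * P (Suc i)
       + (real i + 1) * (real i - m) * P i"
      unfolding P_def f_def by (rule pderiv_ode_recurrence[OF Bernstein_poly_ode[OF k]])
    then have "f * \<bar>P (Suc (Suc i))\<bar> \<le> \<bar>real k - m * x - (real i + 1) * (1 - 2 * x)\<bar> * \<bar>P (Suc i)\<bar>
       + \<bar>(real i + 1) * (real i - m)\<bar> * \<bar>P i\<bar>"
      using f0 by (metis abs_mult abs_of_pos abs_triangle_ineq)
    also have "\<dots> \<le> ((real i + 1) * (1 + z) * \<sigma>) * \<bar>P (Suc i)\<bar> + ((real i + 1)\<^sup>2 * m) * \<bar>P i\<bar>"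
    proof (intro add_mono mult_right_mono)
      have "\<bar>(real i + 1) * (1 - 2 * x)\<bar> \<le> real i + 1"
        using x by (simp add: abs_mult mult_le_cancel_left2 abs_le_iff)
      then have "\<bar>real k - m * x - (real i + 1) * (1 - 2 * x)\<bar> \<le> z * \<sigma> + (real i + 1)"
        using kz by linarith
      \<comment> \<open>As \<open>\<sigma>\<close> is at least 1, it absorbs the term that does not
        grow with \<open>m\<close>.\<close>
      also have "\<dots> \<le> (real i + 1) * (z * \<sigma>) + (real i + 1) * \<sigma>"
      proof -
        have "0 \<le> real i * (z * \<sigma>)" using z0 \<sigma>1 by (intro mult_nonneg_nonneg) auto
        moreover have "real i + 1 \<le> (real i + 1) * \<sigma>" using \<sigma>1 by simp
        moreover have "(real i + 1) * (z * \<sigma>) = real i * (z * \<sigma>) + z * \<sigma>" by (simp add: distrib_right)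
        ultimately show ?thesis by linarith
      qed
      also have "\<dots> = (real i + 1) * (1 + z) * \<sigma>" by (simp add: algebra_simps)
      finally show "\<bar>real k - m * x - (real i + 1) * (1 - 2 * x)\<bar> \<le> (real i + 1) * (1 + z) * \<sigma>" .
      have m1: "real m \<ge> 1" using m0 by simp
      have "\<bar>real i - m\<bar> \<le> real i + real m" by simp
      also have "\<dots> \<le> (real i + 1) * m"
        using m1 mult_left_mono[of 1 "real m" "real i"] by (simp add: distrib_right)
      finally have "(real i + 1) * \<bar>real i - m\<bar> \<le> (real i + 1) * ((real i + 1) * m)"
        by (rule mult_left_mono) simp
      then show "\<bar>(real i + 1) * (real i - m)\<bar> \<le> (real i + 1)\<^sup>2 * m"
        by (simp add: abs_mult power2_eq_square)
    qed auto
    finally have fin: "f * \<bar>P (Suc (Suc i))\<bar> * (s ^ Suc (Suc i) / f) \<le>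
       (((real i + 1) * (1 + z) * \<sigma>) * \<bar>P (Suc i)\<bar> + ((real i + 1)\<^sup>2 * m) * \<bar>P i\<bar>) * (s ^ Suc (Suc i) / f)"
      using ss f0 by (intro mult_right_mono) auto
    have e1: "\<sigma> * (s ^ Suc (Suc i) / f) = s ^ Suc i" using s\<sigma> f0 by (simp add: field_simps)
    have e2: "m * (s ^ Suc (Suc i) / f) = s ^ i"
    proof -
      have "m * (s ^ Suc (Suc i) / f) = (m / f) * (s * s) * s ^ i" by simp
      also have "\<dots> = s ^ i" unfolding ss using m0 f0 by simp
      finally show ?thesis .
    qed
    have e3: "(((real i + 1) * (1 + z) * \<sigma>) * \<bar>P (Suc i)\<bar> + ((real i + 1)\<^sup>2 * m) * \<bar>P i\<bar>) * (s ^ Suc (Suc i) / f)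
       = (real i + 1) * (1 + z) * (\<sigma> * (s ^ Suc (Suc i) / f) * \<bar>P (Suc i)\<bar>) + (real i + 1)\<^sup>2 * (m * (s ^ Suc (Suc i) / f) * \<bar>P i\<bar>)"
      by (rule gen)
    have e4: "f * \<bar>P (Suc (Suc i))\<bar> * (s ^ Suc (Suc i) / f) = s ^ Suc (Suc i) * \<bar>P (Suc (Suc i))\<bar>"
      using f0 by simp
    show ?thesis by (rule fin[unfolded e3 e1 e2 e4])
  qed
  \<comment> \<open>The recurrence reaches back two orders, so the induction carries the bound for
    two consecutive ones.\<close>
  have "s ^ i * \<bar>P i\<bar> \<le> 2 ^ i * fact i * (1 + z) ^ i * p
      \<and> s ^ Suc i * \<bar>P (Suc i)\<bar> \<le> 2 ^ Suc i * fact (Suc i) * (1 + z) ^ Suc i * p" for i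
  proof (induction i)
    case 0
    have P0: "P 0 = p" by (simp add: P_def p_def poly_Bernstein_poly)
    have "poly ([:0, 1, -1:] * pderiv (Bernstein_poly m k)) x = poly ([:real k, - real m:] * Bernstein_poly m k) x"
      using Bernstein_poly_ode[OF k] by simp
    then have "f * P 1 = (real k - m * x) * p"
      by (simp add: P_def p_def f_def poly_Bernstein_poly algebra_simps)
    then have "\<bar>f\<bar> * \<bar>P 1\<bar> = \<bar>real k - m * x\<bar> * \<bar>p\<bar>" unfolding abs_mult[symmetric] by simp
    then have "(s * \<sigma>) * \<bar>P 1\<bar> = z * \<sigma> * p" using f0 p0 by (simp only: kz s\<sigma> abs_of_pos abs_of_nonneg)
    then have "\<sigma> * (s * \<bar>P 1\<bar>) = \<sigma> * (z * p)" by (simp only: mult_ac)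
    then have "s * \<bar>P 1\<bar> = z * p" using \<sigma>1 by simp
    moreover have "z * p \<le> 2 * (1 + z) * p" using z0 p0 by (intro mult_right_mono) auto
    ultimately show ?case using P0 p0 by (simp add: abs_of_nonneg)
  next
    case (Suc i)
    have z1: "1 + z \<ge> 1" using z0 by simp
    have gen: "j * Z * ((2 * t) * (j * F) * Y * q) + j\<^sup>2 * (t * F * (Z * Y) * q) = (j * 2 + j) * (t * (j * F) * (Z * Y) * q)"
      for j Z t F Y q :: real by algebra
    have fct: "fact (Suc i) = (real i + 1) * fact i" "fact (Suc (Suc i)) = (real i + 2) * ((real i + 1) * fact i)" for i
      by (simp_all add: add_ac)
    have "s ^ Suc (Suc i) * \<bar>P (Suc (Suc i))\<bar> \<le>
      (real i + 1) * (1 + z) * (2 ^ Suc i * fact (Suc i) * (1 + z) ^ Suc i * p)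
       + (real i + 1)\<^sup>2 * (2 ^ i * fact i * (1 + z) ^ i * p)"
      using Suc z0 by (intro order_trans[OF rec] add_mono mult_left_mono) auto
    also have "\<dots> \<le> (real i + 1) * (1 + z) * (2 ^ Suc i * fact (Suc i) * (1 + z) ^ Suc i * p)
       + (real i + 1)\<^sup>2 * (2 ^ i * fact i * (1 + z) ^ Suc (Suc i) * p)"
      using z1 p0 by (intro add_left_mono mult_left_mono mult_right_mono power_increasing) auto
    also have "\<dots> = ((real i + 1) * 2 + (real i + 1)) * (2 ^ i * ((real i + 1) * fact i) * (1 + z) ^ Suc (Suc i) * p)"
      unfolding fct power_Suc[of 2 i] power_Suc[of "1 + z" "Suc i"] by (rule gen)
    \<comment> \<open>The power of 2 and the factorial in the claim provide the room for the factor
      \<open>3 * (real i + 1)\<close>.\<close>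
    also have "\<dots> \<le> (4 * (real i + 2)) * (2 ^ i * ((real i + 1) * fact i) * (1 + z) ^ Suc (Suc i) * p)"
      using z0 p0 by (intro mult_right_mono mult_nonneg_nonneg) auto
    also have "\<dots> = 2 ^ Suc (Suc i) * ((real i + 2) * ((real i + 1) * fact i)) * (1 + z) ^ Suc (Suc i) * p"
      by simp
    also have "\<dots> = 2 ^ Suc (Suc i) * fact (Suc (Suc i)) * (1 + z) ^ Suc (Suc i) * p"
      unfolding fct by simp
    finally show ?case using Suc by blast
  qed
  then show ?thesis unfolding s_def P_def z_def \<sigma>_def p_def by blast
qed

text \<open>Here the differentiation stays on the basis instead of passing to the coefficients as in
  \<open>funpow_deriv_bern_sum\<close>; this form serves where
  \<open>Bernstein_poly_deriv_bound\<close> applies.\<close>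

lemma funpow_deriv_bern_sum_poly:
  "(deriv ^^ r) (bern_sum m a) x = (\<Sum>k\<le>m. a k * poly ((pderiv ^^ r) (Bernstein_poly m k)) x)"
proof -
  define E where "E i x = (\<Sum>k\<le>m. a k * poly ((pderiv ^^ i) (Bernstein_poly m k)) x)" for i x
  have "(E i has_real_derivative E (Suc i) x) (at x)" for i x
    unfolding E_def funpow.simps comp_def by (intro DERIV_sum DERIV_cmult poly_DERIV)
  then have fd: "(deriv ^^ r) (E 0) = E r" by (rule funpow_deriv_chain)
  have E0: "E 0 = bern_sum m a" by (simp add: E_def fun_eq_iff bern_sum_def poly_Bernstein_poly)
  show ?thesis using fd unfolding E0 by (simp add: E_def fun_eq_iff)
qed

section \<open>Differences of functions with Lipschitz derivatives\<close>

lemma DERIV_bound_lipschitz: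
  fixes f :: "real \<Rightarrow> real"
  assumes "\<And>x. x \<in> {l..u} \<Longrightarrow> (f has_real_derivative f' x) (at x)" "\<And>x. x \<in> {l..u} \<Longrightarrow> \<bar>f' x\<bar> \<le> K"
    and "x \<in> {l..u}" "y \<in> {l..u}"
  shows "\<bar>f x - f y\<bar> \<le> K * \<bar>x - y\<bar>"
  using field_differentiable_bound[of "{l..u}" f f' K x y] assms
  by (auto intro: has_field_derivative_at_within)

text \<open>Each difference is traded for one derivative: the increment over \<open>h\<close> again
  has a derivative chain, on an interval shorter by \<open>h\<close>, and the mean value theorem
  bounds its top member by \<open>h * K\<close>.\<close>

lemma abs_ndiff_chain_le:
  fixes E :: "nat \<Rightarrow> real \<Rightarrow> real"
  assumes "\<And>j x. j < i \<Longrightarrow> x \<in> {l..u} \<Longrightarrow> (E j has_real_derivative E (Suc j) x) (at x)"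
    and "\<And>x. x \<in> {l..u} \<Longrightarrow> \<bar>E i x\<bar> \<le> K"
    and "0 \<le> h" "l \<le> real k * h" "(real k + real i) * h \<le> u"
  shows "\<bar>ndiff i (\<lambda>k. E 0 (real k * h)) k\<bar> \<le> h ^ i * K"
  using assms
proof (induction i arbitrary: E u K)
  case 0
  then show ?case by simp
next
  case (Suc i)
  define E' where "E' j x = E j (x + h) - E j x" for j x
  have "\<bar>ndiff i (\<lambda>k. E' 0 (real k * h)) k\<bar> \<le> h ^ i * (h * K)"
  proof (rule Suc.IH[where u = "u - h"])
    fix j x assume j: "j < i" and x: "x \<in> {l..u - h}"
    have "(E j has_real_derivative E (Suc j) (x + h)) (at (x + h))" "(E j has_real_derivative E (Suc j) x) (at x)"
      using Suc.prems(1)[of j] j x \<open>0 \<le> h\<close> by auto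
    then show "(E' j has_real_derivative E' (Suc j) x) (at x)"
      unfolding E'_def by (intro DERIV_diff) (simp_all add: DERIV_shift)
  next
    fix x assume x: "x \<in> {l..u - h}"
    have "\<bar>E i (x + h) - E i x\<bar> \<le> K * \<bar>(x + h) - x\<bar>"
      by (rule DERIV_bound_lipschitz[of l u _ "E (Suc i)"]) (use Suc.prems x in auto)
    then show "\<bar>E' i x\<bar> \<le> h * K" using \<open>0 \<le> h\<close> by (simp add: E'_def mult_ac)
  qed (use Suc.prems in \<open>auto simp: algebra_simps\<close>)
  moreover have "(\<lambda>k. E' 0 (real k * h)) = (\<lambda>k. E 0 (real (Suc k) * h) - E 0 (real k * h))"
    by (simp add: E'_def algebra_simps)
  ultimately show ?case by (simp add: mult_ac)
qed

text \<open>The top derivative is merely Lipschitz. One difference taken first turns the Lipschitz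
  condition into the bound \<open>h * K\<close>, and \<open>abs_ndiff_chain_le\<close> handles the
  other \<open>q\<close> differences.\<close>

lemma abs_ndiff_chain_lipschitz_le:
  fixes E :: "nat \<Rightarrow> real \<Rightarrow> real"
  assumes der: "\<And>j x. j < q \<Longrightarrow> x \<in> {l..u} \<Longrightarrow> (E j has_real_derivative E (Suc j) x) (at x)"
    and lip: "\<And>x y. x \<in> {l..u} \<Longrightarrow> y \<in> {l..u} \<Longrightarrow> \<bar>E q x - E q y\<bar> \<le> K * \<bar>x - y\<bar>"
    and h: "0 \<le> h" and k: "l \<le> real k * h" "(real k + real (Suc q)) * h \<le> u"
  shows "\<bar>ndiff (Suc q) (\<lambda>k. E 0 (real k * h)) k\<bar> \<le> h ^ Suc q * K"
proof -
  define E' where "E' j x = E j (x + h) - E j x" for j x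
  have "\<bar>ndiff q (\<lambda>k. E' 0 (real k * h)) k\<bar> \<le> h ^ q * (h * K)"
  proof (rule abs_ndiff_chain_le[where l = l and u = "u - h"])
    fix j x assume j: "j < q" and x: "x \<in> {l..u - h}"
    have "(E j has_real_derivative E (Suc j) (x + h)) (at (x + h))" "(E j has_real_derivative E (Suc j) x) (at x)"
      using der[of j] j x h by auto
    then show "(E' j has_real_derivative E' (Suc j) x) (at x)"
      unfolding E'_def by (intro DERIV_diff) (simp_all add: DERIV_shift)
  next
    fix x assume x: "x \<in> {l..u - h}"
    then show "\<bar>E' q x\<bar> \<le> h * K" using lip[of "x + h" x] h by (simp add: E'_def mult_ac)
  qed (use h k in \<open>auto simp: algebra_simps\<close>)
  moreover have "(\<lambda>k. E' 0 (real k * h)) = (\<lambda>k. E 0 (real (Suc k) * h) - E 0 (real k * h))"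
    by (simp add: E'_def algebra_simps)
  ultimately show ?thesis by (simp add: mult_ac)
qed

lemma Rolle_chain:
  fixes E :: "nat \<Rightarrow> real \<Rightarrow> real"
  assumes der: "\<And>j x. j < q \<Longrightarrow> x \<in> {l..u} \<Longrightarrow> (E j has_real_derivative E (Suc j) x) (at x)"
    and z: "\<And>i. i \<le> q \<Longrightarrow> z i \<in> {l..u} \<and> E 0 (z i) = 0" "\<And>i. i < q \<Longrightarrow> z i < z (Suc i)"
    and j: "j \<le> q"
  obtains \<zeta> where "\<zeta> \<in> {l..u}" "E j \<zeta> = 0"
proof -
  \<comment> \<open>Each application of Rolle's theorem uses up one of the \<open>q + 1\<close>
    ordered zeros, so \<open>q - j + 1\<close> of them survive for \<open>E j\<close>.\<close>
  have "\<exists>z. (\<forall>i\<le>q - j. z i \<in> {l..u} \<and> E j (z i) = 0) \<and> (\<forall>i<q - j. z i < z (Suc i))"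
    using j
  proof (induction j)
    case 0
    then show ?case using z by auto
  next
    case (Suc j)
    then obtain y where y: "\<And>i. i \<le> q - j \<Longrightarrow> y i \<in> {l..u} \<and> E j (y i) = 0" "\<And>i. i < q - j \<Longrightarrow> y i < y (Suc i)"
      by auto
    have "\<exists>w. y i < w \<and> w < y (Suc i) \<and> E (Suc j) w = 0" if i: "i < q - j" for i
    proof -
      have yy: "y i \<in> {l..u}" "y (Suc i) \<in> {l..u}" "E j (y i) = 0" "E j (y (Suc i)) = 0"
        using y(1)[of i] y(1)[of "Suc i"] i by auto
      have d: "(E j has_real_derivative E (Suc j) x) (at x)" if "y i \<le> x" "x \<le> y (Suc i)" for x
        using der[of j x] yy that Suc.prems by auto
      have "\<exists>w. y i < w \<and> w < y (Suc i) \<and> DERIV (E j) w :> 0"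
      proof (rule Rolle)
        show "continuous_on {y i..y (Suc i)} (E j)"
          using d by (intro continuous_at_imp_continuous_on ballI DERIV_isCont) auto
        show "E j differentiable (at x)" if "y i < x" "x < y (Suc i)" for x
          using d[of x] that by (auto simp: real_differentiable_def)
      qed (use y(2)[OF i] yy in auto)
      then obtain w where w: "y i < w" "w < y (Suc i)" "DERIV (E j) w :> 0" by blast
      then have "E (Suc j) w = 0" using DERIV_unique d[of w] by force
      then show ?thesis using w by blast
    qed
    then obtain w where w: "\<And>i. i < q - j \<Longrightarrow> y i < w i \<and> w i < y (Suc i) \<and> E (Suc j) (w i) = 0"
      by metis
    have "w i \<in> {l..u} \<and> E (Suc j) (w i) = 0" if "i \<le> q - Suc j" for i
    proof -
      have "i < q - j" "i \<le> q - j" "Suc i \<le> q - j" using that Suc.prems by auto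
      then show ?thesis using w[of i] y(1)[of i] y(1)[of "Suc i"] by auto
    qed
    moreover have "w i < w (Suc i)" if "i < q - Suc j" for i
      using w[of i] w[of "Suc i"] that by force
    ultimately show ?case by blast
  qed
  then obtain y where "\<forall>i\<le>q - j. y i \<in> {l..u} \<and> E j (y i) = 0" by blast
  then show thesis using that[of "y 0"] by auto
qed

text \<open>Interpolation error estimate. Every member of the chain has a zero by
  \<open>Rolle_chain\<close>; going down from order \<open>q\<close>, each integration from such a
  zero gains a factor \<open>\<delta>\<close>.\<close>

lemma chain_zeros_bound:
  fixes E :: "nat \<Rightarrow> real \<Rightarrow> real"
  assumes der: "\<And>j x. j < q \<Longrightarrow> x \<in> {l..u} \<Longrightarrow> (E j has_real_derivative E (Suc j) x) (at x)"
    and lip: "\<And>x y. x \<in> {l..u} \<Longrightarrow> y \<in> {l..u} \<Longrightarrow> \<bar>E q x - E q y\<bar> \<le> K * \<bar>x - y\<bar>"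
    and z: "\<And>i. i \<le> q \<Longrightarrow> z i \<in> {l..u} \<and> E 0 (z i) = 0" "\<And>i. i < q \<Longrightarrow> z i < z (Suc i)"
    and K: "0 \<le> K" and \<delta>: "u - l \<le> \<delta>"
    and j: "j \<le> q" and x: "x \<in> {l..u}"
  shows "\<bar>E j x\<bar> \<le> K * \<delta> ^ (Suc q - j)"
  using j x
proof (induction j arbitrary: x rule: inc_induct)
  case base
  obtain \<zeta> where "\<zeta> \<in> {l..u}" "E q \<zeta> = 0" using Rolle_chain[where E=E and z=z and q=q and l=l and u=u, OF der z order_refl] by blast
  then have "\<bar>E q x\<bar> \<le> K * \<bar>x - \<zeta>\<bar>" using lip[of x \<zeta>] base by simp
  also have "\<dots> \<le> K * \<delta>" using \<open>\<zeta> \<in> {l..u}\<close> base \<delta> K by (intro mult_left_mono) auto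
  finally show ?case by simp
next
  case (step j)
  obtain \<zeta> where \<zeta>: "\<zeta> \<in> {l..u}" "E j \<zeta> = 0" using Rolle_chain[where E=E and z=z and q=q and l=l and u=u and j=j, OF der z] step by auto
  have \<delta>0: "0 \<le> \<delta>" using \<delta> step.prems by auto
  have "\<bar>E j x - E j \<zeta>\<bar> \<le> (K * \<delta> ^ (Suc q - Suc j)) * \<bar>x - \<zeta>\<bar>"
    by (rule DERIV_bound_lipschitz[of l u _ "E (Suc j)"]) (use der step \<zeta> in auto)
  also have "\<dots> \<le> (K * \<delta> ^ (Suc q - Suc j)) * \<delta>"
    using \<zeta> step.prems \<delta> K \<delta>0 by (intro mult_left_mono) auto
  also have "\<dots> = K * \<delta> ^ (Suc q - j)" using step.hyps by (simp add: Suc_diff_le)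
  finally show ?case using \<zeta> by simp
qed

text \<open>The product rule is applied with ratio \<open>\<nu> * h\<close> for the cutoff and
  \<open>h / \<delta>\<close> for the error. The gain \<open>\<delta> ^ Suc q\<close> of the
  interpolation error cancels the loss, leaving \<open>h * (\<nu> * \<delta> + 1)\<close>, harmless
  when the layer width \<open>\<delta>\<close> is comparable to \<open>1 / \<nu>\<close>.\<close>

lemma abs_ndiff_cutoff_error_le:
  fixes E T :: "nat \<Rightarrow> real \<Rightarrow> real"
  assumes der: "\<And>j x. j < q \<Longrightarrow> x \<in> {l..u} \<Longrightarrow> (E j has_real_derivative E (Suc j) x) (at x)"
    and lip: "\<And>x y. x \<in> {l..u} \<Longrightarrow> y \<in> {l..u} \<Longrightarrow> \<bar>E q x - E q y\<bar> \<le> K * \<bar>x - y\<bar>"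
    and z: "\<And>i. i \<le> q \<Longrightarrow> z i \<in> {l..u} \<and> E 0 (z i) = 0" "\<And>i. i < q \<Longrightarrow> z i < z (Suc i)"
    and K: "0 \<le> K" and \<delta>: "u - l \<le> \<delta>" "0 < \<delta>"
    and T: "\<And>j x. (T j has_real_derivative T (Suc j) x) (at x)" "\<And>j x. j \<le> Suc q \<Longrightarrow> \<bar>T j x\<bar> \<le> S * \<nu> ^ j"
    and \<nu>: "0 \<le> \<nu>"
    and h: "0 \<le> h" and k: "l \<le> real k * h" "(real k + real (Suc q)) * h \<le> u"
  shows "\<bar>ndiff (Suc q) (\<lambda>k. T 0 (real k * h) * E 0 (real k * h)) k\<bar> \<le> S * K * (h * (\<nu> * \<delta> + 1)) ^ Suc q"
proof -
  have S: "0 \<le> S" using T(2)[of 0 0] by simp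
  have "\<bar>ndiff (Suc q) (\<lambda>k. T 0 (real k * h) * E 0 (real k * h)) k\<bar>
     \<le> S * (K * \<delta> ^ Suc q) * (\<nu> * h + h / \<delta>) ^ Suc q"
  proof (rule abs_ndiff_mult_le)
    fix j k' assume j: "j \<le> Suc q" and k': "k \<le> k'" "k' + j \<le> k + Suc q"
    have kl: "l \<le> real k' * h" using k(1) k'(1) h by (meson mult_right_mono of_nat_mono order_trans)
    have "(real k' + real j) * h \<le> (real k + real (Suc q)) * h"
      using k'(2) h by (intro mult_right_mono) linarith+
    then have ku: "(real k' + real j) * h \<le> u" using k(2) by simp
    have "\<bar>ndiff j (\<lambda>k. T 0 (real k * h)) k'\<bar> \<le> h ^ j * (S * \<nu> ^ j)"
      by (rule abs_ndiff_chain_le[where l = l and u = u]) (use T j h kl ku in auto)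
    then show "\<bar>ndiff j (\<lambda>k. T 0 (real k * h)) k'\<bar> \<le> S * (\<nu> * h) ^ j"
      by (simp add: power_mult_distrib mult_ac)
    show "\<bar>ndiff j (\<lambda>k. E 0 (real k * h)) k'\<bar> \<le> K * \<delta> ^ Suc q * (h / \<delta>) ^ j"
    \<comment> \<open>Orders up to \<open>q\<close> use the decay coming from the zeros; the full
      order has only the Lipschitz bound.\<close>
    proof (cases "j = Suc q")
      case True
      have "\<bar>ndiff j (\<lambda>k. E 0 (real k * h)) k'\<bar> \<le> h ^ Suc q * K"
        unfolding True by (rule abs_ndiff_chain_lipschitz_le[where E=E and q=q and l=l and u=u, OF der lip h kl ku[unfolded True]])
      also have "\<dots> = K * \<delta> ^ Suc q * (h / \<delta>) ^ j"
        unfolding True using \<delta> by (simp add: power_divide del: power_Suc)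
      finally show ?thesis .
    next
      case False
      then have jq: "j \<le> q" using j by simp
      have "\<bar>ndiff j (\<lambda>k. E 0 (real k * h)) k'\<bar> \<le> h ^ j * (K * \<delta> ^ (Suc q - j))"
        by (rule abs_ndiff_chain_le[where l = l and u = u])
          (use der jq h kl ku in \<open>auto intro!: chain_zeros_bound[where E=E and z=z and q=q and l=l and u=u, OF der lip z K \<delta>(1) jq]\<close>)
      also have "\<dots> = K * \<delta> ^ Suc q * (h / \<delta>) ^ j"
      proof -
        have "\<delta> ^ Suc q = \<delta> ^ (Suc q - j) * \<delta> ^ j" using jq by (simp flip: power_add)
        then show ?thesis using \<delta> by (simp add: power_divide del: power_Suc)
      qed
      finally show ?thesis .
    qed
  qed (use S \<nu> h in auto)
  also have "\<dots> = S * K * (\<delta> * (\<nu> * h + h / \<delta>)) ^ Suc q" by (simp only: power_mult_distrib mult_ac)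
  also have "\<delta> * (\<nu> * h + h / \<delta>) = h * (\<nu> * \<delta> + 1)" using \<delta> by (simp add: field_simps)
  finally show ?thesis .
qed

text \<open>Freezing the top derivative outside \<open>{a..b}\<close> continues the function there by its Taylor polynomials at
  the end points.\<close>

lemma chain_extension:
  fixes G :: "nat \<Rightarrow> real \<Rightarrow> real"
  assumes ab: "c \<le> a" "a < b" "b \<le> d"
    and "\<And>j x. j < q \<Longrightarrow> x \<in> {a..b} \<Longrightarrow> (G j has_real_derivative G (Suc j) x) (at x)"
    and "continuous_on {a..b} (G q)"
  shows "\<exists>D. (\<forall>j\<le>q. \<forall>x\<in>{a..b}. D j x = G j x)
    \<and> (\<forall>j<q. \<forall>x\<in>{c..d}. (D j has_real_derivative D (Suc j) x) (at x within {c..d}))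
    \<and> (\<forall>x. D q x = G q (max a (min x b))) \<and> continuous_on {c..d} (D 0)"
  using assms(4,5)
proof (induction q arbitrary: G)
  case 0
  have "continuous_on {c..d} (\<lambda>x. G 0 (max a (min x b)))"
    by (rule continuous_on_compose2[OF 0(2)]) (use ab in \<open>auto intro!: continuous_intros\<close>)
  then show ?case by (intro exI[of _ "\<lambda>j x. G 0 (max a (min x b))"]) auto
next
  case (Suc q)
  obtain D where D: "\<forall>j\<le>q. \<forall>x\<in>{a..b}. D j x = G (Suc j) x"
     "\<forall>j<q. \<forall>x\<in>{c..d}. (D j has_real_derivative D (Suc j) x) (at x within {c..d})"
     "\<forall>x. D q x = G (Suc q) (max a (min x b))" "continuous_on {c..d} (D 0)"
    using Suc.IH[of "\<lambda>j. G (Suc j)"] Suc.prems by auto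
  \<comment> \<open>With the chain of derivatives already extended, the function itself is recovered
    by integration; the constant is fixed at \<open>a\<close>, and equality of the derivatives gives
    agreement on all of \<open>{a..b}\<close>.\<close>
  obtain g where g: "\<And>x. x \<in> {c..d} \<Longrightarrow> (g has_vector_derivative D 0 x) (at x within {c..d})"
    using antiderivative_continuous[OF D(4)] by blast
  then have g': "(g has_real_derivative D 0 x) (at x within {c..d})" if "x \<in> {c..d}" for x
    using that by (simp add: has_real_derivative_iff_has_vector_derivative)
  define g0 where "g0 x = g x - g a + G 0 a" for x
  have g0: "(g0 has_real_derivative D 0 x) (at x within {c..d})" if "x \<in> {c..d}" for x
    unfolding g0_def by (auto intro!: derivative_eq_intros g' that)
  have "\<exists>e. \<forall>x\<in>{a..b}. g0 x - G 0 x = e"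
  proof (rule has_field_derivative_zero_constant)
    fix x assume x: "x \<in> {a..b}"
    have "(g0 has_real_derivative D 0 x) (at x within {a..b})"
      using g0[of x] x ab by (auto intro: has_field_derivative_subset)
    moreover have "(G 0 has_real_derivative G (Suc 0) x) (at x within {a..b})"
      using Suc.prems(1)[of 0 x] x by (auto intro: has_field_derivative_at_within)
    ultimately have "((\<lambda>x. g0 x - G 0 x) has_real_derivative D 0 x - G (Suc 0) x) (at x within {a..b})"
      by (rule DERIV_diff)
    then show "((\<lambda>x. g0 x - G 0 x) has_real_derivative 0) (at x within {a..b})" using D(1) x by simp
  qed simp
  then obtain e where e: "\<And>x. x \<in> {a..b} \<Longrightarrow> g0 x - G 0 x = e" by blast
  moreover have "g0 a - G 0 a = 0" by (simp add: g0_def)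
  ultimately have eq: "g0 x = G 0 x" if "x \<in> {a..b}" for x
    using that ab e[of a] e[of x] by simp
  define D' where "D' = (\<lambda>j. case j of 0 \<Rightarrow> g0 | Suc i \<Rightarrow> D i)"
  have "continuous_on {c..d} (D' 0)"
    using DERIV_continuous_on[of "{c..d}" g0 "D 0"] g0 by (simp add: D'_def)
  moreover have "D' j x = G j x" if "j \<le> Suc q" "x \<in> {a..b}" for j x
    using that D(1) eq by (cases j) (auto simp: D'_def)
  moreover have "(D' j has_real_derivative D' (Suc j) x) (at x within {c..d})" if "j < Suc q" "x \<in> {c..d}" for j x
    using that D(2) g0 by (cases j) (auto simp: D'_def)
  moreover have "D' (Suc q) x = G (Suc q) (max a (min x b))" for x using D(3) by (simp add: D'_def)
  ultimately show ?case by blast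
qed

section \<open>Lagrange interpolation polynomials\<close>

lemma lagrange_interp_node:
  assumes "finite I" "inj_on xs I" "i \<in> I"
  shows "lagrange_interp xs I f (xs i) = f (xs i)"
proof -
  have "(\<Prod>j\<in>I - {i'}. (xs i - xs j) / (xs i' - xs j)) = (if i' = i then 1 else 0)" if "i' \<in> I" for i'
  proof (cases "i' = i")
    case True
    have "xs i \<noteq> xs j" if "j \<in> I - {i}" for j using assms that by (auto simp: inj_on_def)
    then show ?thesis using True by (auto intro!: prod.neutral)
  next
    case False
    then show ?thesis using assms that by (auto intro!: prod_zero)
  qed
  then have "lagrange_interp xs I f (xs i) = (\<Sum>i'\<in>I. f (xs i') * (if i' = i then 1 else 0))"
    unfolding lagrange_interp_def by (intro sum.cong) auto
  also have "\<dots> = f (xs i)" using assms by (simp add: if_distrib sum.delta cong: if_cong)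
  finally show ?thesis .
qed

text \<open>The degree bound makes the derivative of order \<open>card I - 1\<close> constant, so
  subtracting the interpolant does not change the Lipschitz constant of the top derivative.\<close>

lemma lagrange_interp_poly:
  assumes "finite I"
  obtains P :: "real poly" where "\<And>x. poly P x = lagrange_interp xs I f x" "degree P \<le> card I - 1"
proof
  let ?q = "\<lambda>i. \<Prod>j\<in>I - {i}. smult (1 / (xs i - xs j)) [:- xs j, 1:]"
  let ?P = "\<Sum>i\<in>I. smult (f (xs i)) (?q i)"
  show "poly ?P x = lagrange_interp xs I f x" for x
    unfolding lagrange_interp_def by (simp add: poly_sum poly_prod diff_divide_distrib)
  have "degree (?q i) \<le> card I - 1" if "i \<in> I" for i
  proof -
    have "degree (?q i) \<le> sum (degree \<circ> (\<lambda>j. smult (1 / (xs i - xs j)) [:- xs j, 1:])) (I - {i})"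
      using assms by (intro degree_prod_sum_le) auto
    also have "\<dots> \<le> (\<Sum>j\<in>I - {i}. 1)" by (intro sum_mono) auto
    finally show ?thesis using that assms by simp
  qed
  then show "degree ?P \<le> card I - 1"
    using assms by (intro degree_sum_le) (auto intro: order_trans[OF degree_smult_le])
qed

section \<open>The modified function\<close>

lemma smooth_fun_DERIV:
  "smooth_fun \<psi> \<Longrightarrow> ((deriv ^^ j) \<psi> has_real_derivative (deriv ^^ Suc j) \<psi> x) (at x)"
  unfolding smooth_fun_def
  by (simp add: DERIV_deriv_iff_real_differentiable)

lemma deriv_const_on_open:
  fixes f :: "real \<Rightarrow> real"
  assumes "open U" "x \<in> U" "\<And>y. y \<in> U \<Longrightarrow> f y = c"
  shows "deriv f x = 0"
proof -
  have "((\<lambda>_. c) has_real_derivative 0) (at x)" by simp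
  then have "(f has_real_derivative 0) (at x)"
    by (rule has_field_derivative_transform_within_open[OF _ assms(1,2)]) (simp add: assms(3))
  then show ?thesis by (rule DERIV_imp_deriv)
qed

text \<open>Outside \<open>{0..1}\<close> every derivative is constant on each side; on
  \<open>{0..1}\<close> it is continuous on a compact set.\<close>

lemma cutoff_derivs_bounded:
  assumes smooth: "smooth_fun \<psi>" and range: "\<And>t. 0 \<le> \<psi> t \<and> \<psi> t \<le> 1"
    and psi0: "\<And>t. t \<le> 0 \<Longrightarrow> \<psi> t = 0" and psi1: "\<And>t. 1 \<le> t \<Longrightarrow> \<psi> t = 1"
  obtains S where "S > 0" "\<And>j t. j \<le> r \<Longrightarrow> \<bar>(deriv ^^ j) \<psi> t\<bar> \<le> S"
proof -
  \<comment> \<open>The constant on the right is 1 for the function itself and 0 for its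
    derivatives; the existential covers both.\<close>
  have out: "(\<forall>t<0. (deriv ^^ j) \<psi> t = 0) \<and> (\<exists>c. \<bar>c\<bar> \<le> 1 \<and> (\<forall>t>1. (deriv ^^ j) \<psi> t = c))" for j
  proof (induction j)
    case 0
    then show ?case using psi0 psi1 by (auto intro!: exI[of _ 1])
  next
    case (Suc j)
    then obtain c where c: "\<forall>t<0. (deriv ^^ j) \<psi> t = 0" "\<forall>t>1. (deriv ^^ j) \<psi> t = c" by blast
    have "(deriv ^^ Suc j) \<psi> t = 0" if "t < 0" for t
      using deriv_const_on_open[of "{..<0}" t "(deriv ^^ j) \<psi>" 0] c that by simp
    moreover have "(deriv ^^ Suc j) \<psi> t = 0" if "t > 1" for t
      using deriv_const_on_open[of "{1<..}" t "(deriv ^^ j) \<psi>" c] c that by simp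
    ultimately show ?case by (auto intro!: exI[of _ 0])
  qed
  have "\<exists>B. \<forall>t. \<bar>(deriv ^^ j) \<psi> t\<bar> \<le> B" for j
  proof -
    have "continuous_on {0..1} ((deriv ^^ j) \<psi>)"
      using smooth_fun_DERIV[OF smooth] by (intro continuous_at_imp_continuous_on ballI DERIV_isCont) blast
    then have "compact ((deriv ^^ j) \<psi> ` {0..1})" by (intro compact_continuous_image) auto
    then obtain B where B: "\<And>t. t \<in> {0..1} \<Longrightarrow> \<bar>(deriv ^^ j) \<psi> t\<bar> \<le> B"
      using compact_imp_bounded[THEN bounded_iff[THEN iffD1]] by (metis image_eqI real_norm_def)
    have "\<bar>(deriv ^^ j) \<psi> t\<bar> \<le> max B 1" for t
    proof -
      consider "t < 0" | "t > 1" | "t \<in> {0..1}" by fastforce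
      then show ?thesis using out[of j] B[of t] by cases (auto simp: le_max_iff_disj)
    qed
    then show ?thesis by blast
  qed
  then obtain B where B: "\<And>j t. \<bar>(deriv ^^ j) \<psi> t\<bar> \<le> B j" by metis
  have B0: "0 \<le> B j" for j using B[of j 0] by linarith
  define S where "S = 1 + (\<Sum>j\<le>r. B j)"
  have "S > 0" using B0 by (simp add: S_def add_pos_nonneg sum_nonneg)
  moreover have "\<bar>(deriv ^^ j) \<psi> t\<bar> \<le> S" if "j \<le> r" for j t
  proof -
    have "B j \<le> (\<Sum>j\<le>r. B j)" using that B0 by (intro member_le_sum) auto
    then show ?thesis using B[of j t] by (simp add: S_def)
  qed
  ultimately show ?thesis using that by blast
qed

text \<open>The two factors of the weight are monotone in opposite directions, so on
  \<open>{s..t}\<close> the weight is at least the first factor at \<open>s\<close> times the second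
  at \<open>t\<close>.\<close>

lemma wt_inverse_bound:
  assumes "0 < s" "s \<le> x" "x \<le> t" "t < 1" "0 \<le> a" "0 \<le> b" "\<bar>wt a b x * y\<bar> \<le> M"
  shows "\<bar>y\<bar> \<le> M * ((1 / s) powr a * (1 / (1 - t)) powr b)"
proof -
  define w0 where "w0 = s powr a * (1 - t) powr b"
  have w0: "w0 > 0" using assms by (simp add: w0_def)
  have "w0 \<le> wt a b x" unfolding w0_def wt_def using assms by (intro mult_mono powr_mono2) auto
  then have "w0 * \<bar>y\<bar> \<le> wt a b x * \<bar>y\<bar>" by (intro mult_right_mono) auto
  also have "\<dots> = \<bar>wt a b x * y\<bar>" by (simp add: abs_mult wt_def)
  finally have "w0 * \<bar>y\<bar> \<le> M" using assms by linarith
  then have "\<bar>y\<bar> \<le> M * (1 / w0)" using w0 by (simp add: field_simps)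
  also have "1 / w0 = (1 / s) powr a * (1 / (1 - t)) powr b"
    using assms by (simp add: w0_def powr_divide)
  finally show ?thesis .
qed

lemma ac_deriv_class_lipschitz:
  assumes cls: "ac_deriv_class r f" and g: "is_rth_deriv r f g"
    and M: "\<And>y. y \<in> {0<..<1} \<Longrightarrow> \<bar>wt a b y * g y\<bar> \<le> M"
    and ab: "0 \<le> a" "0 \<le> b" and st: "0 < s" "s \<le> t" "t < 1"
  shows "\<bar>(deriv ^^ (r - 1)) f t - (deriv ^^ (r - 1)) f s\<bar> \<le> M * ((1 / s) powr a * (1 / (1 - t)) powr b) * (t - s)"
proof (rule abs_cont_on_deriv_bound[OF st(2)])
  show "abs_cont_on ((deriv ^^ (r - 1)) f) s t"
    using cls st unfolding ac_deriv_class_def abs_cont_loc01_def by blast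
  have "AE x in lborel. x \<in> {0<..<1} \<longrightarrow> ((deriv ^^ (r - 1)) f has_real_derivative g x) (at x)"
    using g unfolding is_rth_deriv_def .
  then show "AE x in lborel. x \<in> {s..t} \<longrightarrow> (\<exists>d. ((deriv ^^ (r - 1)) f has_real_derivative d) (at x)
      \<and> \<bar>d\<bar> \<le> M * ((1 / s) powr a * (1 / (1 - t)) powr b))"
  proof (rule AE_mp, intro AE_I2 impI)
    fix x assume d: "x \<in> {0<..<1} \<longrightarrow> ((deriv ^^ (r - 1)) f has_real_derivative g x) (at x)"
      and x: "x \<in> {s..t}"
    have "x \<in> {0<..<1}" using x st by auto
    then show "\<exists>d. ((deriv ^^ (r - 1)) f has_real_derivative d) (at x)
      \<and> \<bar>d\<bar> \<le> M * ((1 / s) powr a * (1 / (1 - t)) powr b)"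
      using d M[of x] x st ab by (intro exI[of _ "g x"] conjI wt_inverse_bound) auto
  qed
qed

text \<open>The clamped function is constant beyond \<open>e\<close> and \<open>1 - e\<close>, so
  the distances from \<open>{l..u}\<close> to the end points 0 and 1 count only when they exceed
  \<open>e\<close>, which keeps the constant finite up to the boundary.\<close>

lemma clamp_lipschitz:
  fixes G :: "real \<Rightarrow> real"
  assumes lip: "\<And>s t. 0 < s \<Longrightarrow> s \<le> t \<Longrightarrow> t < 1 \<Longrightarrow>
      \<bar>G t - G s\<bar> \<le> M * ((1 / s) powr a * (1 / (1 - t)) powr b) * (t - s)"
    and M: "0 \<le> M" and ab: "0 \<le> a" "0 \<le> b" and e: "0 < e" "e \<le> 1 / 2"
    and xy: "x \<in> {l..u}" "y \<in> {l..u}"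
  shows "\<bar>G (max e (min x (1 - e))) - G (max e (min y (1 - e)))\<bar>
     \<le> M * ((1 / max l e) powr a * (1 / max (1 - u) e) powr b) * \<bar>x - y\<bar>"
proof -
  define K where "K = M * ((1 / max l e) powr a * (1 / max (1 - u) e) powr b)"
  have K: "0 \<le> K" unfolding K_def by (intro mult_nonneg_nonneg M powr_ge_zero)
  have "\<bar>G (max e (min y (1 - e))) - G (max e (min x (1 - e)))\<bar> \<le> K * (y - x)"
    if xy: "x \<in> {l..u}" "y \<in> {l..u}" "x \<le> y" for x y
  proof -
    define s where "s = max e (min x (1 - e))"
    define t where "t = max e (min y (1 - e))"
    have st: "0 < s" "s \<le> t" "t < 1" "t - s \<le> y - x" using e xy by (auto simp: s_def t_def)
    show ?thesis
    proof (cases "s = t")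
      case True
      then show ?thesis using K xy by (simp flip: s_def t_def)
    next
      case False
      \<comment> \<open>Distinct clamped points mean that neither pair member has been pushed past
        the opposite clamp, hence \<open>s\<close> is at least \<open>l\<close> and \<open>t\<close>
        at most \<open>u\<close>.\<close>
      then have "x < 1 - e" "e < y" using e xy by (auto simp: s_def t_def min_def max_def split: if_splits)
      then have le: "max l e \<le> s" "max (1 - u) e \<le> 1 - t" using xy e by (auto simp: s_def t_def)
      have pos: "0 < max l e" "0 < max (1 - u) e" using e by auto
      have "\<bar>G t - G s\<bar> \<le> M * ((1 / s) powr a * (1 / (1 - t)) powr b) * (t - s)"
        using lip st by blast
      also have "\<dots> \<le> K * (y - x)"
        unfolding K_def using M ab st le pos
        by (intro mult_mono powr_mono2 divide_left_mono mult_nonneg_nonneg mult_pos_pos) auto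
      finally show ?thesis by (simp add: s_def t_def)
    qed
  qed
  from this[of x y] this[of y x] xy show ?thesis unfolding K_def
    by (cases "x \<le> y") (auto simp: abs_minus_commute)
qed

text \<open>The blending factor is split as \<open>1 + T\<close>, so that \<open>T\<close> and its
  derivatives obey one formula. The interpolation error alone is handled by its Lipschitz top
  derivative, its product with \<open>T\<close> by \<open>abs_ndiff_cutoff_error_le\<close>.\<close>

lemma abs_ndiff_blend_le:
  fixes D T :: "nat \<Rightarrow> real \<Rightarrow> real"
  assumes der: "\<And>j x. j < q \<Longrightarrow> x \<in> {l..u} \<Longrightarrow> (D j has_real_derivative D (Suc j) x) (at x)"
    and lip: "\<And>x y. x \<in> {l..u} \<Longrightarrow> y \<in> {l..u} \<Longrightarrow> \<bar>D q x - D q y\<bar> \<le> K * \<bar>x - y\<bar>"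
    and z: "\<And>i. i \<le> q \<Longrightarrow> z i \<in> {l..u} \<and> poly P (z i) = D 0 (z i)" "\<And>i. i < q \<Longrightarrow> z i < z (Suc i)"
    and P: "degree P \<le> q"
    and K: "0 \<le> K" and \<delta>: "u - l \<le> \<delta>" "0 < \<delta>"
    and T: "\<And>j x. (T j has_real_derivative T (Suc j) x) (at x)" "\<And>j x. j \<le> Suc q \<Longrightarrow> \<bar>T j x\<bar> \<le> S * \<nu> ^ j"
    and \<nu>: "0 \<le> \<nu>"
    and h: "0 \<le> h" and k: "l \<le> real k * h" "(real k + real (Suc q)) * h \<le> u"
  shows "\<bar>ndiff (Suc q) (\<lambda>k. (1 + T 0 (real k * h)) * (poly P (real k * h) - D 0 (real k * h))) k\<bar>
     \<le> h ^ Suc q * K * (1 + S * (\<nu> * \<delta> + 1) ^ Suc q)"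
proof -
  define E where "E j x = poly ((pderiv ^^ j) P) x - D j x" for j x
  have "degree ((pderiv ^^ q) P) = 0" using P by (simp add: degree_higher_pderiv)
  then obtain c where c: "(pderiv ^^ q) P = [:c:]" by (rule degree_eq_zeroE)
  have Eder: "(E j has_real_derivative E (Suc j) x) (at x)" if "j < q" "x \<in> {l..u}" for j x
    unfolding E_def funpow.simps comp_def by (intro DERIV_diff poly_DERIV der that)
  have Elip: "\<bar>E q x - E q y\<bar> \<le> K * \<bar>x - y\<bar>" if "x \<in> {l..u}" "y \<in> {l..u}" for x y
    using lip[OF that] by (simp add: E_def c)
  have Ez: "z i \<in> {l..u} \<and> E 0 (z i) = 0" if "i \<le> q" for i using z(1)[OF that] by (simp add: E_def)
  have "(\<lambda>k. (1 + T 0 (real k * h)) * (poly P (real k * h) - D 0 (real k * h)))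
     = (\<lambda>k. E 0 (real k * h) + T 0 (real k * h) * E 0 (real k * h))"
    by (rule ext) (simp add: E_def algebra_simps)
  then have "\<bar>ndiff (Suc q) (\<lambda>k. (1 + T 0 (real k * h)) * (poly P (real k * h) - D 0 (real k * h))) k\<bar>
     = \<bar>ndiff (Suc q) (\<lambda>k. E 0 (real k * h)) k + ndiff (Suc q) (\<lambda>k. T 0 (real k * h) * E 0 (real k * h)) k\<bar>"
    by (simp only: ndiff_add)
  also have "\<dots> \<le> h ^ Suc q * K + S * K * (h * (\<nu> * \<delta> + 1)) ^ Suc q"
    using abs_ndiff_chain_lipschitz_le[where E=E and q=q and l=l and u=u, OF Eder Elip h k]
      abs_ndiff_cutoff_error_le[where E=E and q=q and l=l and u=u and T=T and z=z, OF Eder Elip Ez z(2) K \<delta> T \<nu> h k]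
    by linarith
  also have "\<dots> = h ^ Suc q * K * (1 + S * (\<nu> * \<delta> + 1) ^ Suc q)"
    by (simp only: power_mult_distrib) (simp add: algebra_simps)
  finally show ?thesis .
qed

section \<open>Comparison of boundary distances with node weights\<close>

lemma powr_mult_le_node_weight:
  fixes N k :: nat and a b c X Y :: real
  assumes "0 \<le> X" "X \<le> c * (N / (real k + 1))" "0 \<le> Y" "Y \<le> c * (N / (real N - real k + 1))"
    and "0 \<le> a" "0 \<le> b" "0 \<le> c" "k \<le> N"
  shows "X powr a * Y powr b \<le> c powr (a + b) * node_weight a b N k"
proof -
  have "X powr a \<le> (c * (N / (real k + 1))) powr a" using assms by (intro powr_mono2) auto
  also have "\<dots> = c powr a * (N / (real k + 1)) powr a" using assms by (intro powr_mult) 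
  finally have X: "X powr a \<le> c powr a * (N / (real k + 1)) powr a" .
  have "Y powr b \<le> (c * (N / (real N - real k + 1))) powr b" using assms by (intro powr_mono2) auto
  also have "\<dots> = c powr b * (N / (real N - real k + 1)) powr b" using assms by (intro powr_mult)
  finally have Y: "Y powr b \<le> c powr b * (N / (real N - real k + 1)) powr b" .
  have "X powr a * Y powr b \<le> (c powr a * (N / (real k + 1)) powr a) * (c powr b * (N / (real N - real k + 1)) powr b)"
    using X Y by (intro mult_mono) auto
  also have "\<dots> = c powr (a + b) * node_weight a b N k"
    by (simp add: node_weight_def powr_add)
  finally show ?thesis .
qed

text \<open>The cutoff \<open>1 / n\<close> is at least \<open>1 / m\<close>, so the maximum
  dominates \<open>(k + 1) / (2 * m)\<close>, also at \<open>k = 0\<close>. The hypothesis relating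
  \<open>m\<close> and \<open>N\<close> covers both \<open>N = m\<close> and
  \<open>N = m - r\<close>; the right end is the same statement for \<open>N - k\<close>.\<close>

lemma inverse_max_node_le:
  fixes n m r N k :: nat
  assumes "0 < n" "n \<le> m" "real m \<le> (real r + 1) * N"
  shows "1 / max (real k / m) (1 / n) \<le> 3 * (real r + 3) * (N / (real k + 1))"
proof -
  have m: "0 < real m" "1 / real m \<le> 1 / real n" using assms by (auto simp: frac_le)
  have "(real k + 1) / (2 * m) \<le> max (real k / m) (1 / m)" using m by (simp add: field_simps max_def)
  also have "\<dots> \<le> max (real k / m) (1 / n)" using m by auto
  finally have "1 / max (real k / m) (1 / n) \<le> 1 / ((real k + 1) / (2 * m))"
    using m assms by (intro divide_left_mono mult_pos_pos) (auto simp: less_max_iff_disj)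
  also have "\<dots> = (2 * real m) / (real k + 1)" by simp
  also have "\<dots> \<le> (3 * (real r + 3) * N) / (real k + 1)"
  proof (rule divide_right_mono)
    have "2 * real m \<le> 2 * ((real r + 1) * N)" using assms by simp
    also have "\<dots> \<le> 3 * (real r + 3) * N" by (simp add: algebra_simps)
    finally show "2 * real m \<le> 3 * (real r + 3) * N" .
  qed simp
  finally show ?thesis by simp
qed

lemma boundary_node_le:
  fixes n m r N k :: nat
  assumes "0 < n" "n \<le> m" "real m \<le> (real r + 1) * N" "real k * n \<le> 2 * m"
  shows "real n \<le> 3 * (real r + 3) * (N / (real k + 1))"
proof -
  have "real n * (real k + 1) \<le> 3 * real m" using assms by (simp add: algebra_simps)
  also have "\<dots> \<le> 3 * ((real r + 1) * N)" using assms by simp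
  also have "\<dots> \<le> 3 * (real r + 3) * N" by (simp add: algebra_simps)
  finally show ?thesis by (simp add: field_simps)
qed

lemma const_node_le:
  fixes N k :: nat and c :: real
  assumes "0 < N" "k \<le> N" "0 \<le> c"
  shows "c \<le> 3 * c * (N / (real k + 1))"
proof -
  have "real k + 1 \<le> 3 * real N" using assms by linarith
  then have "c * (real k + 1) \<le> c * (3 * real N)" using assms by (intro mult_left_mono) auto
  then show ?thesis by (simp add: field_simps)
qed

text \<open>Where a cutoff vanishes, \<open>D\<close> cancels and only the interpolant remains; so
  \<open>D\<close> may be any continuation of \<open>f\<close> beyond \<open>1 / n\<close> and
  \<open>1 - 1 / n\<close>. The bound \<open>4 \<le> n\<close> makes the opposite correction vanish
  in each boundary layer.\<close>

lemma Fn_decomp: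
  assumes psi0: "\<And>t. t \<le> 0 \<Longrightarrow> \<psi> t = 0" and psi1: "\<And>t. 1 \<le> t \<Longrightarrow> \<psi> t = 1"
    and n: "4 \<le> n" and D: "\<And>x. x \<in> {1 / n..1 - 1 / n} \<Longrightarrow> D x = f x"
  shows "Fn \<psi> r n f x = D x + (1 - \<psi> (n * x - 1)) * (Lr r n f x - D x)
      + (1 - \<psi> (n - n * x - 1)) * (Rr r n f x - D x)"
proof -
  have n0: "real n \<ge> 4" using n by simp
  consider "n * x \<le> 1" | "1 < n * x" "n * x \<le> 2" | "2 < n * x" "n * x < real n - 2"
    | "2 < n * x" "real n - 2 \<le> n * x" "n * x < real n - 1" | "real n - 1 \<le> n * x"
    by linarith
  then show ?thesis
  proof cases
    case 1
    then have "x \<le> 1 / n" using n0 by (simp add: field_simps)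
    moreover have "\<psi> (n * x - 1) = 0" "\<psi> (n - n * x - 1) = 1" using 1 n0 by (auto intro: psi0 psi1)
    ultimately show ?thesis by (simp add: Fn_def)
  next
    case 2
    then have "\<not> x \<le> 1 / n" "x \<le> 2 / n" "x \<in> {1 / n..1 - 1 / n}" using n0 by (auto simp: field_simps)
    moreover have "\<psi> (n - n * x - 1) = 1" using 2 n0 by (auto intro: psi1)
    ultimately show ?thesis using D[of x] by (simp add: Fn_def algebra_simps)
  next
    case 3
    then have "\<not> x \<le> 1 / n" "\<not> x \<le> 2 / n" "x < 1 - 2 / n" "x \<in> {1 / n..1 - 1 / n}" using n0 by (auto simp: field_simps)
    moreover have "\<psi> (n * x - 1) = 1" "\<psi> (n - n * x - 1) = 1" using 3 n0 by (auto intro: psi1)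
    ultimately show ?thesis using D[of x] by (simp add: Fn_def)
  next
    case 4
    then have "\<not> x \<le> 1 / n" "\<not> x \<le> 2 / n" "\<not> x < 1 - 2 / n" "x < 1 - 1 / n" "x \<in> {1 / n..1 - 1 / n}"
      using n0 by (auto simp: field_simps)
    moreover have "\<psi> (n * x - 1) = 1" using 4 n0 by (auto intro: psi1)
    ultimately show ?thesis using D[of x] by (simp add: Fn_def algebra_simps)
  next
    case 5
    then have "\<not> x \<le> 1 / n" "\<not> x \<le> 2 / n" "\<not> x < 1 - 2 / n" "\<not> x < 1 - 1 / n"
      using n0 by (auto simp: field_simps)
    moreover have "\<psi> (n * x - 1) = 1" "\<psi> (n - n * x - 1) = 0" using 5 n0 by (auto intro: psi0 psi1)
    ultimately show ?thesis by (simp add: Fn_def)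
  qed
qed

lemma ndiff_eq_0: "(\<And>j. j \<le> i \<Longrightarrow> a (k + j) = 0) \<Longrightarrow> ndiff i a k = 0"
  using abs_ndiff_le[of i a k 0] by simp

text \<open>Supplies the chain \<open>T\<close> for both layers: slope \<open>n\<close> on the left,
  \<open>- n\<close> on the right.\<close>

lemma DERIV_affine_smooth:
  assumes "smooth_fun \<psi>"
  shows "((\<lambda>x. - (s ^ j * (deriv ^^ j) \<psi> (s * x + t))) has_real_derivative
     - (s ^ Suc j * (deriv ^^ Suc j) \<psi> (s * x + t))) (at x)"
proof -
  have "((\<lambda>x. (deriv ^^ j) \<psi> (s * x + t)) has_real_derivative (deriv ^^ Suc j) \<psi> (s * x + t) * s) (at x)"
    by (rule DERIV_chain2[OF smooth_fun_DERIV[OF assms]]) (auto intro!: derivative_eq_intros)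
  from DERIV_minus[OF DERIV_cmult[OF this, of "s ^ j"]] show ?thesis by (simp add: mult_ac)
qed

text \<open>By \<open>Fn_decomp\<close>, the function is a Taylor continuation \<open>D 0\<close> of
  \<open>f\<close> plus two cut-off interpolation errors, each with \<open>r\<close>-th differences
  of order \<open>(1 / m) ^ r\<close> times a Lipschitz constant of \<open>D q\<close>. These
  constants depend on the distance to 0 and 1 at resolution \<open>1 / n\<close> and become node
  weights of degree \<open>m - r\<close>, the degree of the \<open>r\<close>-th derivative.\<close>

lemma abs_ndiff_Fn_le:
  fixes M a b S :: real
  assumes r: "2 \<le> r"
    and psi_smooth: "smooth_fun \<psi>"
    and psi0: "\<And>t. t \<le> 0 \<Longrightarrow> \<psi> t = 0" and psi1: "\<And>t. 1 \<le> t \<Longrightarrow> \<psi> t = 1"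
    and S: "\<And>j t. j \<le> r \<Longrightarrow> \<bar>(deriv ^^ j) \<psi> t\<bar> \<le> S"
    and ab: "0 \<le> a" "0 \<le> b"
    and n: "admissible r n" and nm: "n \<le> m"
    and cls: "ac_deriv_class r f" and g: "is_rth_deriv r f g"
    and M: "\<And>y. y \<in> {0<..<1} \<Longrightarrow> \<bar>wt a b y * g y\<bar> \<le> M"
    and k: "k \<le> m - r"
  shows "\<bar>ndiff r (\<lambda>k. Fn \<psi> r n f (real k / real m)) k\<bar>
    \<le> (1 / m) ^ r * (M * ((3 * (real r + 3)) powr (a + b) * node_weight a b (m - r) k)) * (1 + 2 * (1 + S * (real r + 3) ^ r))"
proof -
  define q where "q = r - 1"
  have rq: "r = Suc q" using r by (simp add: q_def)
  define e where "e = 1 / real n"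
  define h where "h = 1 / real m"
  define N where "N = m - r"
  define c0 where "c0 = 3 * (real r + 3)"
  define W where "W = c0 powr (a + b) * node_weight a b N k"
  have n4: "4 \<le> n" "r < n" using n by (auto simp: admissible_def)
  have n4': "4 \<le> real n" "real r + 1 \<le> real n" using n4 by auto
  have e: "0 < e" "e \<le> 1 / 4" "e * n = 1" using n4 by (auto simp: e_def field_simps)
  have mr: "real m \<ge> real n" "real m > 0" "real N = real m - real r" "N > 0"
    using nm n4 by (auto simp: N_def)
  have h: "0 < h" "h * m = 1" "h \<le> e" using mr n4' by (auto simp: h_def e_def frac_le)
  have mN: "real m \<le> (real r + 1) * N"
  proof -
    have "real m = real N + real r * 1" using mr by simp
    also have "\<dots> \<le> real N + real r * N" using mr(4) by (intro add_left_mono mult_left_mono) auto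
    finally show ?thesis by (simp add: algebra_simps)
  qed
  have M0: "0 \<le> M" using order_trans[OF abs_ge_zero M[of "1/2"]] by simp
  define G where "G j = (deriv ^^ j) f" for j
  have Glip: "\<bar>G q t - G q s\<bar> \<le> M * ((1 / s) powr a * (1 / (1 - t)) powr b) * (t - s)"
    if "0 < s" "s \<le> t" "t < 1" for s t
    unfolding G_def q_def by (rule ac_deriv_class_lipschitz[OF cls g M ab that])
  define K where "K l u = M * ((1 / max l e) powr a * (1 / max (1 - u) e) powr b)" for l u
  have K0: "0 \<le> K l u" for l u unfolding K_def by (intro mult_nonneg_nonneg M0 powr_ge_zero)
  have Hlip: "\<bar>G q (max e (min x (1 - e))) - G q (max e (min y (1 - e)))\<bar> \<le> K l u * \<bar>x - y\<bar>"
    if "x \<in> {l..u}" "y \<in> {l..u}" for x y l u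
    unfolding K_def by (rule clamp_lipschitz[OF Glip M0 ab]) (use e that in auto)
  have "continuous_on {e..1 - e} (G q)"
  proof (rule lipschitz_on_continuous_on[where L = "K e (1 - e)"], rule lipschitz_onI)
    fix x y assume "x \<in> {e..1 - e}" "y \<in> {e..1 - e}"
    then show "dist (G q x) (G q y) \<le> K e (1 - e) * dist x y"
      using Hlip[of x e "1 - e" y] by (simp add: dist_real_def max_def min_def)
  qed (rule K0)
  moreover have "(G j has_real_derivative G (Suc j) x) (at x)" if "j < q" "x \<in> {e..1 - e}" for j x
  proof -
    have "x \<in> {0<..<1}" using that e by auto
    then have "(deriv ^^ j) f differentiable (at x)" using cls that by (auto simp: ac_deriv_class_def q_def)
    then show ?thesis by (simp add: G_def DERIV_deriv_iff_real_differentiable)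
  qed
  \<comment> \<open>The interval \<open>{-1..2}\<close> has \<open>{0..1}\<close> in its interior,
    so the derivatives obtained within it are two-sided on \<open>{0..1}\<close>.\<close>
  ultimately have "\<exists>D. (\<forall>j\<le>q. \<forall>x\<in>{e..1 - e}. D j x = G j x)
    \<and> (\<forall>j<q. \<forall>x\<in>{-1..2}. (D j has_real_derivative D (Suc j) x) (at x within {-1..2}))
    \<and> (\<forall>x. D q x = G q (max e (min x (1 - e)))) \<and> continuous_on {-1..2} (D 0)"
    by (intro chain_extension) (use e in auto)
  then obtain D where D: "\<forall>j\<le>q. \<forall>x\<in>{e..1 - e}. D j x = G j x"
    "\<forall>j<q. \<forall>x\<in>{-1..2}. (D j has_real_derivative D (Suc j) x) (at x within {-1..2})"
    "\<And>x. D q x = G q (max e (min x (1 - e)))"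
    by blast
  have Dder: "(D j has_real_derivative D (Suc j) x) (at x)" if "j < q" "x \<in> {0..1}" for j x
  proof -
    have "at x within {-1..2} = at x" using that by (intro at_within_interior) auto
    moreover have "x \<in> {-1..2}" using that by auto
    ultimately show ?thesis using D(2)[rule_format, OF that(1), of x] by simp
  qed
  have Dlip: "\<bar>D q x - D q y\<bar> \<le> K l u * \<bar>x - y\<bar>" if "x \<in> {l..u}" "y \<in> {l..u}" for x y l u
    unfolding D(3) by (rule Hlip[OF that])
  have D0: "D 0 x = f x" if "x \<in> {e..1 - e}" for x using D(1) that by (simp add: G_def)
  \<comment> \<open>Each Lipschitz constant is converted into the node weight by two scalar
    inequalities, one per end point.\<close>
  have KW: "K l u \<le> M * W" if "1 / max l e \<le> c0 * (N / (real k + 1))" "1 / max (1 - u) e \<le> c0 * (N / (real N - real k + 1))" for l u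
    unfolding K_def W_def using that e ab k M0
    by (intro mult_left_mono powr_mult_le_node_weight) (auto simp: c0_def N_def le_max_iff_disj)
  have Nk: "real (N - k) = real N - real k" using k by (simp add: N_def)
  have kr1: "(real k + real r) * h \<le> 1"
  proof -
    have "(real k + real r) * h \<le> real m * h" using k mr h by (intro mult_right_mono) (auto simp: N_def)
    then show ?thesis using h by (simp add: mult.commute)
  qed
  have krh: "1 - (real k + real r) * h = real (N - k) / m"
    unfolding Nk using mr by (simp add: h_def field_simps)
  have k0h: "0 \<le> real k * h" using h by simp

  have p1: "\<bar>ndiff r (\<lambda>k. D 0 (real k * h)) k\<bar> \<le> h ^ r * (M * W)"
  proof -
    have "\<bar>ndiff r (\<lambda>k. D 0 (real k * h)) k\<bar> \<le> h ^ r * K (real k * h) ((real k + real r) * h)"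
      unfolding rq
    proof (rule abs_ndiff_chain_lipschitz_le[where E=D and l="real k * h" and u="(real k + real (Suc q)) * h"])
      show "(D j has_real_derivative D (Suc j) x) (at x)"
        if j: "j < q" and x: "x \<in> {real k * h..(real k + real (Suc q)) * h}" for j x
      proof (rule Dder[OF j])
        have "0 \<le> x" by (rule order_trans[OF k0h]) (use x in simp)
        moreover have "x \<le> (real k + real (Suc q)) * h" using x by simp
        ultimately show "x \<in> {0..1}" using kr1[unfolded rq] by simp
      qed
    qed (use Dlip h in auto)
    also have "\<dots> \<le> h ^ r * (M * W)"
    proof (intro mult_left_mono KW)
      show "1 / max (real k * h) e \<le> c0 * (N / (real k + 1))"
        using inverse_max_node_le[of n m r N k] n4 nm mN by (simp add: h_def e_def c0_def)
      show "1 / max (1 - (real k + real r) * h) e \<le> c0 * (N / (real N - real k + 1))"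
        unfolding krh using inverse_max_node_le[of n m r N "N - k"] n4 nm mN by (simp add: e_def c0_def Nk)
    qed (use h in auto)
    finally show ?thesis .
  qed

  \<comment> \<open>\<open>r\<close> steps of length at most \<open>e\<close> that start below
    \<open>2 * e\<close> end below \<open>\<delta>\<close>, and the left interpolation nodes lie
    there as well; the right layer is symmetric. The product \<open>n * \<delta>\<close> depends on
    \<open>r\<close> alone.\<close>
  define \<delta> where "\<delta> = (real r + 2) * e"
  have \<delta>: "0 < \<delta>" "real n * \<delta> + 1 = real r + 3" using e n4' by (auto simp: \<delta>_def e_def)
  have n2: "real n * (2 * e) = 2" "2 * e * m * n = 2 * m" using n4' by (auto simp: e_def)
  \<comment> \<open>For \<open>n\<close> below \<open>r + 3\<close> the layer may fill the whole
    interval, but then the clamp level \<open>e\<close> is itself bounded below.\<close>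
  have ir: "1 / max (1 - \<delta>) e \<le> real r + 3"
  proof -
    have "1 / (real r + 3) \<le> max (1 - \<delta>) e"
    proof (cases "real n \<ge> real r + 3")
      case True
      then have "e * (real r + 3) \<le> 1" using e mult_left_mono[OF True, of e] by simp
      define X where "X = (real r + 2) * (e * (real r + 3))"
      have "X \<le> (real r + 2) * 1" unfolding X_def using \<open>e * (real r + 3) \<le> 1\<close> by (intro mult_left_mono) auto
      then have "1 \<le> (real r + 3) - X" by simp
      also have "\<dots> = (1 - \<delta>) * (real r + 3)" by (simp add: \<delta>_def X_def algebra_simps)
      finally have "1 \<le> (1 - \<delta>) * (real r + 3)" .
      then have "1 / (real r + 3) \<le> 1 - \<delta>" by (simp add: divide_le_eq)
      then show ?thesis by simp
    next
      case False
      then have "1 / (real r + 3) \<le> e" unfolding e_def using n4' by (intro divide_left_mono) auto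
      then show ?thesis by simp
    qed
    then have "1 / max (1 - \<delta>) e \<le> 1 / (1 / (real r + 3))"
      using e by (intro divide_left_mono mult_pos_pos) (auto simp: less_max_iff_disj)
    then show ?thesis by simp
  qed
  have i0: "1 / max 0 e = n" using e by (simp add: max_def e_def)
  have nodes: "inj_on (\<lambda>i. real i / real n) {1..r}" "inj_on (\<lambda>i. 1 - real i / real n) {1..r}"
    using n4 by (auto simp: inj_on_def)
  have node_in: "real i / n \<in> {e..1 - e}" "1 - real i / n \<in> {e..1 - e}" if "i \<in> {1..r}" for i
    using that n4' by (auto simp: e_def field_simps)
  obtain P where P: "\<And>x. poly P x = Lr r n f x" "degree P \<le> q"
    using lagrange_interp_poly[of "{1..r}" "\<lambda>i. real i / real n" f] unfolding Lr_def q_def by auto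
  obtain Q where Q: "\<And>x. poly Q x = Rr r n f x" "degree Q \<le> q"
    using lagrange_interp_poly[of "{1..r}" "\<lambda>i. 1 - real i / real n" f] unfolding Rr_def q_def by auto
  have Pn: "poly P (real i / n) = D 0 (real i / n)" if "i \<in> {1..r}" for i
    using D0 node_in(1)[OF that] lagrange_interp_node[OF _ nodes(1) that, of f] by (simp add: P Lr_def)
  have Qn: "poly Q (1 - real i / n) = D 0 (1 - real i / n)" if "i \<in> {1..r}" for i
    using D0 node_in(2)[OF that] lagrange_interp_node[OF _ nodes(2) that, of f] by (simp add: Q Rr_def)
  define C2 where "C2 = 1 + S * (real r + 3) ^ r"
  have S0: "0 \<le> S" using S[of 0 0] by simp
  have C2: "0 \<le> C2" using S0 by (simp add: C2_def)
  have W0: "0 \<le> M * W" unfolding W_def by (intro mult_nonneg_nonneg M0 powr_ge_zero node_weight_nonneg)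

  have p2: "\<bar>ndiff r (\<lambda>k. (1 - \<psi> (n * (real k * h) - 1)) * (Lr r n f (real k * h) - D 0 (real k * h))) k\<bar> \<le> h ^ r * (M * W) * C2"
  \<comment> \<open>Nodes from \<open>2 / n\<close> on are not affected by the left correction;
    every other window lies in \<open>{0..min 1 \<delta>}\<close>.\<close>
  proof (cases "2 * e \<le> real k * h")
    case True
    have "ndiff r (\<lambda>k. (1 - \<psi> (n * (real k * h) - 1)) * (Lr r n f (real k * h) - D 0 (real k * h))) k = 0"
    proof (rule ndiff_eq_0)
      fix j
      have "2 * e \<le> real (k + j) * h" using True h by (simp add: distrib_right add_increasing2)
      then have "n * (2 * e) \<le> n * (real (k + j) * h)" by (intro mult_left_mono) auto
      then have "1 \<le> n * (real (k + j) * h) - 1" using n2(1) by linarith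
      then show "(1 - \<psi> (n * (real (k + j) * h) - 1)) * (Lr r n f (real (k + j) * h) - D 0 (real (k + j) * h)) = 0"
        using psi1 by simp
    qed
    then show ?thesis using W0 C2 h by simp
  next
    case False
    define u where "u = min 1 \<delta>"
    define T where "T j x = - (real n ^ j * (deriv ^^ j) \<psi> (real n * x + -1))" for j x
    have ku: "(real k + real (Suc q)) * h \<le> u"
    proof -
      have "real r * h \<le> real r * e" using h by (intro mult_left_mono) auto
      then have "(real k + real r) * h \<le> \<delta>" using False by (simp add: \<delta>_def algebra_simps)
      then show ?thesis using kr1 rq by (simp add: u_def)
    qed
    have "\<bar>ndiff (Suc q) (\<lambda>k. (1 + T 0 (real k * h)) * (poly P (real k * h) - D 0 (real k * h))) k\<bar>
     \<le> h ^ Suc q * K 0 u * (1 + S * (real n * \<delta> + 1) ^ Suc q)"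
    proof (rule abs_ndiff_blend_le[where l = 0 and u = u and z = "\<lambda>i. real (Suc i) / n"])
      show "real (Suc i) / n \<in> {0..u} \<and> poly P (real (Suc i) / n) = D 0 (real (Suc i) / n)" if "i \<le> q" for i
      proof -
        have "real (Suc i) / n \<le> \<delta>" using that rq n4' by (simp add: \<delta>_def e_def divide_right_mono)
        moreover have "real (Suc i) / n \<le> 1" using that rq n4' by (simp add: field_simps)
        ultimately show ?thesis using Pn[of "Suc i"] that rq by (simp add: u_def)
      qed
      show "(T j has_real_derivative T (Suc j) x) (at x)" for j x
        unfolding T_def by (rule DERIV_affine_smooth[OF psi_smooth])
      show "\<bar>T j x\<bar> \<le> S * real n ^ j" if "j \<le> Suc q" for j x
      proof -
        have "\<bar>T j x\<bar> = \<bar>(deriv ^^ j) \<psi> (real n * x + -1)\<bar> * real n ^ j"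
          by (simp add: T_def abs_mult power_abs)
        also have "\<dots> \<le> S * real n ^ j" using S that rq by (intro mult_right_mono) auto
        finally show ?thesis .
      qed
    qed (use Dder Dlip P K0 \<delta> h k0h ku n4' in \<open>auto simp: u_def divide_strict_right_mono\<close>)
    also have "\<dots> = h ^ r * K 0 u * C2" by (simp only: \<delta> C2_def rq)
    also have "\<dots> \<le> h ^ r * (M * W) * C2"
    proof (intro mult_right_mono mult_left_mono KW)
      have "real k * h * m \<le> 2 * e * m" using False mr by (intro mult_right_mono) auto
      then have "real k \<le> 2 * e * m" using h by (simp add: mult.assoc)
      then have "real k * n \<le> 2 * e * m * n" by (intro mult_right_mono) auto
      then have "real k * n \<le> 2 * m" using n2(2) by linarith
      then show "1 / max 0 e \<le> c0 * (N / (real k + 1))"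
        unfolding i0 c0_def using n4 nm mN by (intro boundary_node_le) auto
      have "1 / max (1 - u) e \<le> real r + 3"
      proof -
        have "max (1 - u) e \<ge> max (1 - \<delta>) e" "0 < max (1 - \<delta>) e" using e by (auto simp: u_def)
        then have "1 / max (1 - u) e \<le> 1 / max (1 - \<delta>) e" by (intro divide_left_mono) auto
        then show ?thesis using ir by linarith
      qed
      also have "\<dots> \<le> c0 * (N / (real N - real k + 1))"
        using const_node_le[of N "N - k" "real r + 3"] mr by (simp add: c0_def Nk)
      finally show "1 / max (1 - u) e \<le> c0 * (N / (real N - real k + 1))" .
    qed (use h C2 in auto)
    finally show ?thesis by (simp add: rq T_def P)
  qed

  have p3: "\<bar>ndiff r (\<lambda>k. (1 - \<psi> (n - n * (real k * h) - 1)) * (Rr r n f (real k * h) - D 0 (real k * h))) k\<bar> \<le> h ^ r * (M * W) * C2"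
  proof (cases "(real k + real r) * h \<le> 1 - 2 * e")
    case True
    have "ndiff r (\<lambda>k. (1 - \<psi> (n - n * (real k * h) - 1)) * (Rr r n f (real k * h) - D 0 (real k * h))) k = 0"
    proof (rule ndiff_eq_0)
      fix j assume "j \<le> r"
      then have "real (k + j) * h \<le> (real k + real r) * h" using h by (intro mult_right_mono) auto
      then have "real (k + j) * h \<le> 1 - 2 * e" using True by linarith
      then have "n * (real (k + j) * h) \<le> n * (1 - 2 * e)" by (intro mult_left_mono) auto
      then have "1 \<le> n - n * (real (k + j) * h) - 1" unfolding right_diff_distrib using n2(1) by linarith
      then show "(1 - \<psi> (n - n * (real (k + j) * h) - 1)) * (Rr r n f (real (k + j) * h) - D 0 (real (k + j) * h)) = 0"
        using psi1 by simp
    qed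
    then show ?thesis using W0 C2 h by simp
  next
    case False
    define l where "l = max 0 (1 - \<delta>)"
    define T where "T j x = - ((- real n) ^ j * (deriv ^^ j) \<psi> (- real n * x + (real n - 1)))" for j x
    have kl: "l \<le> real k * h"
    proof -
      have "real r * h \<le> real r * e" using h by (intro mult_left_mono) auto
      then have "1 - \<delta> \<le> real k * h" using False by (simp add: \<delta>_def algebra_simps)
      then show ?thesis using k0h by (simp add: l_def)
    qed
    have "\<bar>ndiff (Suc q) (\<lambda>k. (1 + T 0 (real k * h)) * (poly Q (real k * h) - D 0 (real k * h))) k\<bar>
     \<le> h ^ Suc q * K l 1 * (1 + S * (real n * \<delta> + 1) ^ Suc q)"
    \<comment> \<open>The right-hand nodes are listed in reverse so that they increase, as Rolle's
      theorem requires.\<close>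
    proof (rule abs_ndiff_blend_le[where l = l and u = 1 and z = "\<lambda>i. 1 - real (r - i) / n"])
      show "1 - real (r - i) / n \<in> {l..1} \<and> poly Q (1 - real (r - i) / n) = D 0 (1 - real (r - i) / n)" if "i \<le> q" for i
      proof -
        have "real (r - i) / n \<le> \<delta>" using that rq n4' by (simp add: \<delta>_def e_def divide_right_mono)
        moreover have "real (r - i) / n \<le> 1" using that rq n4' by (simp add: field_simps)
        ultimately show ?thesis using Qn[of "r - i"] that rq by (simp add: l_def)
      qed
      show "(T j has_real_derivative T (Suc j) x) (at x)" for j x
        unfolding T_def by (rule DERIV_affine_smooth[OF psi_smooth])
      show "\<bar>T j x\<bar> \<le> S * real n ^ j" if "j \<le> Suc q" for j x
      proof -
        have "\<bar>T j x\<bar> = \<bar>(deriv ^^ j) \<psi> (- real n * x + (real n - 1))\<bar> * real n ^ j"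
          by (simp add: T_def abs_mult power_abs)
        also have "\<dots> \<le> S * real n ^ j" using S that rq by (intro mult_right_mono) auto
        finally show ?thesis .
      qed
      show "1 - real (r - i) / n < 1 - real (r - Suc i) / n" if "i < q" for i
        using that rq n4' by (simp add: divide_strict_right_mono of_nat_diff)
    qed (use Dder Dlip Q K0 \<delta> h kl kr1 rq n4' in \<open>auto simp: l_def\<close>)
    also have "\<dots> = h ^ r * K l 1 * C2" by (simp only: \<delta> C2_def rq)
    also have "\<dots> \<le> h ^ r * (M * W) * C2"
    proof (intro mult_right_mono mult_left_mono KW)
      have "real (N - k) / m \<le> 2 * e" using False krh by simp
      then have "real (N - k) \<le> 2 * e * m" using mr by (simp add: field_simps)
      then have "real (N - k) * n \<le> 2 * e * m * n" by (intro mult_right_mono) auto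
      then have "real (N - k) * n \<le> 2 * m" using n2(2) by linarith
      then have "real n \<le> c0 * (N / (real (N - k) + 1))"
        unfolding c0_def using n4 nm mN by (intro boundary_node_le) auto
      then show "1 / max (1 - 1) e \<le> c0 * (N / (real N - real k + 1))"
        using i0 by (simp add: Nk)
      have "1 / max l e \<le> real r + 3"
      proof -
        have "max l e \<ge> max (1 - \<delta>) e" "0 < max (1 - \<delta>) e" using e by (auto simp: l_def)
        then have "1 / max l e \<le> 1 / max (1 - \<delta>) e" by (intro divide_left_mono) auto
        then show ?thesis using ir by linarith
      qed
      also have "\<dots> \<le> c0 * (N / (real k + 1))"
        using const_node_le[of N k "real r + 3"] mr k by (simp add: c0_def N_def)
      finally show "1 / max l e \<le> c0 * (N / (real k + 1))" .
    qed (use h C2 in auto)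
    finally show ?thesis by (simp add: rq T_def Q algebra_simps)
  qed

  have "(\<lambda>k. Fn \<psi> r n f (real k / real m)) = (\<lambda>k. D 0 (real k * h)
      + (1 - \<psi> (n * (real k * h) - 1)) * (Lr r n f (real k * h) - D 0 (real k * h))
      + (1 - \<psi> (n - n * (real k * h) - 1)) * (Rr r n f (real k * h) - D 0 (real k * h)))"
    using Fn_decomp[where D="D 0" and f=f and r=r, OF psi0 psi1 n4(1)] D0 by (simp add: h_def e_def)
  then have "\<bar>ndiff r (\<lambda>k. Fn \<psi> r n f (real k / real m)) k\<bar> \<le> h ^ r * (M * W) + h ^ r * (M * W) * C2 + h ^ r * (M * W) * C2"
    using p1 p2 p3 by (simp only: ndiff_add)
  also have "\<dots> = h ^ r * (M * W) * (1 + 2 * C2)" by (simp add: algebra_simps)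
  finally show ?thesis by (simp only: h_def W_def C2_def c0_def N_def)
qed

section \<open>Pointwise size of the modified function\<close>

lemma abs_lagrange_interp_le:
  fixes B c x :: real
  assumes I: "finite I" and f: "\<And>i. i \<in> I \<Longrightarrow> \<bar>f (xs i)\<bar> \<le> B"
    and c: "\<And>i j. i \<in> I \<Longrightarrow> j \<in> I \<Longrightarrow> i \<noteq> j \<Longrightarrow> \<bar>(x - xs j) / (xs i - xs j)\<bar> \<le> c" "1 \<le> c"
  shows "\<bar>lagrange_interp xs I f x\<bar> \<le> card I * c ^ card I * B"
proof -
  have "\<bar>lagrange_interp xs I f x\<bar> \<le> (\<Sum>i\<in>I. \<bar>f (xs i) * (\<Prod>j\<in>I - {i}. (x - xs j) / (xs i - xs j))\<bar>)"
    unfolding lagrange_interp_def by (rule sum_abs)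
  also have "\<dots> \<le> (\<Sum>i\<in>I. B * c ^ card I)"
  proof (rule sum_mono)
    fix i assume i: "i \<in> I"
    have "\<bar>\<Prod>j\<in>I - {i}. (x - xs j) / (xs i - xs j)\<bar> = (\<Prod>j\<in>I - {i}. \<bar>(x - xs j) / (xs i - xs j)\<bar>)"
      by (rule abs_prod)
    also have "\<dots> \<le> (\<Prod>j\<in>I - {i}. c)" using c i by (intro prod_mono) auto
    also have "\<dots> = c ^ card (I - {i})" by simp
    also have "\<dots> \<le> c ^ card I" using c(2) I by (intro power_increasing card_mono) auto
    finally show "\<bar>f (xs i) * (\<Prod>j\<in>I - {i}. (x - xs j) / (xs i - xs j))\<bar> \<le> B * c ^ card I"
      unfolding abs_mult using f[OF i] by (intro mult_mono) auto
  qed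
  also have "\<dots> = card I * c ^ card I * B" by simp
  finally show ?thesis .
qed

text \<open>In the middle the weight bounds \<open>f\<close> directly. In a boundary layer the
  interpolant is a bounded combination of values at nodes comparably far from both end points, and
  the blend is a convex combination of \<open>f\<close> and the interpolant.\<close>

lemma abs_Fn_le:
  fixes M a b :: real
  assumes r: "2 \<le> r"
    and psi_range: "\<And>t. 0 \<le> \<psi> t \<and> \<psi> t \<le> 1"
    and ab: "0 \<le> a" "0 \<le> b"
    and n: "admissible r n" and nm: "n \<le> m"
    and M: "\<And>y. y \<in> {0<..<1} \<Longrightarrow> \<bar>wt a b y * f y\<bar> \<le> M"
    and k: "k \<le> m"
  shows "\<bar>Fn \<psi> r n f (real k / real m)\<bar>
    \<le> (real r * real r ^ r + 1) * (M * ((3 * (real r + 3)) powr (a + b) * node_weight a b m k))"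
proof -
  define x where "x = real k / real m"
  define W where "W = (3 * (real r + 3)) powr (a + b) * node_weight a b m k"
  define C where "C = real r * real r ^ r"
  have n4: "4 \<le> real n" "real r + 1 \<le> real n" using n by (auto simp: admissible_def)
  have m: "0 < m" "real n \<le> real m" "real m \<le> (real r + 1) * m" using nm n4 by (auto simp: algebra_simps)
  have M0: "0 \<le> M" using order_trans[OF abs_ge_zero M[of "1/2"]] by simp
  have MW0: "0 \<le> M * W" unfolding W_def by (intro mult_nonneg_nonneg M0 powr_ge_zero node_weight_nonneg)
  have C0: "0 \<le> C" by (simp add: C_def)
  have mk: "real (m - k) = real m - real k" using k by simp
  have W: "M * (X powr a * Y powr b) \<le> M * W" if "0 \<le> X" "X \<le> 3 * (real r + 3) * (m / (real k + 1))"
    "0 \<le> Y" "Y \<le> 3 * (real r + 3) * (m / (real m - real k + 1))" for X Y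
    unfolding W_def using that ab k M0 by (intro mult_left_mono powr_mult_le_node_weight) auto
  have x1: "1 - x = real (m - k) / m" unfolding mk using m by (simp add: x_def field_simps)
  have fx: "\<bar>f x\<bar> \<le> M * W" if x: "1 / n \<le> x" "1 / n \<le> 1 - x"
  proof -
    have n0: "0 < 1 / real n" using n4 by simp
    then have x01: "0 < x" "x < 1" using x by linarith+
    then have "\<bar>f x\<bar> \<le> M * ((1 / x) powr a * (1 / (1 - x)) powr b)"
      using M[of x] ab by (intro wt_inverse_bound) auto
    also have "\<dots> \<le> M * W"
    proof (rule W)
      have "max x (1 / n) = x" "max (1 - x) (1 / n) = 1 - x" using x by auto
      then show "1 / x \<le> 3 * (real r + 3) * (m / (real k + 1))"
        "1 / (1 - x) \<le> 3 * (real r + 3) * (m / (real m - real k + 1))"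
        using inverse_max_node_le[of n m r m k] inverse_max_node_le[of n m r m "m - k"] n4 nm m
        by (simp_all add: x1 mk) (simp_all add: x_def)
    qed (use x01 in auto)
    finally show ?thesis .
  qed
  have L: "\<bar>Lr r n f x\<bar> \<le> C * (M * W)" if "x \<le> 2 / n"
  proof -
    have "\<bar>Lr r n f x\<bar> \<le> card {1..r} * real r ^ card {1..r} * (M * W)"
      unfolding Lr_def
    proof (rule abs_lagrange_interp_le)
      fix i assume i: "i \<in> {1..r}"
      have "\<bar>f (real i / n)\<bar> \<le> M * ((1 / (1 / n)) powr a * (1 / (1 - r / n)) powr b)"
        using i n4 ab M[of "real i / n"] by (intro wt_inverse_bound) (auto simp: divide_right_mono)
      also have "\<dots> \<le> M * W"
      proof (rule W)
        have "real k * n \<le> 2 * m" using that n4 m by (simp add: x_def field_simps)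
        then show "1 / (1 / n) \<le> 3 * (real r + 3) * (m / (real k + 1))"
          using boundary_node_le[of n m r m k] n4 nm m by simp
        \<comment> \<open>Admissibility gives \<open>r + 1 \<le> n\<close>, which keeps the nodes at
          distance at least \<open>1 / (r + 1)\<close> from the opposite end.\<close>
        have "1 \<le> (1 - r / n) * (real r + 1)"
        proof -
          have "real r * (real r + 1) / n \<le> real r" using n4 by (simp add: divide_le_eq mult_left_mono)
          then show ?thesis by (simp add: algebra_simps add_divide_distrib)
        qed
        then have "1 / (1 - r / n) \<le> real r + 1" using n4 by (simp add: divide_le_eq mult.commute)
        also have "\<dots> \<le> real r + 3" by simp
        also have "\<dots> \<le> 3 * (real r + 3) * (m / (real m - real k + 1))"
          using const_node_le[of m "m - k" "real r + 3"] m by (simp add: mk)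
        finally show "1 / (1 - r / n) \<le> 3 * (real r + 3) * (m / (real m - real k + 1))" .
      qed (use n4 in auto)
      finally show "\<bar>f (real i / n)\<bar> \<le> M * W" .
    next
      fix i j assume ij: "i \<in> {1..r}" "j \<in> {1..r}" "i \<noteq> j"
      have nx: "0 \<le> n * x" "n * x \<le> 2" using that n4 by (auto simp: x_def field_simps)
      have "(x - real j / n) / (real i / n - real j / n) = (n * x - real j) / (real i - real j)"
      proof -
        have "x - real j / n = (n * x - real j) / n" "real i / n - real j / n = (real i - real j) / n"
          using n4 by (auto simp: field_simps)
        then show ?thesis using n4 by simp
      qed
      also have "\<bar>\<dots>\<bar> \<le> real r / 1"
        unfolding abs_divide
      proof (rule frac_le)
        show "\<bar>n * x - real j\<bar> \<le> real r" using nx ij r by auto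
        show "1 \<le> \<bar>real i - real j\<bar>" using ij(3) by linarith
      qed auto
      finally show "\<bar>(x - real j / n) / (real i / n - real j / n)\<bar> \<le> real r" by simp
    qed (use r in auto)
    then show ?thesis by (simp add: C_def)
  qed
  have R: "\<bar>Rr r n f x\<bar> \<le> C * (M * W)" if "1 - 2 / n \<le> x"
  proof -
    have "\<bar>Rr r n f x\<bar> \<le> card {1..r} * real r ^ card {1..r} * (M * W)"
      unfolding Rr_def
    proof (rule abs_lagrange_interp_le)
      fix i assume i: "i \<in> {1..r}"
      have "\<bar>f (1 - real i / n)\<bar> \<le> M * ((1 / (1 - r / n)) powr a * (1 / (1 - (1 - 1 / n))) powr b)"
        using i n4 ab M[of "1 - real i / n"] by (intro wt_inverse_bound) (auto simp: divide_right_mono)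
      also have "\<dots> \<le> M * W"
      proof (rule W)
        have "1 - x \<le> 2 / n" using that by simp
        then have "real (m - k) * n \<le> 2 * m" using n4 m unfolding x1 by (simp add: field_simps)
        then show "1 / (1 - (1 - 1 / n)) \<le> 3 * (real r + 3) * (m / (real m - real k + 1))"
          using boundary_node_le[of n m r m "m - k"] n4 nm m by (simp add: mk)
        have "1 \<le> (1 - r / n) * (real r + 1)"
        proof -
          have "real r * (real r + 1) / n \<le> real r" using n4 by (simp add: divide_le_eq mult_left_mono)
          then show ?thesis by (simp add: algebra_simps add_divide_distrib)
        qed
        then have "1 / (1 - r / n) \<le> real r + 1" using n4 by (simp add: divide_le_eq mult.commute)
        also have "\<dots> \<le> real r + 3" by simp
        also have "\<dots> \<le> 3 * (real r + 3) * (m / (real k + 1))"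
          using const_node_le[of m k "real r + 3"] m k by simp
        finally show "1 / (1 - r / n) \<le> 3 * (real r + 3) * (m / (real k + 1))" .
      qed (use n4 in auto)
      finally show "\<bar>f (1 - real i / n)\<bar> \<le> M * W" .
    next
      fix i j assume ij: "i \<in> {1..r}" "j \<in> {1..r}" "i \<noteq> j"
      have "x \<le> 1" using m k by (simp add: x_def)
      then have "real n * x \<le> real n * 1" by (intro mult_left_mono) auto
      moreover have "n * (1 - 2 / n) \<le> n * x" using that by (intro mult_left_mono) auto
      then have "real n - 2 \<le> n * x" using n4 by (simp add: algebra_simps)
      ultimately have nx: "0 \<le> n - n * x" "n - n * x \<le> 2" using n4 by auto
      have "(x - (1 - real j / n)) / (1 - real i / n - (1 - real j / n)) = (n - n * x - real j) / (real i - real j)"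
      proof -
        have "x - (1 - real j / n) = - (n - n * x - real j) / n" "1 - real i / n - (1 - real j / n) = - (real i - real j) / n"
          using n4 by (auto simp: field_simps)
        then show ?thesis using n4 by (simp add: minus_divide_left[symmetric] del: minus_diff_eq)
      qed
      also have "\<bar>\<dots>\<bar> \<le> real r / 1"
        unfolding abs_divide
      proof (rule frac_le)
        show "\<bar>n - n * x - real j\<bar> \<le> real r" using nx ij r by auto
        show "1 \<le> \<bar>real i - real j\<bar>" using ij(3) by linarith
      qed auto
      finally show "\<bar>(x - (1 - real j / n)) / (1 - real i / n - (1 - real j / n))\<bar> \<le> real r" by simp
    qed (use r in auto)
    then show ?thesis by (simp add: C_def)
  qed
  have conv: "\<bar>l + \<psi> t * (y - l)\<bar> \<le> (C + 1) * (M * W)" if "\<bar>l\<bar> \<le> C * (M * W)" "\<bar>y\<bar> \<le> M * W" for l y t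
  proof -
    have "l + \<psi> t * (y - l) = (1 - \<psi> t) * l + \<psi> t * y" by (simp add: algebra_simps)
    also have "\<bar>\<dots>\<bar> \<le> (1 - \<psi> t) * \<bar>l\<bar> + \<psi> t * \<bar>y\<bar>"
      using psi_range[of t] abs_triangle_ineq[of "(1 - \<psi> t) * l" "\<psi> t * y"] by (simp add: abs_mult)
    also have "\<dots> \<le> 1 * \<bar>l\<bar> + 1 * \<bar>y\<bar>" using psi_range[of t] by (intro add_mono mult_right_mono) auto
    finally show ?thesis using that by (simp add: algebra_simps)
  qed
  have le: "C * (M * W) \<le> (C + 1) * (M * W)" "M * W \<le> (C + 1) * (M * W)"
    using MW0 C0 by (auto simp: distrib_right)
  have n2: "2 / real n \<le> 1 / 2" "1 / real n \<le> 1 / 4" "1 / real n \<le> 2 / real n" using n4 by (auto simp: field_simps)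
  have "\<bar>Fn \<psi> r n f x\<bar> \<le> (C + 1) * (M * W)"
  proof -
    consider "x \<le> 1 / n" | "1 / n < x" "x \<le> 2 / n" | "2 / n < x" "x < 1 - 2 / n"
      | "2 / n < x" "1 - 2 / n \<le> x" "x < 1 - 1 / n" | "2 / n < x" "1 - 1 / n \<le> x"
      using n2 by linarith
    then show ?thesis
    proof cases
      case 1
      then show ?thesis using L n2 le by (simp add: Fn_def)
    next
      case 2
      then have "\<bar>Lr r n f x + \<psi> (n * x - 1) * (f x - Lr r n f x)\<bar> \<le> (C + 1) * (M * W)"
        using n2 by (intro conv L fx) auto
      then show ?thesis using 2 by (simp add: Fn_def)
    next
      case 3
      then show ?thesis using fx n2 le by (simp add: Fn_def)
    next
      case 4
      then have "\<bar>Rr r n f x + \<psi> (n - n * x - 1) * (f x - Rr r n f x)\<bar> \<le> (C + 1) * (M * W)"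
        using n2 by (intro conv R fx) auto
      then show ?thesis using 4 n2 by (simp add: Fn_def)
    next
      case 5
      then show ?thesis using R n2 le by (simp add: Fn_def)
    qed
  qed
  then show ?thesis by (simp only: x_def C_def W_def)
qed

section \<open>From node values to derivatives of the combination\<close>

lemma node_weight_shift:
  assumes "0 \<le> a" "0 \<le> b" "r < m" "k \<le> m - r" "j \<le> r"
  shows "node_weight a b m (k + j) \<le> (real r + 1) powr (a + b) * node_weight a b (m - r) k"
proof -
  define N where "N = m - r"
  have N: "real N = real m - real r" "0 < N" using assms by (auto simp: N_def)
  have mN: "real m \<le> (real r + 1) * N"
  proof -
    have "real m = real N + real r * 1" using N by simp
    also have "\<dots> \<le> real N + real r * N" using N(2) by (intro add_left_mono mult_left_mono) auto
    finally show ?thesis by (simp add: algebra_simps)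
  qed
  have kN: "real k \<le> real N" using assms by (simp add: N_def)
  have "(m / (real (k + j) + 1)) powr a * (m / (real m - real (k + j) + 1)) powr b
     \<le> (real r + 1) powr (a + b) * node_weight a b N k"
  proof (rule powr_mult_le_node_weight)
    have "m / (real (k + j) + 1) \<le> ((real r + 1) * N) / (real k + 1)" using mN by (intro frac_le) auto
    then show "m / (real (k + j) + 1) \<le> (real r + 1) * (N / (real k + 1))" by simp
    have "m / (real m - real (k + j) + 1) \<le> ((real r + 1) * N) / (real N - real k + 1)"
      using mN N kN assms by (intro frac_le) auto
    then show "m / (real m - real (k + j) + 1) \<le> (real r + 1) * (N / (real N - real k + 1))" by simp
  qed (use assms kN N in \<open>auto simp: N_def\<close>)
  then show ?thesis by (simp add: node_weight_def N_def)
qed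

lemma bernstein_eq_bern_sum: "bernstein m g = bern_sum m (\<lambda>k. g (real k / real m))"
  by (rule ext) (simp add: bernstein_def bern_sum_def Bernstein_def atLeast0AtMost mult.assoc)

lemma funpow_deriv_Bstar:
  "(deriv ^^ r) (Bstar \<psi> r nn c n f) x =
     (\<Sum>i=0..r-2. c n i * (deriv ^^ r) (bern_sum (nn n i) (\<lambda>k. Fn \<psi> r n f (real k / real (nn n i)))) x)"
proof -
  define E where "E j x = (\<Sum>i=0..r-2. c n i * (\<Sum>k\<le>nn n i. Fn \<psi> r n f (real k / real (nn n i))
      * poly ((pderiv ^^ j) (Bernstein_poly (nn n i) k)) x))" for j x
  have "(E j has_real_derivative E (Suc j) x) (at x)" for j x
    unfolding E_def funpow.simps comp_def by (intro DERIV_sum DERIV_cmult poly_DERIV)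
  then have fd: "(deriv ^^ r) (E 0) = E r" by (rule funpow_deriv_chain)
  have E0: "E 0 = Bstar \<psi> r nn c n f"
    by (rule ext) (simp add: E_def Bstar_def comb_bernstein_def bernstein_eq_bern_sum bern_sum_def poly_Bernstein_poly)
  show ?thesis using fd unfolding E0 by (simp add: E_def funpow_deriv_bern_sum_poly)
qed

lemma abs_bern_sum_le:
  assumes "0 < x" "x < 1" "\<And>k. k \<le> N \<Longrightarrow> \<bar>a k\<bar> \<le> T * b k"
  shows "\<bar>bern_sum N a x\<bar> \<le> T * bern_sum N b x"
proof -
  have "\<bar>bern_sum N a x\<bar> \<le> (\<Sum>k\<le>N. \<bar>a k * Bernstein N k x\<bar>)" unfolding bern_sum_def by (rule sum_abs)
  also have "\<dots> \<le> (\<Sum>k\<le>N. T * b k * Bernstein N k x)"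
  proof (rule sum_mono)
    fix k assume "k \<in> {..N}"
    then show "\<bar>a k * Bernstein N k x\<bar> \<le> T * b k * Bernstein N k x"
      using assms by (simp add: abs_mult Bernstein_nonneg mult_right_mono)
  qed
  finally show ?thesis by (simp add: bern_sum_def sum_distrib_left mult.assoc)
qed

lemma abs_deriv_bern_sum_le:
  assumes x: "0 < x" "x < 1" and r: "r \<le> m" and T: "0 \<le> T"
    and a: "\<And>k. k \<le> m - r \<Longrightarrow> \<bar>ndiff r a k\<bar> \<le> T * b k"
  shows "\<bar>(deriv ^^ r) (bern_sum m a) x\<bar> \<le> real m ^ r * (T * bern_sum (m - r) b x)"
proof -
  have "(\<Prod>i<r. real (m - i)) \<le> (\<Prod>i<r. real m)" by (intro prod_mono) auto
  then have "(\<Prod>i<r. real (m - i)) \<le> real m ^ r" by simp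
  moreover have "0 \<le> (\<Prod>i<r. real (m - i))" by (intro prod_nonneg) auto
  moreover have "\<bar>bern_sum (m - r) (ndiff r a) x\<bar> \<le> T * bern_sum (m - r) b x"
    by (rule abs_bern_sum_le[OF x a])
  ultimately show ?thesis
    unfolding funpow_deriv_bern_sum[OF r] abs_mult by (intro mult_mono) auto
qed

section \<open>The two estimates\<close>

lemma phi_powr:
  assumes "0 < x" "x < 1"
  shows "phi x powr c = x powr (c / 2) * (1 - x) powr (c / 2)"
proof -
  have "phi x = (x * (1 - x)) powr (1 / 2)" using assms by (simp add: phi_def powr_half_sqrt)
  then show ?thesis using assms by (simp add: powr_powr powr_mult)
qed

lemma wt_mult_phi_powr:
  assumes "0 < x" "x < 1"
  shows "wt a b x * phi x powr c = wt (a + c / 2) (b + c / 2) x"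
  using assms by (simp add: wt_def phi_powr powr_add)

text \<open>The factor \<open>m ^ r\<close> produced by differentiation cancels the
  \<open>(1 / m) ^ r\<close> of the differences, and the weight absorbs the remaining sum of node
  weights.\<close>

lemma deriv_bern_sum_Fn_smooth_bound:
  assumes r: "2 \<le> r"
    and psi: "smooth_fun \<psi>" "\<And>t. 0 \<le> \<psi> t \<and> \<psi> t \<le> 1" "\<And>t. t \<le> 0 \<Longrightarrow> \<psi> t = 0" "\<And>t. 1 \<le> t \<Longrightarrow> \<psi> t = 1"
    and ab: "0 \<le> a" "0 \<le> b"
  shows "\<exists>C>0. \<forall>n m f g M x. admissible r n \<longrightarrow> n \<le> m \<longrightarrow> ac_deriv_class r f \<longrightarrow> is_rth_deriv r f g \<longrightarrow>
       (\<forall>y\<in>{0<..<1}. \<bar>wt a b y * g y\<bar> \<le> M) \<longrightarrow> 0 < x \<longrightarrow> x < 1 \<longrightarrow>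
       wt a b x * \<bar>(deriv ^^ r) (bern_sum m (\<lambda>k. Fn \<psi> r n f (real k / real m))) x\<bar> \<le> C * M"
proof -
  obtain S where S: "S > 0" "\<And>j t. j \<le> r \<Longrightarrow> \<bar>(deriv ^^ j) \<psi> t\<bar> \<le> S"
    using cutoff_derivs_bounded[of \<psi> r] psi by metis
  obtain C1 where C1: "C1 > 0"
    "\<And>N x. 0 < x \<Longrightarrow> x < 1 \<Longrightarrow> 0 < N \<Longrightarrow> wt a b x * bern_sum N (node_weight a b N) x \<le> C1"
    using weighted_bern_sum_bounded[OF ab] by metis
  define c where "c = (3 * (real r + 3)) powr (a + b)"
  define d where "d = 1 + 2 * (1 + S * (real r + 3) ^ r)"
  have c: "c > 0" by (simp add: c_def)
  have d: "d > 0" using S(1) by (simp add: d_def add_pos_nonneg)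
  have "wt a b x * \<bar>(deriv ^^ r) (bern_sum m (\<lambda>k. Fn \<psi> r n f (real k / real m))) x\<bar> \<le> (c * d * C1) * M"
    if H: "admissible r n" "n \<le> m" "ac_deriv_class r f" "is_rth_deriv r f g"
      "\<forall>y\<in>{0<..<1}. \<bar>wt a b y * g y\<bar> \<le> M" and x: "0 < x" "x < 1" for n m f g M x
  proof -
    have M0: "0 \<le> M" using order_trans[OF abs_ge_zero bspec[OF H(5), of "1/2"]] by simp
    have m: "r < m" using H by (auto simp: admissible_def)
    define T where "T = (1 / m) ^ r * (M * c * d)"
    have T0: "0 \<le> T" using M0 c d by (simp add: T_def)
    have "\<bar>ndiff r (\<lambda>k. Fn \<psi> r n f (real k / real m)) k\<bar> \<le> T * node_weight a b (m - r) k" if "k \<le> m - r" for k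
      using abs_ndiff_Fn_le[OF r psi(1,3,4) S(2) ab H(1-4) bspec[OF H(5)] that] by (simp add: T_def c_def d_def mult_ac)
    then have "\<bar>(deriv ^^ r) (bern_sum m (\<lambda>k. Fn \<psi> r n f (real k / real m))) x\<bar>
       \<le> real m ^ r * (T * bern_sum (m - r) (node_weight a b (m - r)) x)"
      using m by (intro abs_deriv_bern_sum_le x T0) auto
    also have "\<dots> = (M * c * d) * bern_sum (m - r) (node_weight a b (m - r)) x"
      using m by (simp add: T_def power_divide)
    finally have "wt a b x * \<bar>(deriv ^^ r) (bern_sum m (\<lambda>k. Fn \<psi> r n f (real k / real m))) x\<bar>
      \<le> wt a b x * ((M * c * d) * bern_sum (m - r) (node_weight a b (m - r)) x)"
      by (intro mult_left_mono) (auto simp: wt_def)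
    also have "\<dots> = (M * c * d) * (wt a b x * bern_sum (m - r) (node_weight a b (m - r)) x)" by simp
    also have "\<dots> \<le> (M * c * d) * C1"
      using C1(2)[OF x, of "m - r"] m M0 c d by (intro mult_left_mono) auto
    finally show ?thesis by (simp add: mult_ac)
  qed
  moreover have "c * d * C1 > 0" using c d C1 by simp
  ultimately show ?thesis by blast
qed

text \<open>Without smoothness each \<open>r\<close>-th difference is estimated by
  \<open>2 ^ r\<close> times the largest value involved, so the full \<open>m ^ r\<close> remains;
  \<open>node_weight_shift\<close> brings these values to degree \<open>m - r\<close>.\<close>

lemma deriv_bern_sum_Fn_uniform_bound:
  assumes r: "2 \<le> r" and psi: "\<And>t. 0 \<le> \<psi> t \<and> \<psi> t \<le> 1" and ab: "0 \<le> a" "0 \<le> b"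
  shows "\<exists>C>0. \<forall>n m f M x. admissible r n \<longrightarrow> n \<le> m \<longrightarrow>
       (\<forall>y\<in>{0<..<1}. \<bar>wt a b y * f y\<bar> \<le> M) \<longrightarrow> 0 < x \<longrightarrow> x < 1 \<longrightarrow>
       wt a b x * \<bar>(deriv ^^ r) (bern_sum m (\<lambda>k. Fn \<psi> r n f (real k / real m))) x\<bar> \<le> C * real m ^ r * M"
proof -
  obtain C1 where C1: "C1 > 0"
    "\<And>N x. 0 < x \<Longrightarrow> x < 1 \<Longrightarrow> 0 < N \<Longrightarrow> wt a b x * bern_sum N (node_weight a b N) x \<le> C1"
    using weighted_bern_sum_bounded[OF ab] by metis
  define c where "c = (3 * (real r + 3)) powr (a + b)"
  define d where "d = real r * real r ^ r + 1"
  define c' where "c' = (real r + 1) powr (a + b)"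
  define c2 where "c2 = 2 ^ r * (d * (c * c'))"
  have c: "c > 0" "c' > 0" by (simp_all add: c_def c'_def)
  have d: "d > 0" by (simp add: d_def add_nonneg_pos)
  have c2: "c2 > 0" using c d by (simp add: c2_def)
  have "wt a b x * \<bar>(deriv ^^ r) (bern_sum m (\<lambda>k. Fn \<psi> r n f (real k / real m))) x\<bar> \<le> (c2 * C1) * real m ^ r * M"
    if H: "admissible r n" "n \<le> m"
      "\<forall>y\<in>{0<..<1}. \<bar>wt a b y * f y\<bar> \<le> M" and x: "0 < x" "x < 1" for n m f M x
  proof -
    have M0: "0 \<le> M" using order_trans[OF abs_ge_zero bspec[OF H(3), of "1/2"]] by simp
    have m: "r < m" using H by (auto simp: admissible_def)
    have "\<bar>ndiff r (\<lambda>k. Fn \<psi> r n f (real k / real m)) k\<bar> \<le> (c2 * M) * node_weight a b (m - r) k"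
      if k: "k \<le> m - r" for k
    proof -
      have "\<bar>ndiff r (\<lambda>k. Fn \<psi> r n f (real k / real m)) k\<bar> \<le> 2 ^ r * (d * (M * (c * (c' * node_weight a b (m - r) k))))"
      proof (rule abs_ndiff_le)
        fix j assume j: "j \<le> r"
        have kj: "k + j \<le> m" using j k m by auto
        have "\<bar>Fn \<psi> r n f (real (k + j) / real m)\<bar> \<le> d * (M * (c * node_weight a b m (k + j)))"
          unfolding c_def d_def by (rule abs_Fn_le[OF r psi ab H(1,2) bspec[OF H(3)] kj])
        also have "\<dots> \<le> d * (M * (c * (c' * node_weight a b (m - r) k)))"
          using c d M0 node_weight_shift[OF ab m k j] unfolding c'_def
          by (intro mult_left_mono) auto
        finally show "\<bar>Fn \<psi> r n f (real (k + j) / real m)\<bar> \<le> d * (M * (c * (c' * node_weight a b (m - r) k)))" .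
      qed
      then show ?thesis by (simp add: c2_def mult_ac)
    qed
    then have "\<bar>(deriv ^^ r) (bern_sum m (\<lambda>k. Fn \<psi> r n f (real k / real m))) x\<bar>
       \<le> real m ^ r * ((c2 * M) * bern_sum (m - r) (node_weight a b (m - r)) x)"
      using m c2 M0 by (intro abs_deriv_bern_sum_le x) auto
    then have "wt a b x * \<bar>(deriv ^^ r) (bern_sum m (\<lambda>k. Fn \<psi> r n f (real k / real m))) x\<bar>
      \<le> wt a b x * (real m ^ r * ((c2 * M) * bern_sum (m - r) (node_weight a b (m - r)) x))"
      by (intro mult_left_mono) (auto simp: wt_def)
    also have "\<dots> = (real m ^ r * (c2 * M)) * (wt a b x * bern_sum (m - r) (node_weight a b (m - r)) x)" by simp
    also have "\<dots> \<le> (real m ^ r * (c2 * M)) * C1"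
      using C1(2)[OF x, of "m - r"] m M0 c2 by (intro mult_left_mono) auto
    finally show ?thesis by (simp add: mult_ac)
  qed
  moreover have "c2 * C1 > 0" using c2 C1 by simp
  ultimately show ?thesis by blast
qed

lemma mult_le_sum_squares: "(u::real) * v \<le> u\<^sup>2 + v\<^sup>2"
proof -
  have "u * v \<le> (u\<^sup>2 + v\<^sup>2) / 2" using zero_le_power2[of "u - v"] by (simp add: power2_diff)
  also have "\<dots> \<le> u\<^sup>2 + v\<^sup>2" by simp
  finally show ?thesis .
qed

text \<open>Each summand is a node weight times a power of the normalised deviation. The inequality
  between product and squares separates the two, leaving a weighted sum and a central moment of
  order \<open>2 * r\<close>.\<close>

lemma deriv_bern_sum_Fn_interior_bound:
  assumes r: "2 \<le> r" and psi: "\<And>t. 0 \<le> \<psi> t \<and> \<psi> t \<le> 1" and ab: "0 \<le> a" "0 \<le> b"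
  shows "\<exists>C>0. \<forall>n m f M x. admissible r n \<longrightarrow> n \<le> m \<longrightarrow>
       (\<forall>y\<in>{0<..<1}. \<bar>wt a b y * f y\<bar> \<le> M) \<longrightarrow> 0 < x \<longrightarrow> x < 1 \<longrightarrow> 1 \<le> real m * (x * (1 - x)) \<longrightarrow>
       wt a b x * (phi x ^ r * \<bar>(deriv ^^ r) (bern_sum m (\<lambda>k. Fn \<psi> r n f (real k / real m))) x\<bar>) \<le> C * sqrt (real m) ^ r * M"
proof -
  \<comment> \<open>The exponents are doubled because the node weights will occur squared.\<close>
  have ab2: "0 \<le> 2 * a" "0 \<le> 2 * b" using ab by auto
  obtain C1 where C1: "C1 > 0"
    "\<And>N x. 0 < x \<Longrightarrow> x < 1 \<Longrightarrow> 0 < N \<Longrightarrow> wt (2 * a) (2 * b) x * bern_sum N (node_weight (2 * a) (2 * b) N) x \<le> C1"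
    using weighted_bern_sum_bounded[OF ab2] by metis
  define c where "c = (3 * (real r + 3)) powr (a + b)"
  define d where "d = real r * real r ^ r + 1"
  define p :: real where "p = 2 ^ r * fact r"
  define mom :: real where "mom = fact (2 * r) * exp 1 * (2 * exp 1)"
  define C where "C = d * c * p * (C1 + mom)"
  have pos: "c > 0" "d > 0" "p > 0" "mom > 0" by (simp_all add: c_def d_def p_def mom_def add_nonneg_pos)
  have C: "C > 0" using pos C1 by (simp add: C_def)
  have "wt a b x * (phi x ^ r * \<bar>(deriv ^^ r) (bern_sum m (\<lambda>k. Fn \<psi> r n f (real k / real m))) x\<bar>) \<le> C * sqrt (real m) ^ r * M"
    if H: "admissible r n" "n \<le> m"
      "\<forall>y\<in>{0<..<1}. \<bar>wt a b y * f y\<bar> \<le> M" and x: "0 < x" "x < 1" and mx: "1 \<le> real m * (x * (1 - x))" for n m f M x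
  proof -
    have M0: "0 \<le> M" using order_trans[OF abs_ge_zero bspec[OF H(3), of "1/2"]] by simp
    have m: "0 < m" using H by (auto simp: admissible_def)
    define Z where "Z k = 1 + \<bar>real k - real m * x\<bar> / sqrt (real m * (x * (1 - x)))" for k :: nat
    define w where "w k = wt a b x * node_weight a b m k" for k
    define s where "s = sqrt (x * (1 - x) / m)"
    let ?P = "\<lambda>k. poly ((pderiv ^^ r) (Bernstein_poly m k)) x"
    let ?F = "\<lambda>k. Fn \<psi> r n f (real k / real m)"
    have B0: "0 \<le> Bernstein m k x" for k using x by (simp add: Bernstein_nonneg)
    have wt0: "0 \<le> wt a b x" by (simp add: wt_def)
    have s0: "0 \<le> s" using x by (simp add: s_def)
    have phi: "phi x = sqrt (real m) * s" unfolding phi_def s_def real_sqrt_mult[symmetric] using m by simp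
    have each: "wt a b x * (s ^ r * \<bar>?F k * ?P k\<bar>) \<le> (d * c * p * M) * ((w k)\<^sup>2 * Bernstein m k x + Z k ^ (2 * r) * Bernstein m k x)"
      if k: "k \<le> m" for k
    proof -
      have F: "\<bar>?F k\<bar> \<le> d * (M * (c * node_weight a b m k))"
        unfolding c_def d_def by (rule abs_Fn_le[OF r psi ab H(1,2) bspec[OF H(3)] k])
      have P: "s ^ r * \<bar>?P k\<bar> \<le> p * Z k ^ r * Bernstein m k x"
        unfolding s_def p_def Z_def by (rule Bernstein_poly_deriv_bound[OF x mx k])
      have "wt a b x * (s ^ r * \<bar>?F k * ?P k\<bar>) = wt a b x * (\<bar>?F k\<bar> * (s ^ r * \<bar>?P k\<bar>))"
        by (simp add: abs_mult mult_ac)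
      also have "\<dots> \<le> wt a b x * ((d * (M * (c * node_weight a b m k))) * (p * Z k ^ r * Bernstein m k x))"
        using order_trans[OF abs_ge_zero F] s0 by (intro mult_left_mono[OF mult_mono[OF F P] _] wt0) auto
      also have "\<dots> = (d * c * p * M) * ((w k * Z k ^ r) * Bernstein m k x)"
        by (simp add: w_def mult_ac)
      also have "\<dots> \<le> (d * c * p * M) * (((w k)\<^sup>2 + (Z k ^ r)\<^sup>2) * Bernstein m k x)"
        using pos M0 B0 by (intro mult_left_mono mult_right_mono mult_le_sum_squares) auto
      finally show ?thesis by (simp add: distrib_right power_mult[symmetric] mult.commute[of 2 r])
    qed
    have "wt a b x * (phi x ^ r * \<bar>(deriv ^^ r) (bern_sum m ?F) x\<bar>)
       = sqrt (real m) ^ r * (wt a b x * (s ^ r * \<bar>\<Sum>k\<le>m. ?F k * ?P k\<bar>))"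
      by (simp add: funpow_deriv_bern_sum_poly phi power_mult_distrib mult_ac)
    also have "\<dots> \<le> sqrt (real m) ^ r * (wt a b x * (s ^ r * (\<Sum>k\<le>m. \<bar>?F k * ?P k\<bar>)))"
      using wt0 s0 by (intro mult_left_mono sum_abs) auto
    also have "\<dots> = sqrt (real m) ^ r * (\<Sum>k\<le>m. wt a b x * (s ^ r * \<bar>?F k * ?P k\<bar>))"
      by (simp add: sum_distrib_left)
    also have "\<dots> \<le> sqrt (real m) ^ r * (\<Sum>k\<le>m. (d * c * p * M) * ((w k)\<^sup>2 * Bernstein m k x + Z k ^ (2 * r) * Bernstein m k x))"
      by (intro mult_left_mono sum_mono each) auto
    also have "\<dots> = sqrt (real m) ^ r * ((d * c * p * M) * ((\<Sum>k\<le>m. (w k)\<^sup>2 * Bernstein m k x) + (\<Sum>k\<le>m. Z k ^ (2 * r) * Bernstein m k x)))"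
      unfolding sum.distrib[symmetric] sum_distrib_left ..
    also have "\<dots> \<le> sqrt (real m) ^ r * ((d * c * p * M) * (C1 + mom))"
    proof (intro mult_left_mono add_mono)
      have "(w k)\<^sup>2 = wt (2 * a) (2 * b) x * node_weight (2 * a) (2 * b) m k" for k
        unfolding w_def wt_def node_weight_def power2_eq_square mult_2 powr_add by (simp only: mult_ac)
      then have "(\<Sum>k\<le>m. (w k)\<^sup>2 * Bernstein m k x) = wt (2 * a) (2 * b) x * bern_sum m (node_weight (2 * a) (2 * b) m) x"
        by (simp add: bern_sum_def sum_distrib_left mult.assoc)
      then show "(\<Sum>k\<le>m. (w k)\<^sup>2 * Bernstein m k x) \<le> C1" using C1(2)[OF x m] by simp
      show "(\<Sum>k\<le>m. Z k ^ (2 * r) * Bernstein m k x) \<le> mom"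
        unfolding Z_def mom_def by (rule Bernstein_central_moment[OF x mx])
    qed (use pos M0 in auto)
    finally show ?thesis by (simp add: C_def mult_ac)
  qed
  with C show ?thesis by blast
qed

lemma deriv_bern_sum_Fn_bound:
  fixes la A :: real
  assumes r: "2 \<le> r" and psi: "\<And>t. 0 \<le> \<psi> t \<and> \<psi> t \<le> 1" and ab: "0 \<le> a" "0 \<le> b"
    and la: "0 \<le> la" and A: "1 \<le> A"
  shows "\<exists>C>0. \<forall>n m f M x. admissible r n \<longrightarrow> n \<le> m \<longrightarrow> real m \<le> A * real n \<longrightarrow>
       (\<forall>y\<in>{0<..<1}. \<bar>wt a b y * f y\<bar> \<le> M) \<longrightarrow> 0 < x \<longrightarrow> x < 1 \<longrightarrow>
       wt a b x * phi x powr (real r * la) * \<bar>(deriv ^^ r) (bern_sum m (\<lambda>k. Fn \<psi> r n f (real k / real m))) x\<bar>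
         \<le> C * (real n powr (real r / 2) * max (real n powr (real r * (1 - la) / 2)) (phi x powr (real r * (la - 1))) * M)"
proof -
  obtain C1 where C1: "C1 > 0"
    "\<forall>n m f M x. admissible r n \<longrightarrow> n \<le> m \<longrightarrow>
       (\<forall>y\<in>{0<..<1}. \<bar>wt a b y * f y\<bar> \<le> M) \<longrightarrow> 0 < x \<longrightarrow> x < 1 \<longrightarrow>
       wt a b x * \<bar>(deriv ^^ r) (bern_sum m (\<lambda>k. Fn \<psi> r n f (real k / real m))) x\<bar> \<le> C1 * real m ^ r * M"
    using deriv_bern_sum_Fn_uniform_bound[where \<psi> = \<psi>, OF r psi ab] by blast
  obtain C2 where C2: "C2 > 0"
    "\<forall>n m f M x. admissible r n \<longrightarrow> n \<le> m \<longrightarrow>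
       (\<forall>y\<in>{0<..<1}. \<bar>wt a b y * f y\<bar> \<le> M) \<longrightarrow> 0 < x \<longrightarrow> x < 1 \<longrightarrow> 1 \<le> real m * (x * (1 - x)) \<longrightarrow>
       wt a b x * (phi x ^ r * \<bar>(deriv ^^ r) (bern_sum m (\<lambda>k. Fn \<psi> r n f (real k / real m))) x\<bar>) \<le> C2 * sqrt (real m) ^ r * M"
    using deriv_bern_sum_Fn_interior_bound[where \<psi> = \<psi>, OF r psi ab] by blast
  define C where "C = C1 * A ^ r + C2 * sqrt A ^ r"
  have C: "C > 0" using C1(1) C2(1) A by (simp add: C_def add_pos_pos)
  have "wt a b x * phi x powr (real r * la) * \<bar>(deriv ^^ r) (bern_sum m (\<lambda>k. Fn \<psi> r n f (real k / real m))) x\<bar>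
         \<le> C * (real n powr (real r / 2) * max (real n powr (real r * (1 - la) / 2)) (phi x powr (real r * (la - 1))) * M)"
    if H: "admissible r n" "n \<le> m" and mA: "real m \<le> A * real n" and
      M: "\<forall>y\<in>{0<..<1}. \<bar>wt a b y * f y\<bar> \<le> M" and x: "0 < x" "x < 1" for n m f M x
  proof -
    define Q where "Q = \<bar>(deriv ^^ r) (bern_sum m (\<lambda>k. Fn \<psi> r n f (real k / real m))) x\<bar>"
    define mx where "mx = max (real n powr (real r * (1 - la) / 2)) (phi x powr (real r * (la - 1)))"
    have M0: "0 \<le> M" using order_trans[OF abs_ge_zero bspec[OF M, of "1/2"]] by simp
    have n: "0 < real n" using H by (auto simp: admissible_def)
    have ph: "0 < phi x" using x by (simp add: phi_def)
    have mx0: "0 \<le> mx" by (simp add: mx_def le_max_iff_disj)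
    have Q0: "0 \<le> Q" by (simp add: Q_def)
    have R: "0 \<le> real n powr (real r / 2) * mx * M" using mx0 M0 by simp
    have "wt a b x * phi x powr (real r * la) * Q \<le> (C1 * A ^ r + C2 * sqrt A ^ r) * (real n powr (real r / 2) * mx * M)"
    \<comment> \<open>In the first case \<open>n \<le> m\<close> makes the interior estimate
      applicable and the second entry of the maximum appears. In the other case \<open>phi x\<close>
      is at most \<open>n\<close> to the power \<open>-1/2\<close>, so the factor with exponent
      \<open>r * la\<close> improves the uniform bound and the first entry appears.\<close>
    proof (cases "1 \<le> real n * (x * (1 - x))")
      case True
      have "real n * (x * (1 - x)) \<le> real m * (x * (1 - x))" using H(2) x by (intro mult_right_mono) auto
      then have "1 \<le> real m * (x * (1 - x))" using True by linarith
      then have "wt a b x * (phi x ^ r * Q) \<le> C2 * sqrt (real m) ^ r * M" unfolding Q_def by (intro C2(2)[rule_format] H M[rule_format] x) auto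
      also have "\<dots> \<le> C2 * (sqrt A ^ r * real n powr (real r / 2)) * M"
      proof (intro mult_right_mono mult_left_mono)
        have "sqrt (real m) ^ r \<le> sqrt (A * real n) ^ r" using mA by (intro power_mono) auto
        also have "\<dots> = sqrt A ^ r * sqrt (real n) ^ r" by (simp add: real_sqrt_mult power_mult_distrib)
        also have "sqrt (real n) ^ r = real n powr (real r / 2)"
        proof -
          have e: "sqrt (real n) = real n powr (1 / 2)" by (simp add: powr_half_sqrt)
          have "sqrt (real n) ^ r = (real n powr (1 / 2)) powr real r"
            unfolding e using n by (subst powr_realpow) auto
          then show ?thesis by (simp add: powr_powr)
        qed
        finally show "sqrt (real m) ^ r \<le> sqrt A ^ r * real n powr (real r / 2)" .
      qed (use C2(1) M0 in auto)
      finally have le: "wt a b x * (phi x ^ r * Q) \<le> C2 * (sqrt A ^ r * real n powr (real r / 2)) * M" .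
      have "phi x powr (real r * la) = phi x ^ r * phi x powr (real r * (la - 1))"
      proof -
        have "phi x ^ r = phi x powr real r" using ph by (simp add: powr_realpow)
        then have "phi x ^ r * phi x powr (real r * (la - 1)) = phi x powr (real r + real r * (la - 1))"
          by (simp only: powr_add)
        then show ?thesis by (simp add: right_diff_distrib)
      qed
      then have "wt a b x * phi x powr (real r * la) * Q = (wt a b x * (phi x ^ r * Q)) * phi x powr (real r * (la - 1))"
        by (simp add: mult_ac)
      also have "\<dots> \<le> (C2 * (sqrt A ^ r * real n powr (real r / 2)) * M) * mx"
        by (rule mult_mono[OF le]) (use C2(1) M0 A in \<open>auto simp: mx_def\<close>)
      also have "\<dots> = (C2 * sqrt A ^ r) * (real n powr (real r / 2) * mx * M)" by (simp add: mult_ac)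
      also have "\<dots> \<le> (C1 * A ^ r + C2 * sqrt A ^ r) * (real n powr (real r / 2) * mx * M)"
        using R C1(1) A by (intro mult_right_mono) auto
      finally show ?thesis .
    next
      case False
      have "wt a b x * Q \<le> C1 * real m ^ r * M" unfolding Q_def by (intro C1(2)[rule_format] H M[rule_format] x) auto
      also have "\<dots> \<le> C1 * (A ^ r * real n powr real r) * M"
      proof (intro mult_right_mono mult_left_mono)
        have "real m ^ r \<le> (A * real n) ^ r" using mA by (intro power_mono) auto
        then show "real m ^ r \<le> A ^ r * real n powr real r" using n by (simp add: power_mult_distrib powr_realpow)
      qed (use C1(1) M0 in auto)
      finally have le: "wt a b x * Q \<le> C1 * (A ^ r * real n powr real r) * M" .
      have "phi x \<le> sqrt (1 / n)" unfolding phi_def using False n by (intro real_sqrt_le_mono) (simp add: field_simps)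
      also have "\<dots> = real n powr - (1 / 2)"
        by (simp only: powr_minus_divide powr_half_sqrt[OF of_nat_0_le_iff] real_sqrt_divide real_sqrt_one)
      finally have "phi x powr (real r * la) \<le> (real n powr - (1 / 2)) powr (real r * la)"
        using ph la by (intro powr_mono2) auto
      also have "\<dots> = real n powr (- (real r * la) / 2)" by (simp add: powr_powr)
      finally have ple: "phi x powr (real r * la) \<le> real n powr (- (real r * la) / 2)" .
      have "wt a b x * phi x powr (real r * la) * Q = (wt a b x * Q) * phi x powr (real r * la)" by (simp add: mult_ac)
      also have "\<dots> \<le> (C1 * (A ^ r * real n powr real r) * M) * real n powr (- (real r * la) / 2)"
        by (rule mult_mono[OF le ple]) (use C1(1) M0 A in auto)
      also have "\<dots> = (C1 * A ^ r) * ((real n powr real r * real n powr (- (real r * la) / 2)) * M)" by (simp add: mult_ac)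
      \<comment> \<open>The exponent \<open>r - r * la / 2\<close> is regrouped as
        \<open>r / 2 + r * (1 - la) / 2\<close>.\<close>
      also have "real n powr real r * real n powr (- (real r * la) / 2) = real n powr (real r / 2) * real n powr (real r * (1 - la) / 2)"
        unfolding powr_add[symmetric] by (rule arg_cong[where f = "\<lambda>t. real n powr t"]) (simp add: field_simps)
      also have "(C1 * A ^ r) * ((real n powr (real r / 2) * real n powr (real r * (1 - la) / 2)) * M)
          \<le> (C1 * A ^ r) * ((real n powr (real r / 2) * mx) * M)"
        using C1(1) A M0 by (intro mult_left_mono mult_right_mono) (auto simp: mx_def)
      also have "\<dots> \<le> (C1 * A ^ r + C2 * sqrt A ^ r) * (real n powr (real r / 2) * mx * M)"
        using R C2(1) A by (intro mult_right_mono) auto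
      finally show ?thesis .
    qed
    then show ?thesis by (simp only: Q_def mx_def C_def)
  qed
  with C show ?thesis by blast
qed

lemma comb_conditions_range:
  assumes "comb_conditions r nn c A n" "i \<le> r - 2"
  shows "n \<le> nn n i" "real (nn n i) \<le> A * real n"
proof -
  have inc: "\<And>i. i < r - 2 \<Longrightarrow> nn n i < nn n (Suc i)" and nn0: "nn n 0 = n" and top: "real (nn n (r - 2)) \<le> A * real n"
    using assms(1) by (auto simp: comb_conditions_def)
  have up: "nn n i \<le> nn n j" if "i \<le> j" "j \<le> r - 2" for i j
    using that
  proof (induction j rule: dec_induct)
    case (step j)
    then show ?case using inc[of j] by simp
  qed simp
  show "n \<le> nn n i" using up[of 0 i] assms(2) nn0 by simp
  have "real (nn n i) \<le> real (nn n (r - 2))" using up[of i "r - 2"] assms(2) by simp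
  then show "real (nn n i) \<le> A * real n" using top by linarith
qed

theorem theorem2:
  fixes r :: nat and \<alpha> \<beta> la A :: real
    and \<psi> :: "real \<Rightarrow> real"
    and nn :: "nat \<Rightarrow> nat \<Rightarrow> nat" and c :: "nat \<Rightarrow> nat \<Rightarrow> real"
  assumes r: "2 \<le> r"
    and ab: "0 < \<alpha>" "0 < \<beta>"
    and lam: "0 \<le> la" "la \<le> 1"
    and psi_smooth: "smooth_fun \<psi>"
    and psi_range: "\<And>t. 0 \<le> \<psi> t \<and> \<psi> t \<le> 1"
    and psi0: "\<And>t. t \<le> 0 \<Longrightarrow> \<psi> t = 0"
    and psi1: "\<And>t. 1 \<le> t \<Longrightarrow> \<psi> t = 1"
    and comb: "\<And>n. admissible r n \<Longrightarrow> comb_conditions r nn c A n"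
  shows "\<exists>C>0.
    (\<forall>n f M x. admissible r n \<and> f \<in> Cw \<alpha> \<beta>
        \<and> (\<forall>y\<in>{0<..<1}. \<bar>wt \<alpha> \<beta> y * f y\<bar> \<le> M) \<and> x \<in> {0<..<1} \<longrightarrow>
        \<bar>wt \<alpha> \<beta> x * phi x powr (real r * la) * (deriv ^^ r) (Bstar \<psi> r nn c n f) x\<bar>
          \<le> C * real n powr (real r / 2)
              * max (real n powr (real r * (1 - la) / 2)) (phi x powr (real r * (la - 1))) * M)
    \<and> (\<forall>n f g M x. admissible r n \<and> f \<in> Cw \<alpha> \<beta> \<and> ac_deriv_class r f \<and> is_rth_deriv r f g
        \<and> (\<forall>y\<in>{0<..<1}. \<bar>wt \<alpha> \<beta> y * phi y powr (real r * la) * g y\<bar> \<le> M) \<and> x \<in> {0<..<1} \<longrightarrow>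
        \<bar>wt \<alpha> \<beta> x * phi x powr (real r * la) * (deriv ^^ r) (Bstar \<psi> r nn c n f) x\<bar> \<le> C * M)"
proof -
  \<comment> \<open>Positivity of the final constant relies on this. It follows from the range of
    the degrees at index 0 for any one admissible \<open>n\<close>.\<close>
  have A: "1 \<le> A"
  proof -
    define n where "n = max 4 (Suc r)"
    have "admissible r n" by (simp add: admissible_def n_def)
    from comb_conditions_range[OF comb[OF this], of 0] have "1 * real n \<le> A * real n" by linarith
    moreover have "0 < real n" by (simp add: n_def)
    ultimately show ?thesis by (rule mult_right_le_imp_le)
  qed
  \<comment> \<open>\<open>phi\<close> to the power \<open>r * la\<close> is itself a weight with
    both exponents \<open>r * la / 2\<close>, so the smooth case becomes an estimate with enlarged
    exponents.\<close>
  define a where "a = \<alpha> + real r * la / 2"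
  define b where "b = \<beta> + real r * la / 2"
  have ab0: "0 \<le> \<alpha>" "0 \<le> \<beta>" "0 \<le> a" "0 \<le> b" using ab lam by (auto simp: a_def b_def)
  obtain C1 where C1: "C1 > 0"
    "\<forall>n m f M x. admissible r n \<longrightarrow> n \<le> m \<longrightarrow> real m \<le> A * real n \<longrightarrow>
       (\<forall>y\<in>{0<..<1}. \<bar>wt \<alpha> \<beta> y * f y\<bar> \<le> M) \<longrightarrow> 0 < x \<longrightarrow> x < 1 \<longrightarrow>
       wt \<alpha> \<beta> x * phi x powr (real r * la) * \<bar>(deriv ^^ r) (bern_sum m (\<lambda>k. Fn \<psi> r n f (real k / real m))) x\<bar>
         \<le> C1 * (real n powr (real r / 2) * max (real n powr (real r * (1 - la) / 2)) (phi x powr (real r * (la - 1))) * M)"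
    using deriv_bern_sum_Fn_bound[where \<psi> = \<psi>, OF r psi_range ab0(1,2) lam(1) A] by blast
  obtain C2 where C2: "C2 > 0"
    "\<forall>n m f g M x. admissible r n \<longrightarrow> n \<le> m \<longrightarrow> ac_deriv_class r f \<longrightarrow> is_rth_deriv r f g \<longrightarrow>
       (\<forall>y\<in>{0<..<1}. \<bar>wt a b y * g y\<bar> \<le> M) \<longrightarrow> 0 < x \<longrightarrow> x < 1 \<longrightarrow>
       wt a b x * \<bar>(deriv ^^ r) (bern_sum m (\<lambda>k. Fn \<psi> r n f (real k / real m))) x\<bar> \<le> C2 * M"
    using deriv_bern_sum_Fn_smooth_bound[where \<psi> = \<psi>, OF r psi_smooth psi_range psi0 psi1 ab0(3,4)] by blast
  \<comment> \<open>A bound common to all degrees between \<open>n\<close> and \<open>A * n\<close>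
    passes to the combination at the cost of the absolute coefficient sum.\<close>
  have combine: "\<bar>w * (deriv ^^ r) (Bstar \<psi> r nn c n f) x\<bar> \<le> A * Q"
    if n: "admissible r n" and w: "0 \<le> w"
      and Q: "\<And>m. n \<le> m \<Longrightarrow> real m \<le> A * real n \<Longrightarrow>
        w * \<bar>(deriv ^^ r) (bern_sum m (\<lambda>k. Fn \<psi> r n f (real k / real m))) x\<bar> \<le> Q" for n f x w Q
  proof -
    let ?B = "\<lambda>i. (deriv ^^ r) (bern_sum (nn n i) (\<lambda>k. Fn \<psi> r n f (real k / real (nn n i)))) x"
    \<comment> \<open>The choice \<open>m = n\<close> is allowed, and it shows that \<open>Q\<close>
      is nonnegative.\<close>
    have "real n \<le> A * real n" using mult_right_mono[OF A, of "real n"] by simp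
    then have "0 \<le> w * \<bar>(deriv ^^ r) (bern_sum n (\<lambda>k. Fn \<psi> r n f (real k / real n))) x\<bar> \<and>
        w * \<bar>(deriv ^^ r) (bern_sum n (\<lambda>k. Fn \<psi> r n f (real k / real n))) x\<bar> \<le> Q"
      using Q[of n] w by simp
    then have Q0: "0 \<le> Q" by linarith
    have "\<bar>w * (deriv ^^ r) (Bstar \<psi> r nn c n f) x\<bar> = w * \<bar>\<Sum>i=0..r-2. c n i * ?B i\<bar>"
      using w by (simp add: funpow_deriv_Bstar abs_mult)
    also have "\<dots> \<le> w * (\<Sum>i=0..r-2. \<bar>c n i * ?B i\<bar>)"
      using w by (intro mult_left_mono sum_abs)
    also have "\<dots> = (\<Sum>i=0..r-2. \<bar>c n i\<bar> * (w * \<bar>?B i\<bar>))"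
      by (simp add: sum_distrib_left abs_mult mult_ac)
    also have "\<dots> \<le> (\<Sum>i=0..r-2. \<bar>c n i\<bar> * Q)"
      using comb_conditions_range[OF comb[OF n]] by (intro sum_mono mult_left_mono Q) auto
    also have "\<dots> = (\<Sum>i=0..r-2. \<bar>c n i\<bar>) * Q" by (simp add: sum_distrib_right)
    also have "\<dots> \<le> A * Q"
      using comb[OF n] Q0 by (intro mult_right_mono) (auto simp: comb_conditions_def)
    finally show ?thesis .
  qed
  define C where "C = A * (C1 + C2)"
  have C: "C > 0" using A C1(1) C2(1) by (simp add: C_def add_pos_pos)
  have w0: "0 \<le> wt \<alpha> \<beta> x * phi x powr (real r * la)" for x by (simp add: wt_def)
  show ?thesis
  proof (intro exI[of _ C] conjI C allI impI; elim conjE)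
    fix n :: nat and f :: "real \<Rightarrow> real" and M x :: real
    assume H: "admissible r n" "\<forall>y\<in>{0<..<1}. \<bar>wt \<alpha> \<beta> y * f y\<bar> \<le> M" "x \<in> {0<..<1}"
    let ?R = "real n powr (real r / 2) * max (real n powr (real r * (1 - la) / 2)) (phi x powr (real r * (la - 1))) * M"
    have M0: "0 \<le> M" using order_trans[OF abs_ge_zero bspec[OF H(2), of "1/2"]] by simp
    have "\<bar>wt \<alpha> \<beta> x * phi x powr (real r * la) * (deriv ^^ r) (Bstar \<psi> r nn c n f) x\<bar> \<le> A * (C1 * ?R)"
      by (rule combine[OF H(1) w0]) (use H in \<open>auto intro!: C1(2)[rule_format]\<close>)
    also have "\<dots> = (A * C1) * ?R" by simp
    also have "\<dots> \<le> C * ?R"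
      using A C1(1) C2(1) M0 by (intro mult_right_mono) (auto simp: C_def le_max_iff_disj)
    finally show "\<bar>wt \<alpha> \<beta> x * phi x powr (real r * la) * (deriv ^^ r) (Bstar \<psi> r nn c n f) x\<bar>
          \<le> C * real n powr (real r / 2)
              * max (real n powr (real r * (1 - la) / 2)) (phi x powr (real r * (la - 1))) * M"
      by (simp only: mult.assoc)
  next
    fix n :: nat and f g :: "real \<Rightarrow> real" and M x :: real
    assume H: "admissible r n" "ac_deriv_class r f" "is_rth_deriv r f g"
      "\<forall>y\<in>{0<..<1}. \<bar>wt \<alpha> \<beta> y * phi y powr (real r * la) * g y\<bar> \<le> M" "x \<in> {0<..<1}"
    have eq: "wt \<alpha> \<beta> y * phi y powr (real r * la) = wt a b y" if "y \<in> {0<..<1}" for y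
      using that wt_mult_phi_powr[of y \<alpha> \<beta> "real r * la"] by (simp add: a_def b_def)
    have M: "\<bar>wt a b y * g y\<bar> \<le> M" if "y \<in> {0<..<1}" for y
      using bspec[OF H(4) that] unfolding eq[OF that] .
    have M0: "0 \<le> M" using order_trans[OF abs_ge_zero M[of "1/2"]] by simp
    have "\<bar>wt \<alpha> \<beta> x * phi x powr (real r * la) * (deriv ^^ r) (Bstar \<psi> r nn c n f) x\<bar> \<le> A * (C2 * M)"
    proof (rule combine[OF H(1) w0])
      fix m assume "n \<le> m"
      then show "wt \<alpha> \<beta> x * phi x powr (real r * la) * \<bar>(deriv ^^ r) (bern_sum m (\<lambda>k. Fn \<psi> r n f (real k / real m))) x\<bar> \<le> C2 * M"
        unfolding eq[OF H(5)] using H M by (intro C2(2)[rule_format]) auto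
    qed
    also have "\<dots> = (A * C2) * M" by simp
    also have "\<dots> \<le> C * M" using A C1(1) M0 by (intro mult_right_mono) (auto simp: C_def)
    finally show "\<bar>wt \<alpha> \<beta> x * phi x powr (real r * la) * (deriv ^^ r) (Bstar \<psi> r nn c n f) x\<bar> \<le> C * M" .
  qed
qed

end
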